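(* Let $(\mathcal{A},\tau)$ be a non-commutative probability space, where $\mathcal{A}$ is a unital $C^*$-algebra and $\tau$ is a positive, faithful, tracial linear functional with $\tau(1_{\mathcal{A}})=1$. Let $x,s\in\mathcal{A}$ be self-adjoint and freely independent with respect to $\tau$, with the distribution of $x$ freely infinitely divisible and $s$ semicircular. Then the distribution of $x+i[x,s]$ is freely infinitely divisible.
   Context: Here $[a,b]=ab-ba$ and $i$ is the imaginary unit, so $x+i[x,s]$ is self-adjoint. The distribution of a self-adjoint $a\in\mathcal{A}$ is the compactly supported probability measure $\mu_a$ on $\mathbb{R}$ with $\int t^n\,d\mu_a(t)=\tau(a^n)$ for all $n\ge 0$. A probability measure $\mu$ on $\mathbb{R}$ is freely infinitely divisible if for every integer $n\ge 1$ there is a probability measure $\mu_n$ on $\mathbb{R}$ with $\mu=\mu_n\boxplus\cdots\boxplus\mu_n$ ($n$ times), where $\boxplus$ is free additive convolution. An element $s$ is semicircular if it is self-adjoint and its only non-vanishing free cumulant is $\kappa_2(s)>0$ (centered semicircle law). *)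

theory Defs
  imports "HOL-Probability.Probability" "HOL-Library.Disjoint_Sets"
begin

section \<open>Unital C*-algebras\<close>

text \<open>The superclasses contribute the ring structure, the complete submultiplicative norm and
  \<open>norm 1 = 1\<close>; the last only excludes the zero algebra, which carries no functional with
  \<open>\<tau> 1 = 1\<close>.\<close>

class unital_cstar_algebra = real_normed_algebra_1 + banach +
  fixes scaleC :: "complex \<Rightarrow> 'a \<Rightarrow> 'a" (infixr \<open>*\<^sub>C\<close> 75)
    and star :: "'a \<Rightarrow> 'a"
  assumes scaleC_add_right: "c *\<^sub>C (x + y) = c *\<^sub>C x + c *\<^sub>C y"
    and scaleC_add_left: "(c + d) *\<^sub>C x = c *\<^sub>C x + d *\<^sub>C x"
    and scaleC_scaleC: "c *\<^sub>C d *\<^sub>C x = (c * d) *\<^sub>C x"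
    and scaleC_of_real: "complex_of_real r *\<^sub>C x = r *\<^sub>R x"
    and norm_scaleC: "norm (c *\<^sub>C x) = cmod c * norm x"
    and scaleC_mult_left: "(c *\<^sub>C x) * y = c *\<^sub>C (x * y)"
    and scaleC_mult_right: "x * (c *\<^sub>C y) = c *\<^sub>C (x * y)"
    and star_star: "star (star x) = x"
    and star_add: "star (x + y) = star x + star y"
    and star_scaleC: "star (c *\<^sub>C x) = cnj c *\<^sub>C star x"
    and star_mult: "star (x * y) = star y * star x"
    and cstar_identity: "norm (star x * x) = (norm x)\<^sup>2"

definition selfadjoint :: "'a::unital_cstar_algebra \<Rightarrow> bool" where
  "selfadjoint a \<longleftrightarrow> star a = a"

definition commutator :: "'a::ring \<Rightarrow> 'a \<Rightarrow> 'a" where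
  "commutator a b = a * b - b * a"

section \<open>Non-commutative probability spaces\<close>

locale ncps =
  fixes \<tau> :: "'a::unital_cstar_algebra \<Rightarrow> complex"
  assumes add: "\<tau> (a + b) = \<tau> a + \<tau> b"
    and scaleC: "\<tau> (c *\<^sub>C a) = c * \<tau> a"
    and positive: "\<tau> (star a * a) \<in> \<real>\<^sub>\<ge>\<^sub>0"
    and faithful: "\<tau> (star a * a) = 0 \<Longrightarrow> a = 0"
    and tracial: "\<tau> (a * b) = \<tau> (b * a)"
    and unit: "\<tau> 1 = 1"

inductive_set unital_subalgebra :: "'a::unital_cstar_algebra set \<Rightarrow> 'a set" for S where
  one: "1 \<in> unital_subalgebra S"
| gen: "a \<in> S \<Longrightarrow> a \<in> unital_subalgebra S"
| add: "a \<in> unital_subalgebra S \<Longrightarrow> b \<in> unital_subalgebra S \<Longrightarrow> a + b \<in> unital_subalgebra S"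
| scaleC: "a \<in> unital_subalgebra S \<Longrightarrow> c *\<^sub>C a \<in> unital_subalgebra S"
| mult: "a \<in> unital_subalgebra S \<Longrightarrow> b \<in> unital_subalgebra S \<Longrightarrow> a * b \<in> unital_subalgebra S"

definition free_subalgebras ::
    "('a::unital_cstar_algebra \<Rightarrow> complex) \<Rightarrow> 'i set \<Rightarrow> ('i \<Rightarrow> 'a set) \<Rightarrow> bool" where
  "free_subalgebras \<tau> I B \<longleftrightarrow>
    (\<forall>ks as. ks \<noteq> [] \<and> length as = length ks \<and> set ks \<subseteq> I \<and> distinct_adj ks \<and>
       (\<forall>j<length ks. as ! j \<in> B (ks ! j) \<and> \<tau> (as ! j) = 0) \<longrightarrow>
       \<tau> (prod_list as) = 0)"

definition freely_independent ::
    "('a::unital_cstar_algebra \<Rightarrow> complex) \<Rightarrow> 'a \<Rightarrow> 'a \<Rightarrow> bool" where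
  "freely_independent \<tau> a b \<longleftrightarrow>
    free_subalgebras \<tau> UNIV (\<lambda>k::bool. unital_subalgebra {if k then a else b})"

text \<open>Every measure satisfying this predicate is determined by \<open>\<tau>\<close> and \<open>a\<close>, since a compactly
  supported measure is determined by its moments.\<close>

definition is_distribution ::
    "('a::unital_cstar_algebra \<Rightarrow> complex) \<Rightarrow> 'a \<Rightarrow> real measure \<Rightarrow> bool" where
  "is_distribution \<tau> a \<mu> \<longleftrightarrow>
    real_distribution \<mu> \<and> (\<exists>K. compact K \<and> measure \<mu> K = 1) \<and>
    (\<forall>n. complex_of_real (LINT t|\<mu>. t ^ n) = \<tau> (a ^ n))"

section \<open>Free cumulants\<close>

definition noncrossing :: "nat set set \<Rightarrow> bool" where
  "noncrossing P \<longleftrightarrow>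
    \<not> (\<exists>V\<in>P. \<exists>W\<in>P. V \<noteq> W \<and>
        (\<exists>i j k l. i < j \<and> j < k \<and> k < l \<and> i \<in> V \<and> k \<in> V \<and> j \<in> W \<and> l \<in> W))"

definition NC :: "nat \<Rightarrow> nat set set set" where
  "NC n = {P. partition_on {..<n} P \<and> noncrossing P}"

lemma length_nths_less:
  assumes "P \<in> NC (length as) - {{{..<length as}}}" "V \<in> P"
  shows "length (nths as V) < length as"
proof -
  have P: "partition_on {..<length as} P" and ne: "P \<noteq> {{..<length as}}"
    using assms(1) by (auto simp: NC_def)
  have sub: "V \<subseteq> {..<length as}"
    using P assms(2) by (auto simp: partition_on_def)
  have "V \<noteq> {..<length as}"
  proof
    assume V: "V = {..<length as}"
    have "W = V" if W: "W \<in> P" for W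
    proof (rule ccontr)
      assume "W \<noteq> V"
      then have "W \<inter> V = {}"
        using partition_onD2[OF P] W assms(2) by (auto simp: disjoint_def)
      moreover have "W \<subseteq> V"
        using partition_onD1[OF P] W V by auto
      moreover have "W \<noteq> {}"
        using partition_onD3[OF P] W by auto
      ultimately show False by blast
    qed
    then show False using ne V assms(2) by blast
  qed
  then have "card V < length as"
    using sub psubset_card_mono[of "{..<length as}" V] by auto
  moreover have "{i. i < length as \<and> i \<in> V} = V"
    using sub by auto
  ultimately show ?thesis by (simp add: length_nths)
qed

text \<open>The moment-cumulant formula
  \<open>\<tau> (a\<^sub>1 \<cdots> a\<^sub>n) = (\<Sum>P\<in>NC n. \<Prod>V\<in>P. \<kappa> (nths [a\<^sub>1, \<dots>, a\<^sub>n] V))\<close>,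
  solved for the term of the one-block partition; positions are counted from 0.\<close>

context notes sum.cong[fundef_cong] prod.cong[fundef_cong] begin

function free_cumulant :: "('a::unital_cstar_algebra \<Rightarrow> complex) \<Rightarrow> 'a list \<Rightarrow> complex" where
  "free_cumulant \<tau> as = \<tau> (prod_list as) -
    (\<Sum>P \<in> NC (length as) - {{{..<length as}}}. \<Prod>V\<in>P. free_cumulant \<tau> (nths as V))"
  by auto
termination
  by (relation "Wellfounded.measure (\<lambda>(_, as). length as)") (auto intro!: length_nths_less)

end

declare free_cumulant.simps[simp del]

definition semicircular :: "('a::unital_cstar_algebra \<Rightarrow> complex) \<Rightarrow> 'a \<Rightarrow> bool" where
  "semicircular \<tau> s \<longleftrightarrow> selfadjoint s \<and>
    (\<exists>v>0. free_cumulant \<tau> (replicate 2 s) = complex_of_real v) \<and>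
    (\<forall>n\<ge>1. n \<noteq> 2 \<longrightarrow> free_cumulant \<tau> (replicate n s) = 0)"

section \<open>Free additive convolution and free infinite divisibility\<close>

text \<open>Free additive convolution of arbitrary, possibly unbounded, probability measures on the line
  (Bercovici and Voiculescu): \<open>\<mu> \<boxplus> \<nu>\<close> is the probability measure whose Voiculescu transform is the
  sum of those of \<open>\<mu>\<close> and \<open>\<nu>\<close> on a truncated cone.\<close>

definition cauchy_transform :: "real measure \<Rightarrow> complex \<Rightarrow> complex" where
  "cauchy_transform \<mu> z = (LINT t|\<mu>. 1 / (z - complex_of_real t))"

definition truncated_cone :: "real \<Rightarrow> real \<Rightarrow> complex set" where
  "truncated_cone \<alpha> \<beta> = {z. Im z > \<beta> \<and> \<bar>Re z\<bar> < \<alpha> * Im z}"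

text \<open>With \<open>F = 1 / cauchy_transform \<mu>\<close>, the map \<open>z \<mapsto> z + \<phi> z\<close> is a right inverse of \<open>F\<close>. The
  function \<open>F\<close> need not be injective on the upper half-plane; the growth condition selects the branch
  with \<open>F\<^sup>-\<^sup>1(z) \<sim> z\<close>, which makes \<open>\<phi>\<close> unique.\<close>

definition is_voiculescu_transform ::
    "real measure \<Rightarrow> real \<Rightarrow> real \<Rightarrow> (complex \<Rightarrow> complex) \<Rightarrow> bool" where
  "is_voiculescu_transform \<mu> \<alpha> \<beta> \<phi> \<longleftrightarrow>
    \<phi> holomorphic_on truncated_cone \<alpha> \<beta> \<and>
    (\<forall>z\<in>truncated_cone \<alpha> \<beta>. Im (z + \<phi> z) > 0 \<and> 1 / cauchy_transform \<mu> (z + \<phi> z) = z) \<and>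
    ((\<lambda>z. \<phi> z / z) \<longlongrightarrow> 0) (inf at_infinity (principal (truncated_cone \<alpha> \<beta>)))"

definition is_free_convolution :: "real measure \<Rightarrow> real measure \<Rightarrow> real measure \<Rightarrow> bool" where
  "is_free_convolution \<mu> \<nu> \<rho> \<longleftrightarrow>
    real_distribution \<mu> \<and> real_distribution \<nu> \<and> real_distribution \<rho> \<and>
    (\<exists>\<alpha>>0. \<exists>\<beta>>0. \<exists>\<phi> \<psi>.
      is_voiculescu_transform \<mu> \<alpha> \<beta> \<phi> \<and> is_voiculescu_transform \<nu> \<alpha> \<beta> \<psi> \<and>
      is_voiculescu_transform \<rho> \<alpha> \<beta> (\<lambda>z. \<phi> z + \<psi> z))"

inductive is_free_convolution_power :: "real measure \<Rightarrow> nat \<Rightarrow> real measure \<Rightarrow> bool" for \<mu> where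
  one: "real_distribution \<mu> \<Longrightarrow> is_free_convolution_power \<mu> 1 \<mu>"
| Suc: "is_free_convolution_power \<mu> n \<rho> \<Longrightarrow> is_free_convolution \<rho> \<mu> \<sigma> \<Longrightarrow>
    is_free_convolution_power \<mu> (Suc n) \<sigma>"

definition freely_infinitely_divisible :: "real measure \<Rightarrow> bool" where
  "freely_infinitely_divisible \<mu> \<longleftrightarrow> real_distribution \<mu> \<and>
    (\<forall>n\<ge>1. \<exists>\<mu>\<^sub>n. real_distribution \<mu>\<^sub>n \<and> is_free_convolution_power \<mu>\<^sub>n n \<mu>)"

end

theory Submission
  imports Defs "HOL-Complex_Analysis.Complex_Analysis"
begin

text \<open>For a compactly supported law, free infinite divisibility means that the R-transform \<open>R\<close> has a
  Levy form \<open>R w = R 0 + \<beta> \<integral> w / (1 - w t) d\<pi>(t)\<close>, and this holds iff the kernel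
  \<open>w \<zeta> (R w - R \<zeta>) / (w - \<zeta>)\<close>, with \<open>\<zeta>\<close> the conjugate of \<open>z\<close>, is conditionally positive semidefinite for small
  \<open>w\<close> and \<open>z\<close> on a ray.

  For \<open>y = x + i[x,s]\<close> with \<open>s\<close> of variance \<open>v\<close>, the Schwinger-Dyson equation for \<open>s\<close> gives a closed recursion
  for the moments \<open>\<tau> (y\<^sup>n x\<^sup>j)\<close>. Their generating functions \<open>S\<^sub>j\<close> in \<open>n\<close> are integrals of
  \<open>t\<^sup>j / (a - c t - e t\<^sup>2)\<close> against the law of \<open>x\<close>, with \<open>a\<close>, \<open>c\<close>, \<open>e\<close> given by \<open>S\<^sub>0\<close>, \<open>S\<^sub>1\<close>, \<open>S\<^sub>2\<close>. Factoring
  the denominator, the Cauchy transform of \<open>y\<close> becomes a sum \<open>P + Q\<close> of two values of that of \<open>x\<close>. In terms of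
  \<open>N = - P Q / (P + Q)\<close>, \<open>u = 1 / (P + Q)\<close> and the Levy form of \<open>x\<close>, with \<open>H = \<beta> \<integral> 1 / (u - t - N t\<^sup>2) d\<pi>(t)\<close>, one gets
  \<open>N (u - v H) = v\<close> and \<open>R\<^sub>y(1/u) = \<alpha> + \<beta> \<integral> ((1 + N t)\<^sup>2 / (u - t - N t\<^sup>2) + N) d\<pi>(t) + N u H\<close>. The first
  relation shows that \<open>N\<close> and \<open>H\<close> have positive semidefinite kernels, by a geometric series that converges for
  large \<open>u\<close>; the second writes the kernel of \<open>R\<^sub>y\<close> as a sum of positive ones.\<close>

section \<open>The moment problem on a compact interval\<close>

text \<open>The obstacle is that nothing is available globally. For \<open>x + i[x,s]\<close> there
  is only a convergent moment series near 0, and the convolution roots supplied by the hypothesis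
  may have unbounded support, so that their transforms are controlled only far up a cone. Continuing
  functions to the upper half-plane and fixing the sign of imaginary parts is therefore avoided.
  Positivity of a kernel at finitely many points is local: it can be tested on a short segment of a
  ray, it survives sums, limits, integrals and geometric series, and near 0 it already yields all
  Hankel forms of the Taylor coefficients. The ray is the imaginary axis because every truncated
  cone contains its upper end.

  Positivity is only conditional on the side of \<open>x\<close>, where
  \<open>1 / (1 - L / n)\<close> is a Gram kernel and just its first-order term in
  \<open>1 / n\<close> is wanted; the test vectors of the converse annihilate constants anyway. On
  the side of \<open>x + i[x,s]\<close> the two roots of the quadratic have no preferred labelling,
  and passing to \<open>N\<close> and \<open>u\<close>, symmetric in \<open>P\<close> and
  \<open>Q\<close>, removes the ambiguity before any kernel is formed.\<close>

definition moment_functional :: "(nat \<Rightarrow> real) \<Rightarrow> real poly \<Rightarrow> real" where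
  "moment_functional q p = (\<Sum>i\<le>degree p. coeff p i * q i)"

lemma moment_functional_eq:
  assumes "degree p \<le> n"
  shows "moment_functional q p = (\<Sum>i\<le>n. coeff p i * q i)"
  unfolding moment_functional_def using assms
  by (intro sum.mono_neutral_left) (auto simp: coeff_eq_0)

lemma moment_functional_add:
  "moment_functional q (p + r) = moment_functional q p + moment_functional q r"
proof -
  let ?n = "max (degree p) (degree r)"
  have "degree (p + r) \<le> ?n"
    by (rule degree_add_le_max)
  then show ?thesis
    by (simp add: moment_functional_eq[of _ ?n] sum.distrib algebra_simps)
qed

lemma moment_functional_smult:
  "moment_functional q (smult c p) = c * moment_functional q p"
  by (simp add: moment_functional_eq[of _ "degree p"] moment_functional_eq[of p "degree p"]
      degree_smult_le sum_distrib_left mult.assoc)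

lemma moment_functional_0 [simp]: "moment_functional q 0 = 0"
  by (simp add: moment_functional_def)

lemma moment_functional_sum:
  "moment_functional q (\<Sum>i\<in>A. p i) = (\<Sum>i\<in>A. moment_functional q (p i))"
  by (induction A rule: infinite_finite_induct) (auto simp: moment_functional_add)

lemma moment_functional_monom: "moment_functional q (monom c n) = c * q n"
  by (simp add: moment_functional_eq[of _ n] degree_monom_le if_distrib[of "\<lambda>x. x * _"] cong: if_cong)

lemma moment_functional_monom_mult:
  "moment_functional q (monom c n * p) = c * (\<Sum>i\<le>degree p. coeff p i * q (n + i))"
proof -
  have "monom c n * p = (\<Sum>i\<le>degree p. monom (c * coeff p i) (n + i))"
    by (subst (1) poly_as_sum_of_monoms[symmetric]) (simp add: sum_distrib_left mult_monom)
  then show ?thesis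
    by (simp add: moment_functional_sum moment_functional_monom sum_distrib_left mult.assoc)
qed

lemma moment_functional_mult:
  "moment_functional q (p * r) =
    (\<Sum>i\<le>degree p. \<Sum>j\<le>degree r. coeff p i * coeff r j * q (i + j))"
proof -
  have "p * r = (\<Sum>i\<le>degree p. monom (coeff p i) i * r)"
    by (subst (1) poly_as_sum_of_monoms[symmetric]) (simp add: sum_distrib_right)
  then show ?thesis
    by (simp add: moment_functional_sum moment_functional_monom_mult sum_distrib_left mult.assoc)
qed

definition hankel_psd :: "(nat \<Rightarrow> real) \<Rightarrow> bool" where
  "hankel_psd q \<longleftrightarrow> (\<forall>N a. 0 \<le> (\<Sum>i<N. \<Sum>j<N. a i * a j * q (i + j)))"

text \<open>The geometric bound replaces a support condition: \<open>T\<close> becomes the radius of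
  the support of the representing measure, whereas \<open>C\<close> leaves no trace in it.\<close>

locale bounded_moment_sequence =
  fixes q :: "nat \<Rightarrow> real" and C T :: real
  assumes psd: "hankel_psd q" and T: "T > 0" and bound: "\<bar>q n\<bar> \<le> C * T ^ n"
begin

abbreviation L where "L \<equiv> moment_functional q"

lemma square_nonneg: "0 \<le> L (p * p)"
proof -
  have "0 \<le> (\<Sum>i<Suc (degree p). \<Sum>j<Suc (degree p). coeff p i * coeff p j * q (i + j))"
    using psd unfolding hankel_psd_def by blast
  then show ?thesis
    by (simp only: moment_functional_mult lessThan_Suc_atMost)
qed

lemma Cauchy_Schwarz: "(L (p * r))\<^sup>2 \<le> L (p * p) * L (r * r)"
proof -
  have *: "0 \<le> L (p * p) + 2 * c * L (p * r) + c\<^sup>2 * L (r * r)" for c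
  proof -
    have "(p + smult c r) * (p + smult c r) = p * p + smult (2 * c) (p * r) + smult (c\<^sup>2) (r * r)"
      by (rule poly_eq_poly_eq_iff[THEN iffD1]) (simp add: fun_eq_iff power2_eq_square algebra_simps)
    then show ?thesis
      using square_nonneg[of "p + smult c r"]
      by (simp add: moment_functional_add moment_functional_smult)
  qed
  show ?thesis
  proof (cases "L (r * r) = 0")
    case True
    have "L (p * r) = 0"
    proof (rule ccontr)
      assume "L (p * r) \<noteq> 0"
      \<comment> \<open>The witness gives the polynomial in \<open>c\<close>, now linear, the value
        -1.\<close>
      then show False
        using *[of "- (L (p * p) + 1) / (2 * L (p * r))"] True by (simp add: field_simps)
    qed
    then show ?thesis using True by simp
  next
    case False
    then have pos: "L (r * r) > 0" using square_nonneg[of r] by linarith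
    have "0 \<le> L (p * p) - (L (p * r))\<^sup>2 / L (r * r)"
      using *[of "- L (p * r) / L (r * r)"] pos
      by (simp add: field_simps power2_eq_square)
    then show ?thesis using pos by (simp add: field_simps)
  qed
qed

text \<open>Cauchy-Schwarz bounds the square of \<open>b m\<close> by
  \<open>b 0 * b (2 * m)\<close>. Iterated k times, this bounds the \<open>2 ^ k\<close>-th power of
  the normalised value \<open>x\<close> by a constant independent of k, so \<open>x \<le> 1\<close>;
  the crude constant \<open>D\<close> disappears.\<close>

lemma monom_square_bound: "\<bar>L (monom 1 n * (p * p))\<bar> \<le> T ^ n * L (p * p)"
proof -
  define b where "b m = L (monom 1 m * (p * p))" for m
  have b0: "b 0 = L (p * p)" by (simp add: b_def monom_0)
  have step: "(b m)\<^sup>2 \<le> b 0 * b (2 * m)" for m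
  proof -
    have "monom 1 m * p * (monom 1 m * p) = monom 1 m * monom 1 m * (p * p)"
      by (simp only: ac_simps)
    then have e1: "monom 1 m * p * (monom 1 m * p) = monom 1 (2 * m) * (p * p)"
      by (simp only: mult_monom mult_2 mult_1_left)
    have e2: "p * (monom 1 m * p) = monom 1 m * (p * p)" by (simp only: ac_simps)
    show ?thesis
      using Cauchy_Schwarz[of p "monom 1 m * p"] unfolding e1 e2 b0 by (simp only: b_def)
  qed
  define D where "D = (\<Sum>i\<le>degree (p * p). \<bar>coeff (p * p) i\<bar> * (C * T ^ i))"
  have bD: "\<bar>b m\<bar> \<le> D * T ^ m" for m
  proof -
    have "\<bar>b m\<bar> \<le> (\<Sum>i\<le>degree (p * p). \<bar>coeff (p * p) i\<bar> * \<bar>q (m + i)\<bar>)"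
      by (simp add: b_def moment_functional_monom_mult order_trans[OF sum_abs] abs_mult)
    also have "\<dots> \<le> (\<Sum>i\<le>degree (p * p). \<bar>coeff (p * p) i\<bar> * (C * T ^ (m + i)))"
      by (intro sum_mono mult_left_mono bound) auto
    also have "\<dots> = D * T ^ m"
      by (simp add: D_def sum_distrib_right sum_distrib_left power_add algebra_simps)
    finally show ?thesis .
  qed
  show ?thesis
  proof (cases "b 0 = 0")
    case True
    then have "(b n)\<^sup>2 \<le> 0" using step[of n] by simp
    then show ?thesis using True b0 by (simp add: b_def)
  next
    case False
    then have b0pos: "b 0 > 0" using square_nonneg[of p] b0 by linarith
    define x where "x = \<bar>b n\<bar> / (b 0 * T ^ n)"
    have xpow: "b 0 * (x * T ^ n) ^ (2 ^ k) \<le> \<bar>b (2 ^ k * n)\<bar>" for k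
    proof (induction k)
      case 0
      then show ?case using b0pos T by (simp add: x_def)
    next
      case (Suc k)
      have "(b 0 * (x * T ^ n) ^ (2 ^ k))\<^sup>2 \<le> (\<bar>b (2 ^ k * n)\<bar>)\<^sup>2"
        using Suc b0pos T by (intro power_mono) (auto simp: x_def)
      also have "\<dots> \<le> b 0 * b (2 * (2 ^ k * n))" using step by simp
      also have "\<dots> \<le> b 0 * \<bar>b (2 ^ Suc k * n)\<bar>"
        using b0pos by (simp add: mult.assoc)
      finally have "b 0 * (b 0 * ((x * T ^ n) ^ (2 ^ k))\<^sup>2) \<le> b 0 * \<bar>b (2 ^ Suc k * n)\<bar>"
        by (simp only: power_mult_distrib power2_eq_square ac_simps)
      then have "b 0 * ((x * T ^ n) ^ (2 ^ k))\<^sup>2 \<le> \<bar>b (2 ^ Suc k * n)\<bar>"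
        using b0pos by (subst (asm) mult_le_cancel_left_pos)
      then show ?case by (simp only: power_Suc mult.commute[of 2] power_mult)
    qed
    have bnd: "x ^ (2 ^ k) \<le> D / b 0" for k
    proof -
      have "b 0 * (x ^ (2 ^ k) * T ^ (2 ^ k * n)) \<le> D * T ^ (2 ^ k * n)"
        using xpow[of k] bD[of "2 ^ k * n"]
        by (simp add: power_mult_distrib power_mult[symmetric] mult.commute[of n])
      then have "T ^ (2 ^ k * n) * (b 0 * x ^ (2 ^ k)) \<le> T ^ (2 ^ k * n) * D" by (simp add: ac_simps)
      then have "b 0 * x ^ (2 ^ k) \<le> D" using T by (subst (asm) mult_le_cancel_left_pos) auto
      then show ?thesis using b0pos by (simp add: field_simps)
    qed
    have "x \<le> 1"
    proof (rule ccontr)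
      assume "\<not> x \<le> 1"
      then obtain m where m: "D / b 0 < x ^ m" using real_arch_pow[of x] by auto
      have "x ^ m \<le> x ^ (2 ^ m)" using \<open>\<not> x \<le> 1\<close> by (intro power_increasing) (auto intro: less_imp_le)
      then show False using m bnd[of m] by linarith
    qed
    then show ?thesis using b0pos T b0 by (simp add: x_def field_simps b_def)
  qed
qed

text \<open>Even powers combine to a square, and what is left is 1, \<open>T + X\<close>,
  \<open>T - X\<close> or \<open>T^2 - X^2\<close>. The previous bound, with exponent 1 or 2,
  absorbs the part that may be negative.\<close>

lemma interval_nonneg: "0 \<le> L ([:T, 1:] ^ k * [:T, -1:] ^ l)"
proof -
  have lin: "0 \<le> L ([:T, c:] * (p * p))" if "\<bar>c\<bar> = 1" for p and c :: real
  proof -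
    have "[:T, c:] * (p * p) = smult T (p * p) + smult c (monom 1 1 * (p * p))"
      by (simp add: monom_altdef)
    moreover have "\<bar>c * L (monom 1 1 * (p * p))\<bar> \<le> T * L (p * p)"
      using that monom_square_bound[of 1 p] by (simp add: abs_mult)
    ultimately show ?thesis by (simp add: moment_functional_add moment_functional_smult abs_le_iff)
  qed
  have quad: "0 \<le> L ([:T, 1:] * [:T, -1:] * (p * p))" for p
  proof -
    have "[:T, 1:] * [:T, -1:] = smult (T\<^sup>2) 1 + smult (-1) (monom 1 2)"
      by (simp add: monom_altdef power2_eq_square)
    then have "[:T, 1:] * [:T, -1:] * (p * p) = smult (T\<^sup>2) (p * p) + smult (-1) (monom 1 2 * (p * p))"
      by (simp only: distrib_right mult_smult_left mult_1_left)
    moreover have "\<bar>L (monom 1 2 * (p * p))\<bar> \<le> T\<^sup>2 * L (p * p)"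
      by (rule monom_square_bound)
    ultimately show ?thesis
      by (simp only: moment_functional_add moment_functional_smult)
  qed
  define r where "r = [:T, 1:] ^ (k div 2) * [:T, -1:] ^ (l div 2)"
  have pow: "u ^ m = (if even m then 1 else u) * (u ^ (m div 2) * u ^ (m div 2))" for u :: "real poly" and m
  proof (cases "even m")
    case True
    then have "m = m div 2 + m div 2" by presburger
    then have "u ^ m = u ^ (m div 2) * u ^ (m div 2)" by (metis power_add)
    then show ?thesis using True by simp
  next
    case False
    then have "m = Suc (m div 2 + m div 2)" by presburger
    then have "u ^ m = u * (u ^ (m div 2) * u ^ (m div 2))" by (metis power_add power_Suc)
    then show ?thesis using False by simp
  qed
  have "[:T, 1:] ^ k * [:T, -1:] ^ l =
    (if even k then 1 else [:T, 1:]) * (if even l then 1 else [:T, -1:]) * (r * r)"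
  proof -
    have ac: "a * (x * x) * (b * (y * y)) = a * b * (x * y * (x * y))" for a b x y :: "real poly"
      by (simp only: ac_simps)
    show ?thesis
      unfolding r_def by (subst pow[of _ k], subst pow[of _ l], rule ac)
  qed
  moreover have "0 \<le> L (((if even k then 1 else [:T, 1:]) * (if even l then 1 else [:T, -1:])) * (r * r))"
  proof (cases "even k")
    case k: True
    show ?thesis
    proof (cases "even l")
      case True
      show ?thesis unfolding if_P[OF k] if_P[OF True] mult_1_left by (rule square_nonneg)
    next
      case False
      show ?thesis unfolding if_P[OF k] if_not_P[OF False] mult_1_left by (rule lin) simp
    qed
  next
    case k: False
    show ?thesis
    proof (cases "even l")
      case True
      show ?thesis unfolding if_P[OF True] if_not_P[OF k] mult_1_right by (rule lin) simp
    next
      case False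
      show ?thesis unfolding if_not_P[OF False] if_not_P[OF k] by (rule quad)
    qed
  qed
  ultimately show ?thesis by (simp only:)
qed

text \<open>The Bernstein basis of \<open>[-T, T]\<close>. Its values under \<open>L\<close>,
  divided by \<open>q 0\<close>, will be the masses of the discrete measures that approximate the
  representing one.\<close>

definition bernstein :: "nat \<Rightarrow> nat \<Rightarrow> real poly" where
  "bernstein n k = smult (real (n choose k) / (2 * T) ^ n) ([:T, 1:] ^ k * [:T, -1:] ^ (n - k))"

abbreviation U where "U \<equiv> [:1 / 2, 1 / (2 * T):]"

lemma bernstein_alt: "bernstein n k = smult (real (n choose k)) (U ^ k * [:1 / 2, - 1 / (2 * T):] ^ (n - k))"
  if "k \<le> n"
proof -
  have "U = smult (1 / (2 * T)) [:T, 1:]" "[:1 / 2, - 1 / (2 * T):] = smult (1 / (2 * T)) [:T, -1:]"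
    using T by auto
  then have "U ^ k * [:1 / 2, - 1 / (2 * T):] ^ (n - k) =
      smult ((1 / (2 * T)) ^ k * (1 / (2 * T)) ^ (n - k)) ([:T, 1:] ^ k * [:T, -1:] ^ (n - k))"
    by (simp only: smult_power mult_smult_left mult_smult_right smult_smult) (simp only: mult.commute)
  also have "(1 / (2 * T)) ^ k * (1 / (2 * T)) ^ (n - k) = 1 / (2 * T) ^ n"
    using that by (metis le_add_diff_inverse power_add power_one_over)
  finally show ?thesis by (simp add: bernstein_def)
qed

lemma bernstein_nonneg: "0 \<le> L (bernstein n k)"
  unfolding bernstein_def moment_functional_smult
  using T by (intro mult_nonneg_nonneg interval_nonneg) auto

text \<open>By \<open>U + V = 1\<close> and the binomial theorem the weights behave like binomial
  ones: their factorial moments are exact for every n, before any limit.\<close>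

lemma bernstein_factorial_moment:
  assumes "j \<le> n"
  shows "(\<Sum>k\<le>n. real (k choose j) * L (bernstein n k)) = real (n choose j) * L (U ^ j)"
proof -
  define V where "V = [:1 / 2, - 1 / (2 * T):]"
  have UV: "U + V = 1" by (simp add: V_def)
  have "(\<Sum>k\<le>n. smult (real (k choose j)) (bernstein n k)) =
        (\<Sum>k\<in>{j..n}. smult (real (k choose j)) (bernstein n k))"
    by (intro sum.mono_neutral_right) auto
  also have "\<dots> = (\<Sum>k\<in>{j..n}. smult (real (n choose j)) (U ^ j) * (of_nat (n - j choose (k - j)) * U ^ (k - j) * V ^ (n - j - (k - j))))"
  proof (intro sum.cong refl)
    fix k assume k: "k \<in> {j..n}"
    have c: "real (k choose j) * real (n choose k) = real (n choose j) * real (n - j choose (k - j))"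
      using k choose_mult[of j k n] by (simp add: mult.commute flip: of_nat_mult)
    have "smult (real (k choose j)) (bernstein n k) = smult (real (k choose j) * real (n choose k)) (U ^ k * V ^ (n - k))"
      using k by (simp only: bernstein_alt V_def atLeastAtMost_iff smult_smult)
    also have "U ^ k = U ^ j * U ^ (k - j)" using k by (simp flip: power_add)
    also have "n - k = n - j - (k - j)" using k by simp
    finally show "smult (real (k choose j)) (bernstein n k) =
       smult (real (n choose j)) (U ^ j) * (of_nat (n - j choose (k - j)) * U ^ (k - j) * V ^ (n - j - (k - j)))"
      unfolding c by (simp only: of_nat_poly mult_smult_left mult_smult_right smult_smult mult.assoc mult_pCons_left mult_zero_left pCons_0_0 add_0_right)
        (simp only: mult.commute)
  qed
  also have "\<dots> = smult (real (n choose j)) (U ^ j) * (\<Sum>i\<le>n - j. of_nat (n - j choose i) * U ^ i * V ^ (n - j - i))"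
    unfolding sum_distrib_left using assms
    by (intro sum.reindex_bij_witness[of _ "\<lambda>i. i + j" "\<lambda>k. k - j"]) auto
  also have "\<dots> = smult (real (n choose j)) (U ^ j)"
    by (simp only: binomial_ring[symmetric] UV power_one mult_1_right)
  finally have "L (\<Sum>k\<le>n. smult (real (k choose j)) (bernstein n k)) = L (smult (real (n choose j)) (U ^ j))"
    by (rule arg_cong)
  then show ?thesis by (simp only: moment_functional_sum moment_functional_smult)
qed

end

text \<open>The quotient of binomial coefficients is the product of \<open>(k - i) / (n - i)\<close>
  over \<open>i < j\<close>, and each factor differs from \<open>k / n\<close> by at most
  \<open>i / (n - i)\<close>. This compares the exact factorial moments with power moments at the
  points \<open>k / n\<close>.\<close>

lemma binomial_ratio_power:
  assumes "k \<le> n" "j \<le> n"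
  shows "\<bar>real (k choose j) / real (n choose j) - (real k / real n) ^ j\<bar> \<le> (\<Sum>i<j. real i / (real n - real i))"
  using assms(2)
proof (induction j)
  case (Suc j)
  define a where "a = real (k choose j) / real (n choose j)"
  have jn: "j < n" using Suc.prems by simp
  have a01: "0 \<le> a" "a \<le> 1"
    using assms(1) jn by (auto simp: a_def binomial_mono field_simps intro!: binomial_right_mono)
  have absorb: "real (m choose Suc j) * (real j + 1) = real (m choose j) * (real m - real j)" for m
  proof (cases "j \<le> m")
    case True
    have "Suc j * (m choose Suc j) = (m - j) * (m choose j)"
      by (simp only: binomial_absorb_comp binomial_absorption)
    then have "real (Suc j * (m choose Suc j)) = real ((m - j) * (m choose j))" by (simp only:)
    then show ?thesis using True by (simp add: of_nat_diff algebra_simps)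
  qed (simp add: binomial_eq_0)
  have "real (k choose Suc j) / real (n choose Suc j) = (real (k choose Suc j) * (real j + 1)) / (real (n choose Suc j) * (real j + 1))"
    by simp
  also have "\<dots> = a * ((real k - real j) / (real n - real j))"
    unfolding absorb a_def by (simp only: times_divide_times_eq)
  finally have eq: "real (k choose Suc j) / real (n choose Suc j) = a * ((real k - real j) / (real n - real j))" .
  have d: "(real k - real j) / (real n - real j) - real k / real n = - (real j * (real n - real k) / (real n * (real n - real j)))"
    using jn by (simp add: field_simps)
  have "\<bar>a * ((real k - real j) / (real n - real j)) - (real k / real n) ^ Suc j\<bar> =
    \<bar>a * ((real k - real j) / (real n - real j) - real k / real n) + (a - (real k / real n) ^ j) * (real k / real n)\<bar>"
    by (simp add: algebra_simps)
  also have "\<dots> \<le> \<bar>a * ((real k - real j) / (real n - real j) - real k / real n)\<bar> + \<bar>(a - (real k / real n) ^ j) * (real k / real n)\<bar>"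
    by (rule abs_triangle_ineq)
  also have "\<bar>a * ((real k - real j) / (real n - real j) - real k / real n)\<bar> \<le> 1 * (real j / (real n - real j))"
  proof -
    have "real j * (real n - real k) / (real n * (real n - real j)) \<le> real j * real n / (real n * (real n - real j))"
      using jn assms(1) by (intro divide_right_mono mult_left_mono) auto
    then have "\<bar>(real k - real j) / (real n - real j) - real k / real n\<bar> \<le> real j / (real n - real j)"
      unfolding d using jn assms(1) by simp
    then show ?thesis unfolding abs_mult using a01 by (intro mult_mono) auto
  qed
  also have "\<bar>(a - (real k / real n) ^ j) * (real k / real n)\<bar> \<le> (\<Sum>i<j. real i / (real n - real i)) * 1"
    unfolding abs_mult using Suc assms(1) jn
    by (intro mult_mono) (auto simp: a_def field_simps intro!: sum_nonneg)
  finally show ?case unfolding eq by simp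
next
  case 0
  then show ?case by simp
qed

context bounded_moment_sequence begin

lemma sum_bernstein: "(\<Sum>k\<le>n. L (bernstein n k)) = q 0"
  using bernstein_factorial_moment[of 0 n] by (simp add: moment_functional_def)

text \<open>The total mass is \<open>q 0\<close> for every n, so the error of replacing factorial
  moments by power moments tends to 0.\<close>

lemma bernstein_power_moment_limit:
  "(\<lambda>n. \<Sum>k\<le>n. (real k / real n) ^ j * L (bernstein n k)) \<longlonglongrightarrow> L (U ^ j)"
proof -
  have "(\<lambda>n. (\<Sum>k\<le>n. (real k / real n) ^ j * L (bernstein n k)) - L (U ^ j)) \<longlonglongrightarrow> 0"
  proof (rule Lim_null_comparison)
    show "\<forall>\<^sub>F n in sequentially. norm ((\<Sum>k\<le>n. (real k / real n) ^ j * L (bernstein n k)) - L (U ^ j))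
        \<le> (\<Sum>i<j. real i / (real n - real i)) * q 0"
      using eventually_ge_at_top[of j]
    proof eventually_elim
      case (elim n)
      have "L (U ^ j) = (\<Sum>k\<le>n. real (k choose j) / real (n choose j) * L (bernstein n k))"
      proof -
        have "real (n choose j) \<noteq> 0" using elim by (simp add: not_less)
        then have "L (U ^ j) = (\<Sum>k\<le>n. real (k choose j) * L (bernstein n k)) / real (n choose j)"
          unfolding bernstein_factorial_moment[OF elim] by simp
        then show ?thesis by (simp add: sum_divide_distrib)
      qed
      then have "norm ((\<Sum>k\<le>n. (real k / real n) ^ j * L (bernstein n k)) - L (U ^ j)) =
        \<bar>\<Sum>k\<le>n. ((real k / real n) ^ j - real (k choose j) / real (n choose j)) * L (bernstein n k)\<bar>"
        by (simp add: sum_subtractf left_diff_distrib)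
      also have "\<dots> \<le> (\<Sum>k\<le>n. (\<Sum>i<j. real i / (real n - real i)) * L (bernstein n k))"
      proof (rule order_trans[OF sum_abs], rule sum_mono)
        fix k assume "k \<in> {..n}"
        then show "\<bar>((real k / real n) ^ j - real (k choose j) / real (n choose j)) * L (bernstein n k)\<bar>
          \<le> (\<Sum>i<j. real i / (real n - real i)) * L (bernstein n k)"
          using binomial_ratio_power[of k n j] elim bernstein_nonneg[of n k]
          by (simp add: abs_mult abs_minus_commute mult_right_mono)
      qed
      also have "\<dots> = (\<Sum>i<j. real i / (real n - real i)) * q 0"
        by (simp only: sum_bernstein flip: sum_distrib_left)
      finally show ?case .
    qed
    have "(\<lambda>n. \<Sum>i<j. real i / (real n - real i)) \<longlonglongrightarrow> (\<Sum>i<j. 0)"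
      by (intro tendsto_sum) real_asymp
    then show "(\<lambda>n. (\<Sum>i<j. real i / (real n - real i)) * q 0) \<longlonglongrightarrow> 0"
      by (auto intro!: tendsto_mult_left_zero)
  qed
  then show ?thesis by (rule LIM_zero_cancel)
qed

text \<open>Weak convergence tests bounded continuous functions only; powers of
  \<open>clamp01 t\<close> are such functions and agree with powers of \<open>t\<close> on the unit
  interval.\<close>

definition clamp01 :: "real \<Rightarrow> real" where "clamp01 t = max 0 (min 1 t)"

lemma bernstein_measure:
  assumes "q 0 > 0"
  obtains \<mu> where "real_distribution \<mu>"
    "\<And>f. f \<in> borel_measurable borel \<Longrightarrow> (LINT t|\<mu>. f t) = (\<Sum>k\<le>n. f (real k / real n) * (L (bernstein n k) / q 0) :: real)"
    "AE t in \<mu>. 0 \<le> t \<and> t \<le> 1"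
proof -
  define w where "w k = (if k \<le> n then L (bernstein n k) / q 0 else 0)" for k
  have w0: "0 \<le> w k" for k using bernstein_nonneg assms by (simp add: w_def)
  have "(\<integral>\<^sup>+k. ennreal (w k) \<partial>count_space UNIV) = (\<Sum>k\<le>n. ennreal (w k))"
    by (subst nn_integral_count_space'[of "{..n}"]) (auto simp: w_def)
  also have "\<dots> = ennreal (\<Sum>k\<le>n. w k)" using w0 by (simp add: sum_ennreal)
  also have "(\<Sum>k\<le>n. w k) = 1"
    using sum_bernstein[of n] assms by (simp add: w_def flip: sum_divide_distrib)
  finally have "(\<integral>\<^sup>+k. ennreal (w k) \<partial>count_space UNIV) = 1" by simp
  then have pmf: "pmf (embed_pmf w) k = w k" for k
    using w0 by (intro pmf_embed_pmf) auto
  define \<mu> where "\<mu> = distr (measure_pmf (embed_pmf w)) borel (\<lambda>k. real k / real n)"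
  have set: "k \<le> n" if "k \<in> set_pmf (embed_pmf w)" for k
    using that pmf[of k] by (auto simp: set_pmf_iff w_def split: if_splits)
  show thesis
  proof
    show "real_distribution \<mu>" unfolding \<mu>_def
      by (rule prob_space.real_distribution_distr[OF prob_space_measure_pmf]) auto
    show "(LINT t|\<mu>. f t) = (\<Sum>k\<le>n. f (real k / real n) * (L (bernstein n k) / q 0) :: real)"
      if "f \<in> borel_measurable borel" for f
      unfolding \<mu>_def using that
      by (subst integral_distr) (auto simp: integral_measure_pmf_real[of "{..n}"] set pmf w_def)
    show "AE t in \<mu>. 0 \<le> t \<and> t \<le> 1" unfolding \<mu>_def
      by (subst AE_distr_iff) (auto simp: AE_measure_pmf_iff divide_le_eq dest: set)
  qed
qed

text \<open>The Bernstein measures all live on the unit interval, hence are tight, and the moments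
  of a weak limit point are the limits of theirs.\<close>

lemma unit_interval_measure:
  assumes "q 0 > 0"
  obtains M where "real_distribution M" "AE t in M. 0 \<le> t \<and> t \<le> 1"
    "\<And>j. (LINT t|M. t ^ j) = L (U ^ j) / q 0"
proof -
  define P where "P n \<mu> \<longleftrightarrow> real_distribution \<mu> \<and> (\<forall>f. f \<in> borel_measurable borel \<longrightarrow>
      (LINT t|\<mu>. f t) = (\<Sum>k\<le>n. f (real k / real n) * (L (bernstein n k) / q 0) :: real)) \<and>
      (AE t in \<mu>. 0 \<le> t \<and> t \<le> 1)" for n \<mu>
  have "\<exists>\<mu>. P n \<mu>" for n
    by (rule bernstein_measure[OF assms, of n]) (auto simp: P_def)
  then obtain \<mu> where P: "\<And>n. P n (\<mu> n)" by metis
  have \<mu>: "real_distribution (\<mu> n)" "AE t in \<mu> n. 0 \<le> t \<and> t \<le> 1"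
    "\<And>f. f \<in> borel_measurable borel \<Longrightarrow>
      (LINT t|\<mu> n. f t) = (\<Sum>k\<le>n. f (real k / real n) * (L (bernstein n k) / q 0) :: real)" for n
    using P[of n] by (auto simp: P_def)
  have "tight \<mu>" unfolding tight_def
  proof (intro conjI allI impI \<mu>)
    fix \<epsilon> :: real assume "\<epsilon> > 0"
    have "measure (\<mu> n) {-1<..1} = 1" for n
    proof -
      interpret real_distribution "\<mu> n" by (rule \<mu>)
      have "AE t in \<mu> n. t \<in> {-1<..1}" using \<mu>(2)[of n] by eventually_elim auto
      then show ?thesis by (subst prob_eq_1) simp_all
    qed
    then show "\<exists>a b. a < b \<and> (\<forall>n. 1 - \<epsilon> < measure (\<mu> n) {a<..b})"
      using \<open>\<epsilon> > 0\<close> by (intro exI[of _ "-1"] exI[of _ 1]) auto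
  qed
  then obtain r M where r: "strict_mono (r :: nat \<Rightarrow> nat)" and M: "real_distribution M"
    and conv: "weak_conv_m (\<mu> \<circ> id \<circ> r) M"
    using tight_imp_convergent_subsubsequence[of \<mu> id] by (auto simp: strict_mono_id)
  interpret real_distribution M by (rule M)
  have lim: "(\<lambda>n. LINT t|\<mu> (r n). f t) \<longlonglongrightarrow> (LINT t|M. f t)"
    if "\<And>x. isCont f x" "\<And>x. norm (f x) \<le> B" for f :: "real \<Rightarrow> real" and B
    using weak_conv_imp_integral_bdd_continuous_conv[OF _ M conv that] \<mu>(1) by (simp add: o_def)
  have cont [continuous_intros]: "isCont clamp01 x" for x
    unfolding clamp01_def by (intro continuous_intros)
  have clamp: "0 \<le> clamp01 t" "clamp01 t \<le> 1" for t by (auto simp: clamp01_def)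
  have [measurable]: "clamp01 \<in> borel_measurable borel" unfolding clamp01_def by measurable
  have AE: "AE t in M. 0 \<le> t \<and> t \<le> 1"
  proof -
    \<comment> \<open>A bounded continuous function that vanishes exactly on the unit interval: its
      integral passes to the limit and shows that the limit has no mass outside.\<close>
    define f where "f t = min 1 \<bar>t - clamp01 t\<bar>" for t
    have [measurable]: "f \<in> borel_measurable borel" unfolding f_def by measurable
    have "(LINT t|\<mu> n. f t) = 0" for n
      by (rule integral_eq_zero_AE) (use \<mu>(2)[of n] in \<open>eventually_elim, auto simp: f_def clamp01_def\<close>)
    moreover have "(\<lambda>n. LINT t|\<mu> (r n). f t) \<longlonglongrightarrow> (LINT t|M. f t)"
      by (rule lim[of _ 1]) (auto simp: f_def intro!: continuous_intros)
    ultimately have "(LINT t|M. f t) = 0" by (simp add: LIMSEQ_const_iff)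
    moreover have "integrable M f"
      by (rule integrable_const_bound[of _ 1]) (auto simp: f_def)
    ultimately have "AE t in M. f t = 0"
      by (subst (asm) integral_nonneg_eq_0_iff_AE) (auto simp: f_def)
    then show ?thesis by eventually_elim (auto simp: f_def clamp01_def min_def max_def split: if_splits)
  qed
  show thesis
  proof
    fix j
    have "(LINT t|M. t ^ j) = (LINT t|M. clamp01 t ^ j)"
    proof (rule integral_cong_AE)
      show "AE t in M. t ^ j = clamp01 t ^ j" using AE by eventually_elim (simp add: clamp01_def)
    qed auto
    moreover have "(\<lambda>n. LINT t|\<mu> (r n). clamp01 t ^ j) \<longlonglongrightarrow> (LINT t|M. clamp01 t ^ j)"
      by (rule lim[of _ 1]) (auto simp: clamp power_le_one intro!: continuous_intros)
    moreover have "(\<lambda>n. LINT t|\<mu> (r n). clamp01 t ^ j) \<longlonglongrightarrow> L (U ^ j) / q 0"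
    proof -
      have "(LINT t|\<mu> n. clamp01 t ^ j) = (\<Sum>k\<le>n. (real k / real n) ^ j * L (bernstein n k)) / q 0" for n
        unfolding sum_divide_distrib
        by (subst \<mu>(3)) (auto intro!: sum.cong simp: clamp01_def divide_le_eq min_absorb2)
      then show ?thesis
        using LIMSEQ_subseq_LIMSEQ[OF tendsto_divide[OF bernstein_power_moment_limit[of j] tendsto_const[of "q 0"]] r] assms
        by (simp add: o_def)
    qed
    ultimately show "(LINT t|M. t ^ j) = L (U ^ j) / q 0"
      using LIMSEQ_unique by auto
  qed (fact M AE)+
qed

lemma bounded_moment_problem:
  obtains \<pi> where "real_distribution \<pi>" "AE t in \<pi>. \<bar>t\<bar> \<le> T" "\<And>n. q n = q 0 * (LINT t|\<pi>. t ^ n)"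
proof (cases "q 0 = 0")
  case True
  \<comment> \<open>Cauchy-Schwarz against the constant 1 kills every moment, so any law supported
    in the interval will do.\<close>
  have "q n = 0" for n
  proof -
    have "(L (1 * monom 1 n))\<^sup>2 \<le> L (1 * 1) * L (monom 1 n * monom 1 n)" by (rule Cauchy_Schwarz)
    moreover have "L (1 * 1) = q 0" by (simp add: moment_functional_def)
    ultimately show ?thesis using True
      by (simp only: mult_1_left moment_functional_monom) simp
  qed
  moreover have "real_distribution (return borel 0)"
    unfolding real_distribution_def real_distribution_axioms_def by (simp add: prob_space_return)
  moreover have "AE t in return borel 0. \<bar>t\<bar> \<le> T" using T by (subst AE_return) auto
  ultimately show thesis using that[of "return borel 0"] by simp
next
  case False
  then have q0: "q 0 > 0" using square_nonneg[of 1] by (simp add: moment_functional_def)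
  obtain M where M: "real_distribution M" and AE: "AE t in M. 0 \<le> t \<and> t \<le> 1"
    and mom: "\<And>j. (LINT t|M. t ^ j) = L (U ^ j) / q 0"
    using unit_interval_measure[OF q0] by blast
  interpret real_distribution M by (rule M)
  have int: "integrable M (\<lambda>t. t ^ j)" for j
  proof (rule integrable_const_bound)
    show "AE t in M. norm (t ^ j) \<le> 1" using AE by eventually_elim (simp add: power_le_one)
  qed auto
  have poly: "(LINT t|M. poly p t) = L (p \<circ>\<^sub>p U) / q 0" for p
  proof -
    have "(LINT t|M. poly p t) = (\<Sum>i\<le>degree p. coeff p i * (L (U ^ i) / q 0))"
      unfolding poly_altdef by (subst Bochner_Integration.integral_sum) (auto simp: int mom)
    moreover have "p \<circ>\<^sub>p U = (\<Sum>i\<le>degree p. smult (coeff p i) (U ^ i))"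
      by (rule poly_eq_poly_eq_iff[THEN iffD1])
        (simp add: fun_eq_iff poly_pcompose poly_sum poly_altdef[of p] poly_power)
    ultimately show ?thesis
      by (simp add: moment_functional_sum moment_functional_smult sum_divide_distrib)
  qed
  \<comment> \<open>The affine map inverts \<open>U\<close> and carries the unit interval back to
    \<open>[-T, T]\<close>.\<close>
  define \<pi> where "\<pi> = distr M borel (\<lambda>s. T * (2 * s - 1))"
  show thesis
  proof
    show "real_distribution \<pi>" unfolding \<pi>_def by (rule real_distribution_distr) auto
    show "AE t in \<pi>. \<bar>t\<bar> \<le> T" unfolding \<pi>_def
    proof (subst AE_distr_iff)
      show "AE x in M. \<bar>T * (2 * x - 1)\<bar> \<le> T"
        using AE
      proof eventually_elim
        case (elim x)
        then have "T * \<bar>2 * x - 1\<bar> \<le> T * 1" using T by (intro mult_left_mono) auto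
        then show ?case using T by (simp add: abs_mult)
      qed
    qed auto
    fix n
    have "(LINT t|\<pi>. t ^ n) = (LINT t|M. poly ([:-T, 2 * T:] ^ n) t)"
      unfolding \<pi>_def
      by (subst integral_distr) (auto intro!: Bochner_Integration.integral_cong simp: poly_power algebra_simps)
    also have "\<dots> = L (([:-T, 2 * T:] \<circ>\<^sub>p U) ^ n) / q 0"
    proof -
      have "[:-T, 2 * T:] ^ n \<circ>\<^sub>p U = ([:-T, 2 * T:] \<circ>\<^sub>p U) ^ n"
        by (rule poly_eq_poly_eq_iff[THEN iffD1]) (simp add: fun_eq_iff poly_pcompose poly_power)
      then show ?thesis by (simp only: poly)
    qed
    also have "[:-T, 2 * T:] \<circ>\<^sub>p U = monom 1 1"
      using T by (simp add: pcompose_pCons monom_altdef)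
    also have "L (monom 1 1 ^ n) = q n"
      by (simp add: monom_power moment_functional_monom)
    finally show "q n = q 0 * (LINT t|\<pi>. t ^ n)" using q0 by simp
  qed
qed

end

section \<open>Positive semidefinite kernels and Nevanlinna representations\<close>

text \<open>Only the real part is constrained, so Hermitian symmetry never has to be
  checked.\<close>

definition psd_kernel :: "complex set \<Rightarrow> (complex \<Rightarrow> complex \<Rightarrow> complex) \<Rightarrow> bool" where
  "psd_kernel S K \<longleftrightarrow> (\<forall>(n::nat) w c. (\<forall>i<n. w i \<in> S) \<longrightarrow>
     0 \<le> Re (\<Sum>i<n. \<Sum>j<n. c i * cnj (c j) * K (w i) (w j)))"

definition conditionally_psd_kernel :: "complex set \<Rightarrow> (complex \<Rightarrow> complex \<Rightarrow> complex) \<Rightarrow> bool" where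
  "conditionally_psd_kernel S K \<longleftrightarrow> (\<forall>(n::nat) w c. (\<forall>i<n. w i \<in> S) \<longrightarrow> (\<Sum>i<n. c i) = 0 \<longrightarrow>
     0 \<le> Re (\<Sum>i<n. \<Sum>j<n. c i * cnj (c j) * K (w i) (w j)))"

text \<open>The witness \<open>b l k\<close> is the coefficient of degree k in the l-th Lagrange
  polynomial, that is, an entry of the inverse Vandermonde matrix of the nodes.\<close>

lemma lagrange_dual_basis:
  fixes \<theta> :: "nat \<Rightarrow> 'a::field"
  assumes "inj_on \<theta> {..N}"
  obtains b where "\<And>m k. m \<le> N \<Longrightarrow> k \<le> N \<Longrightarrow> (\<Sum>l\<le>N. b l k * \<theta> l ^ m) = (if m = k then 1 else 0)"
proof -
  define lag where "lag l = (\<Prod>m\<in>{..N} - {l}. smult (1 / (\<theta> l - \<theta> m)) [:- \<theta> m, 1:])" for l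
  have deg: "degree (lag l) \<le> N" if "l \<le> N" for l
  proof -
    have "degree (lag l) \<le> (\<Sum>m\<in>{..N} - {l}. degree (smult (1 / (\<theta> l - \<theta> m)) [:- \<theta> m, 1:]))"
      unfolding lag_def using degree_prod_sum_le[of "{..N} - {l}" "\<lambda>m. smult (1 / (\<theta> l - \<theta> m)) [:- \<theta> m, 1:]"]
      by (simp add: o_def)
    also have "\<dots> \<le> (\<Sum>m\<in>{..N} - {l}. 1)" by (intro sum_mono) (auto intro: order_trans[OF degree_smult_le])
    also have "\<dots> = N" using that by simp
    finally show ?thesis .
  qed
  have val: "poly (lag l) (\<theta> m) = (if l = m then 1 else 0)" if "l \<le> N" "m \<le> N" for l m
  proof (cases "l = m")
    case True
    then show ?thesis using assms that
      by (auto simp: lag_def poly_prod inj_on_def intro!: prod.neutral simp flip: diff_divide_distrib split: if_splits)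
  next
    case False
    then show ?thesis using that
      by (auto simp: lag_def poly_prod intro!: prod_zero bexI[of _ m])
  qed
  have eq: "(\<Sum>l\<le>N. smult (\<theta> l ^ m) (lag l)) = monom 1 m" if "m \<le> N" for m
  proof (rule poly_eqI_degree[of "\<theta> ` {..N}"])
    show "poly (\<Sum>l\<le>N. smult (\<theta> l ^ m) (lag l)) x = poly (monom 1 m) x" if "x \<in> \<theta> ` {..N}" for x
      using that by (auto simp: poly_sum val poly_monom if_distrib[of "\<lambda>x. _ * x"] cong: if_cong)
    have "degree (\<Sum>l\<le>N. smult (\<theta> l ^ m) (lag l)) \<le> N"
      by (intro degree_sum_le) (auto simp: deg)
    then show "degree (\<Sum>l\<le>N. smult (\<theta> l ^ m) (lag l)) < card (\<theta> ` {..N})"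
      using assms by (simp add: card_image)
    show "degree (monom (1::'a) m) < card (\<theta> ` {..N})"
      using assms that by (simp add: card_image degree_monom_eq)
  qed
  show thesis
  proof
    fix m k assume "m \<le> N" "k \<le> N"
    then show "(\<Sum>l\<le>N. coeff (lag l) k * \<theta> l ^ m) = (if m = k then 1 else 0)"
      using arg_cong[OF eq[of m], of "\<lambda>p. coeff p k"]
      by (simp add: coeff_sum mult.commute)
  qed
qed

lemma kernel_power_series:
  fixes a :: "nat \<Rightarrow> complex"
  assumes R: "\<And>w. norm w < r \<Longrightarrow> (\<lambda>n. a n * w ^ n) sums R w"
    and wz: "norm w < r" "norm z < r" "w \<noteq> z"
  shows "(\<lambda>n. a (Suc n) * (\<Sum>i\<le>n. w ^ Suc i * z ^ Suc (n - i))) sums (w * z * (R w - R z) / (w - z))"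
proof -
  have "(\<lambda>n. a (Suc n) * (w ^ Suc n - z ^ Suc n)) sums (R w - R z)"
  proof -
    have "(\<lambda>n. a n * w ^ n - a n * z ^ n) sums (R w - R z)"
      by (intro sums_diff R wz)
    then have "(\<lambda>n. a (Suc n) * w ^ Suc n - a (Suc n) * z ^ Suc n) sums (R w - R z)"
      by (subst sums_Suc_iff) simp
    then show ?thesis by (simp add: right_diff_distrib)
  qed
  then have "(\<lambda>n. w * z / (w - z) * (a (Suc n) * (w ^ Suc n - z ^ Suc n))) sums (w * z / (w - z) * (R w - R z))"
    by (rule sums_mult)
  moreover have "w * z / (w - z) * (a (Suc n) * (w ^ Suc n - z ^ Suc n)) =
      a (Suc n) * (\<Sum>i\<le>n. w ^ Suc i * z ^ Suc (n - i))" for n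
  proof -
    have "w ^ Suc n - z ^ Suc n = (w - z) * (\<Sum>i\<le>n. w ^ i * z ^ (n - i))"
      by (subst diff_power_eq_sum) (simp add: lessThan_Suc_atMost)
    moreover have "(\<Sum>i\<le>n. w ^ Suc i * z ^ Suc (n - i)) = w * z * (\<Sum>i\<le>n. w ^ i * z ^ (n - i))"
      by (simp add: sum_distrib_left mult_ac)
    ultimately show ?thesis using wz by simp
  qed
  ultimately show ?thesis by simp
qed

text \<open>The inner sum has \<open>n + 1\<close> terms, absorbed into \<open>2 ^ n\<close>; this
  is why the tail is geometric with ratio \<open>2 * T * \<delta>\<close>. The hypothesis
  \<open>4 * T * \<delta> \<le> 1\<close> makes that ratio at most 1/2, whence the factor 2.\<close>

lemma kernel_power_series_remainder:
  fixes a :: "nat \<Rightarrow> complex"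
  assumes R: "\<And>w. norm w < r \<Longrightarrow> (\<lambda>n. a n * w ^ n) sums R w"
    and bound: "\<And>n. norm (a (Suc n)) \<le> C * T ^ n" and T: "T \<ge> 0"
    and wz: "norm w \<le> \<delta>" "norm z \<le> \<delta>" "w \<noteq> z" "\<delta> < r" "4 * T * \<delta> \<le> 1"
  shows "norm (w * z * (R w - R z) / (w - z) -
      (\<Sum>n<M. a (Suc n) * (\<Sum>i\<le>n. w ^ Suc i * z ^ Suc (n - i)))) \<le> 2 * C * \<delta>\<^sup>2 * (2 * T * \<delta>) ^ M"
proof -
  define f where "f n = a (Suc n) * (\<Sum>i\<le>n. w ^ Suc i * z ^ Suc (n - i))" for n
  have \<delta>: "\<delta> \<ge> 0" using wz(1) norm_ge_zero[of w] by linarith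
  have C: "C \<ge> 0" using bound[of 0] norm_ge_zero[of "a (Suc 0)"] by (simp del: norm_ge_zero)
  have sums: "f sums (w * z * (R w - R z) / (w - z))"
    unfolding f_def by (rule kernel_power_series[OF R]) (use wz in auto)
  have bnd: "norm (f n) \<le> C * \<delta>\<^sup>2 * (2 * T * \<delta>) ^ n" for n
  proof -
    have "norm (\<Sum>i\<le>n. w ^ Suc i * z ^ Suc (n - i)) \<le> (\<Sum>i\<le>n. \<delta> ^ Suc i * \<delta> ^ Suc (n - i))"
      by (rule sum_norm_le) (unfold norm_mult norm_power, intro mult_mono power_mono, use wz \<delta> in auto)
    also have "\<dots> = (\<Sum>i\<le>n. \<delta>\<^sup>2 * \<delta> ^ n)"
      by (intro sum.cong refl) (simp add: power2_eq_square flip: power_add)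
    also have "\<dots> = real (Suc n) * (\<delta>\<^sup>2 * \<delta> ^ n)" by simp
    also have "\<dots> \<le> 2 ^ n * (\<delta>\<^sup>2 * \<delta> ^ n)"
    proof (rule mult_right_mono)
      have "Suc n \<le> 2 ^ n" by (simp add: Suc_leI)
      then show "real (Suc n) \<le> 2 ^ n" by (metis of_nat_le_iff of_nat_numeral of_nat_power)
    qed (use \<delta> in auto)
    finally have "norm (f n) \<le> (C * T ^ n) * (2 ^ n * (\<delta>\<^sup>2 * \<delta> ^ n))"
      unfolding f_def norm_mult by (intro mult_mono bound) (use C T in auto)
    then show ?thesis by (simp add: power_mult_distrib mult_ac)
  qed
  have geo: "(\<lambda>n. C * \<delta>\<^sup>2 * (2 * T * \<delta>) ^ (n + M)) sums (C * \<delta>\<^sup>2 * (2 * T * \<delta>) ^ M * (1 / (1 - 2 * T * \<delta>)))"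
  proof -
    have "norm (2 * T * \<delta>) < 1" using wz T \<delta> by simp
    then show ?thesis
      using sums_mult[OF geometric_sums[of "2 * T * \<delta>"], of "C * \<delta>\<^sup>2 * (2 * T * \<delta>) ^ M"]
      by (simp add: power_add mult_ac)
  qed
  have "(\<lambda>n. f (n + M)) sums (w * z * (R w - R z) / (w - z) - (\<Sum>n<M. f n))"
    using sums by (rule sums_split_initial_segment)
  then have "norm (w * z * (R w - R z) / (w - z) - (\<Sum>n<M. f n)) \<le> C * \<delta>\<^sup>2 * (2 * T * \<delta>) ^ M * (1 / (1 - 2 * T * \<delta>))"
    by (rule norm_sums_le[OF _ geo]) (rule bnd)
  also have "\<dots> \<le> C * \<delta>\<^sup>2 * (2 * T * \<delta>) ^ M * 2"
    using wz T \<delta> C by (intro mult_left_mono) (auto simp: field_simps)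
  finally show ?thesis unfolding f_def by (simp add: mult_ac)
qed

lemma hankel_sum_eq_triangle:
  fixes a q :: "nat \<Rightarrow> real"
  assumes "\<And>i. i \<ge> N \<Longrightarrow> a i = 0"
  shows "(\<Sum>n<2 * N. q n * (\<Sum>i\<le>n. a i * a (n - i))) = (\<Sum>i<N. \<Sum>j<N. a i * a j * q (i + j))"
proof -
  have "(\<Sum>n<2 * N. q n * (\<Sum>i\<le>n. a i * a (n - i))) = (\<Sum>n<2 * N. \<Sum>i\<le>n. a i * a (n - i) * q (i + (n - i)))"
    by (simp add: sum_distrib_left mult_ac)
  also have "\<dots> = (\<Sum>(n, i)\<in>Sigma {..<2 * N} (\<lambda>n. {..n}). a i * a (n - i) * q (i + (n - i)))"
    by (subst sum.Sigma) auto
  also have "\<dots> = (\<Sum>(i, j)\<in>{(i, j). i + j < 2 * N}. a i * a j * q (i + j))"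
    by (rule sum.reindex_bij_witness[of _ "\<lambda>(i, j). (i + j, i)" "\<lambda>(n, i). (i, n - i)"]) auto
  also have "\<dots> = (\<Sum>(i, j)\<in>{..<N} \<times> {..<N}. a i * a j * q (i + j))"
  proof (rule sum.mono_neutral_right)
    show "finite {(i, j). i + j < 2 * N}"
      by (rule finite_subset[of _ "{..<2 * N} \<times> {..<2 * N}"]) auto
    have "i < N" if "a i \<noteq> 0" for i using assms that not_less by blast
    then show "\<forall>x\<in>{(i, j). i + j < 2 * N} - {..<N} \<times> {..<N}. (case x of (i, j) \<Rightarrow> a i * a j * q (i + j)) = 0"
      by auto
  qed auto
  also have "\<dots> = (\<Sum>i<N. \<Sum>j<N. a i * a j * q (i + j))"
    by (simp add: sum.cartesian_product)
  finally show ?thesis .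
qed

text \<open>The test points shrink to 0 along the ray while the weights blow up, in such a way that
  the power sums of order \<open>m + 1\<close> tend to \<open>\<alpha> m\<close> for
  \<open>m < N\<close> and to 0 beyond. The power sum of order 0 vanishes, as conditional positivity
  requires. After expansion of the kernel in powers of \<open>w\<close> and of the conjugate of
  \<open>z\<close>, the quadratic form tends to the Hankel form of \<open>\<alpha>\<close>.\<close>

lemma hankel_psd_of_conditionally_psd_kernel:
  fixes a :: "nat \<Rightarrow> complex" and q :: "nat \<Rightarrow> real"
  assumes R: "\<And>w. norm w < r \<Longrightarrow> (\<lambda>n. a n * w ^ n) sums R w" and r: "r > 0"
    and a: "\<And>n. a (Suc n) = complex_of_real (q n)"
    and bound: "\<And>n. \<bar>q n\<bar> \<le> C * T ^ n" and T: "T \<ge> 0"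
    and psd: "conditionally_psd_kernel {w. norm w < r \<and> Re w = 0 \<and> Im w < 0}
       (\<lambda>w z. w * cnj z * (R w - R (cnj z)) / (w - cnj z))"
  shows "hankel_psd q"
  unfolding hankel_psd_def
proof (intro allI)
  fix N and \<alpha> :: "nat \<Rightarrow> real"
  \<comment> \<open>Starting at 1 keeps every node off the origin and thus on the open ray;
    \<open>N + 1\<close> nodes control the powers 0 to N.\<close>
  define \<theta> :: "nat \<Rightarrow> complex" where "\<theta> l = of_nat (Suc l)" for l
  have "inj_on \<theta> {..N}" by (auto simp: \<theta>_def inj_on_def simp del: of_nat_Suc)
  then obtain b where b: "\<And>m k. m \<le> N \<Longrightarrow> k \<le> N \<Longrightarrow> (\<Sum>l\<le>N. b l k * \<theta> l ^ m) = (if m = k then 1 else 0)"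
    using lagrange_dual_basis by blast
  define s where "s \<epsilon> = - \<i> * complex_of_real \<epsilon>" for \<epsilon> :: real
  \<comment> \<open>By duality the power sums \<open>E\<close> of orders 1 to N are exact and that
    of order 0 is zero; only the orders beyond N need a limit.\<close>
  define e where "e \<epsilon> l = (\<Sum>j<N. complex_of_real (\<alpha> j) / s \<epsilon> ^ Suc j * b l (Suc j))" for \<epsilon> l
  define w where "w \<epsilon> l = s \<epsilon> * \<theta> l" for \<epsilon> l
  define E where "E \<epsilon> m = (\<Sum>l\<le>N. e \<epsilon> l * w \<epsilon> l ^ m)" for \<epsilon> m
  define \<beta> where "\<beta> j m = (\<Sum>l\<le>N. b l (Suc j) * \<theta> l ^ m)" for j m
  define ah where "ah m = (if m < N then \<alpha> m else 0)" for m
  have E_eq: "E \<epsilon> m = (\<Sum>j<N. complex_of_real (\<alpha> j) * (s \<epsilon> ^ m / s \<epsilon> ^ Suc j) * \<beta> j m)" for \<epsilon> m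
  proof -
    have "E \<epsilon> m = (\<Sum>l\<le>N. \<Sum>j<N. complex_of_real (\<alpha> j) * (s \<epsilon> ^ m / s \<epsilon> ^ Suc j) * (b l (Suc j) * \<theta> l ^ m))"
      unfolding E_def e_def w_def sum_distrib_right
      by (intro sum.cong refl) (simp add: power_mult_distrib)
    also have "\<dots> = (\<Sum>j<N. complex_of_real (\<alpha> j) * (s \<epsilon> ^ m / s \<epsilon> ^ Suc j) * \<beta> j m)"
      unfolding \<beta>_def sum_distrib_left by (rule sum.swap)
    finally show ?thesis .
  qed
  have \<beta>: "\<beta> j m = (if m = Suc j then 1 else 0)" if "m \<le> N" "j < N" for j m
    unfolding \<beta>_def using b[of m "Suc j"] that by simp
  have s0: "s \<epsilon> \<noteq> 0" if "\<epsilon> > 0" for \<epsilon> using that by (simp add: s_def)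
  have E0: "E \<epsilon> 0 = 0" for \<epsilon>
    unfolding E_eq by (rule sum.neutral) (auto simp: \<beta>)
  have slim: "(s \<longlongrightarrow> 0) (at_right 0)"
    unfolding s_def by (rule tendsto_eq_intros refl)+ simp
  have Elim: "((\<lambda>\<epsilon>. E \<epsilon> (Suc m)) \<longlongrightarrow> complex_of_real (ah m)) (at_right 0)" for m
  proof (cases "m < N")
    case True
    have "E \<epsilon> (Suc m) = complex_of_real (ah m)" if "\<epsilon> > 0" for \<epsilon>
    proof -
      have "E \<epsilon> (Suc m) = (\<Sum>j<N. if m = j then complex_of_real (\<alpha> j) else 0)"
        unfolding E_eq using True s0[OF that] by (intro sum.cong refl) (auto simp: \<beta>)
      then show ?thesis using True by (simp add: ah_def)
    qed
    then have "eventually (\<lambda>\<epsilon>. E \<epsilon> (Suc m) = complex_of_real (ah m)) (at_right 0)"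
      by (auto simp: eventually_at_filter)
    then show ?thesis by (rule tendsto_eventually)
  next
    case False
    have "E \<epsilon> (Suc m) = (\<Sum>j<N. complex_of_real (\<alpha> j) * s \<epsilon> ^ (m - j) * \<beta> j (Suc m))" if "\<epsilon> > 0" for \<epsilon>
      unfolding E_eq using False s0[OF that] by (intro sum.cong refl) (auto simp: power_diff)
    then have ev: "eventually (\<lambda>\<epsilon>. E \<epsilon> (Suc m) = (\<Sum>j<N. complex_of_real (\<alpha> j) * s \<epsilon> ^ (m - j) * \<beta> j (Suc m))) (at_right 0)"
      by (auto simp: eventually_at_filter)
    have "((\<lambda>\<epsilon>. (\<Sum>j<N. complex_of_real (\<alpha> j) * s \<epsilon> ^ (m - j) * \<beta> j (Suc m))) \<longlongrightarrow>
        (\<Sum>j<N. complex_of_real (\<alpha> j) * 0 ^ (m - j) * \<beta> j (Suc m))) (at_right 0)"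
      by (intro tendsto_intros slim)
    also have "(\<Sum>j<N. complex_of_real (\<alpha> j) * 0 ^ (m - j) * \<beta> j (Suc m)) = complex_of_real (ah m)"
      using False by (auto simp: ah_def intro!: sum.neutral)
    finally show ?thesis using ev by (simp add: tendsto_cong)
  qed
  define Main where "Main \<epsilon> = (\<Sum>n<2 * N. complex_of_real (q n) * (\<Sum>i\<le>n. E \<epsilon> (Suc i) * cnj (E \<epsilon> (Suc (n - i)))))" for \<epsilon>
  have Mlim: "(Main \<longlongrightarrow> (\<Sum>n<2 * N. complex_of_real (q n) * (\<Sum>i\<le>n. complex_of_real (ah i) * cnj (complex_of_real (ah (n - i)))))) (at_right 0)"
    unfolding Main_def by (intro tendsto_intros Elim)
  also have "(\<Sum>n<2 * N. complex_of_real (q n) * (\<Sum>i\<le>n. complex_of_real (ah i) * cnj (complex_of_real (ah (n - i))))) =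
      complex_of_real (\<Sum>i<N. \<Sum>j<N. ah i * ah j * q (i + j))"
    by (subst hankel_sum_eq_triangle[symmetric]) (auto simp: ah_def)
  also have "(\<Sum>i<N. \<Sum>j<N. ah i * ah j * q (i + j)) = (\<Sum>i<N. \<Sum>j<N. \<alpha> i * \<alpha> j * q (i + j))"
    by (intro sum.cong refl) (auto simp: ah_def)
  finally have Mlim: "(Main \<longlongrightarrow> complex_of_real (\<Sum>i<N. \<Sum>j<N. \<alpha> i * \<alpha> j * q (i + j))) (at_right 0)" .
  define K where "K w z = w * cnj z * (R w - R (cnj z)) / (w - cnj z)" for w z
  define Tot where "Tot \<epsilon> = (\<Sum>l\<le>N. \<Sum>m\<le>N. e \<epsilon> l * cnj (e \<epsilon> m) * K (w \<epsilon> l) (w \<epsilon> m))" for \<epsilon>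
  define KM where "KM w z = (\<Sum>n<2 * N. complex_of_real (q n) * (\<Sum>i\<le>n. w ^ Suc i * cnj z ^ Suc (n - i)))" for w z
  have Main_eq: "Main \<epsilon> = (\<Sum>l\<le>N. \<Sum>m\<le>N. e \<epsilon> l * cnj (e \<epsilon> m) * KM (w \<epsilon> l) (w \<epsilon> m))" for \<epsilon>
  proof -
    define f where "f l i = e \<epsilon> l * w \<epsilon> l ^ i" for l i
    have "(\<Sum>l\<le>N. \<Sum>m\<le>N. e \<epsilon> l * cnj (e \<epsilon> m) * KM (w \<epsilon> l) (w \<epsilon> m)) =
      (\<Sum>l\<le>N. \<Sum>m\<le>N. \<Sum>n<2 * N. complex_of_real (q n) * (\<Sum>i\<le>n. f l (Suc i) * cnj (f m (Suc (n - i)))))"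
      unfolding KM_def f_def sum_distrib_left by (intro sum.cong refl) (simp add: mult_ac)
    also have "\<dots> = (\<Sum>n<2 * N. \<Sum>l\<le>N. \<Sum>m\<le>N. complex_of_real (q n) * (\<Sum>i\<le>n. f l (Suc i) * cnj (f m (Suc (n - i)))))"
      by (simp only: sum.swap[of _ "{..<2 * N}" "{..N}"])
    also have "\<dots> = (\<Sum>n<2 * N. complex_of_real (q n) * (\<Sum>i\<le>n. (\<Sum>l\<le>N. f l (Suc i)) * cnj (\<Sum>m\<le>N. f m (Suc (n - i)))))"
    proof (rule sum.cong[OF refl])
      fix n
      have "(\<Sum>i\<le>n. (\<Sum>l\<le>N. f l (Suc i)) * cnj (\<Sum>m\<le>N. f m (Suc (n - i)))) =
        (\<Sum>i\<le>n. \<Sum>l\<le>N. \<Sum>m\<le>N. f l (Suc i) * cnj (f m (Suc (n - i))))"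
        unfolding cnj_sum sum_product ..
      also have "\<dots> = (\<Sum>l\<le>N. \<Sum>m\<le>N. \<Sum>i\<le>n. f l (Suc i) * cnj (f m (Suc (n - i))))"
        by (simp only: sum.swap[of _ "{..N}" "{..n}"])
      finally show "(\<Sum>l\<le>N. \<Sum>m\<le>N. complex_of_real (q n) * (\<Sum>i\<le>n. f l (Suc i) * cnj (f m (Suc (n - i))))) =
        complex_of_real (q n) * (\<Sum>i\<le>n. (\<Sum>l\<le>N. f l (Suc i)) * cnj (\<Sum>m\<le>N. f m (Suc (n - i))))"
        by (simp only: sum_distrib_left)
    qed
    also have "\<dots> = Main \<epsilon>"
      unfolding Main_def E_def f_def ..
    finally show ?thesis by simp
  qed
  define B where "B = (\<Sum>l\<le>N. \<Sum>j<N. \<bar>\<alpha> j\<bar> * norm (b l (Suc j)))"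
  have B: "B \<ge> 0" unfolding B_def by (intro sum_nonneg) auto
  have e_bound: "norm (e \<epsilon> l) \<le> B / \<epsilon> ^ N" if "0 < \<epsilon>" "\<epsilon> \<le> 1" "l \<le> N" for \<epsilon> l
  proof -
    have "norm (e \<epsilon> l) \<le> (\<Sum>j<N. \<bar>\<alpha> j\<bar> / \<epsilon> ^ N * norm (b l (Suc j)))"
      unfolding e_def
    proof (rule sum_norm_le)
      fix j assume j: "j \<in> {..<N}"
      have "\<epsilon> ^ N \<le> \<epsilon> ^ Suc j" using j that by (intro power_decreasing) auto
      then have "\<bar>\<alpha> j\<bar> / \<epsilon> ^ Suc j \<le> \<bar>\<alpha> j\<bar> / \<epsilon> ^ N" using that by (intro divide_left_mono mult_pos_pos) auto
      then show "norm (complex_of_real (\<alpha> j) / s \<epsilon> ^ Suc j * b l (Suc j)) \<le> \<bar>\<alpha> j\<bar> / \<epsilon> ^ N * norm (b l (Suc j))"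
        using that mult_right_mono[OF _ norm_ge_zero[of "b l (Suc j)"]]
        by (simp only: norm_mult norm_divide norm_power s_def norm_of_real norm_minus_cancel norm_ii mult_1_left abs_of_pos real_norm_def)
    qed
    also have "\<dots> = (\<Sum>j<N. \<bar>\<alpha> j\<bar> * norm (b l (Suc j))) / \<epsilon> ^ N" by (simp add: sum_divide_distrib)
    also have "\<dots> \<le> B / \<epsilon> ^ N"
      unfolding B_def using that
      by (intro divide_right_mono member_le_sum[of l "{..N}" "\<lambda>l. \<Sum>j<N. \<bar>\<alpha> j\<bar> * norm (b l (Suc j))"]) (auto intro: sum_nonneg)
    finally show ?thesis .
  qed
  define D where "D = real (Suc N)"
  have D: "D > 0" by (simp add: D_def)
  have C: "C \<ge> 0" using bound[of 0] by simp
  have small: "eventually (\<lambda>\<epsilon>. 0 < \<epsilon> \<and> \<epsilon> \<le> 1 \<and> \<epsilon> * D < r \<and> 4 * T * (\<epsilon> * D) \<le> 1) (at_right 0)"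
  proof -
    have "((\<lambda>\<epsilon>. \<epsilon> * D) \<longlongrightarrow> 0) (at_right 0)" "((\<lambda>\<epsilon>. 4 * T * (\<epsilon> * D)) \<longlongrightarrow> 0) (at_right 0)"
      by (rule tendsto_eq_intros refl | simp)+
    then have "eventually (\<lambda>\<epsilon>. \<epsilon> * D < r) (at_right 0)" "eventually (\<lambda>\<epsilon>. 4 * T * (\<epsilon> * D) < 1) (at_right 0)"
      using r by (auto intro: order_tendstoD(2))
    moreover have "eventually (\<lambda>\<epsilon>. \<epsilon> \<in> {0<..<1::real}) (at_right 0)" by (rule eventually_at_right_real) simp
    ultimately show ?thesis by eventually_elim auto
  qed
  have w_bound: "norm (w \<epsilon> l) \<le> \<epsilon> * D" "Im (w \<epsilon> l) < 0" "Re (w \<epsilon> l) = 0" if "\<epsilon> > 0" "l \<le> N" for \<epsilon> l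
    using that by (auto simp: w_def s_def \<theta>_def D_def norm_mult simp del: of_nat_Suc)
  have nonneg: "0 \<le> Re (Tot \<epsilon>)" if "0 < \<epsilon>" "\<epsilon> * D < r" for \<epsilon>
  proof -
    have "(\<Sum>l<Suc N. e \<epsilon> l) = 0" using E0[of \<epsilon>] by (simp add: E_def lessThan_Suc_atMost)
    moreover have "\<forall>l<Suc N. w \<epsilon> l \<in> {w. norm w < r \<and> Re w = 0 \<and> Im w < 0}"
      using w_bound[OF that(1)] that(2) by (force simp: less_Suc_eq_le)
    ultimately have "0 \<le> Re (\<Sum>l<Suc N. \<Sum>m<Suc N. e \<epsilon> l * cnj (e \<epsilon> m) * K (w \<epsilon> l) (w \<epsilon> m))"
      using psd unfolding conditionally_psd_kernel_def K_def by blast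
    then show ?thesis unfolding Tot_def lessThan_Suc_atMost .
  qed
  \<comment> \<open>Two weights of size \<open>1 / \<epsilon> ^ N\<close> meet a remainder of order
    \<open>\<epsilon> ^ (2 * N + 2)\<close>, because the series is cut after \<open>2 * N\<close>
    terms; two powers of \<open>\<epsilon>\<close> are left.\<close>
  define F where "F = (\<Sum>l\<le>N. \<Sum>m\<le>N. B * B * (2 * C * D\<^sup>2 * (2 * T * D) ^ (2 * N)))"
  have diff: "norm (Tot \<epsilon> - Main \<epsilon>) \<le> F * \<epsilon>\<^sup>2" if "0 < \<epsilon>" "\<epsilon> \<le> 1" "\<epsilon> * D < r" "4 * T * (\<epsilon> * D) \<le> 1" for \<epsilon>
  proof -
    have TM: "Tot \<epsilon> - Main \<epsilon> = (\<Sum>l\<le>N. \<Sum>m\<le>N. e \<epsilon> l * cnj (e \<epsilon> m) * (K (w \<epsilon> l) (w \<epsilon> m) - KM (w \<epsilon> l) (w \<epsilon> m)))"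
      unfolding Tot_def Main_eq by (simp only: sum_subtractf[symmetric] right_diff_distrib)
    have "norm (Tot \<epsilon> - Main \<epsilon>) \<le> (\<Sum>l\<le>N. \<Sum>m\<le>N. (B / \<epsilon> ^ N) * (B / \<epsilon> ^ N) * (2 * C * (\<epsilon> * D)\<^sup>2 * (2 * T * (\<epsilon> * D)) ^ (2 * N)))"
      unfolding TM
    proof (intro sum_norm_le)
      fix l m assume l: "l \<in> {..N}" and m: "m \<in> {..N}"
      have ne: "w \<epsilon> l \<noteq> cnj (w \<epsilon> m)"
        using w_bound(2)[of \<epsilon> l] w_bound(2)[of \<epsilon> m] that l m by (auto simp: complex_eq_iff)
      have "norm (K (w \<epsilon> l) (w \<epsilon> m) - KM (w \<epsilon> l) (w \<epsilon> m)) \<le> 2 * C * (\<epsilon> * D)\<^sup>2 * (2 * T * (\<epsilon> * D)) ^ (2 * N)"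
        unfolding K_def KM_def a[symmetric]
        by (rule kernel_power_series_remainder[OF R]) (use that l m ne w_bound bound T in \<open>auto simp: a\<close>)
      then show "norm (e \<epsilon> l * cnj (e \<epsilon> m) * (K (w \<epsilon> l) (w \<epsilon> m) - KM (w \<epsilon> l) (w \<epsilon> m)))
        \<le> (B / \<epsilon> ^ N) * (B / \<epsilon> ^ N) * (2 * C * (\<epsilon> * D)\<^sup>2 * (2 * T * (\<epsilon> * D)) ^ (2 * N))"
        unfolding norm_mult complex_mod_cnj
        using that l m B e_bound by (intro mult_mono) auto
    qed
    moreover have "(B / \<epsilon> ^ N) * (B / \<epsilon> ^ N) * (2 * C * (\<epsilon> * D)\<^sup>2 * (2 * T * (\<epsilon> * D)) ^ (2 * N)) =
      B * B * (2 * C * D\<^sup>2 * (2 * T * D) ^ (2 * N)) * \<epsilon>\<^sup>2"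
    proof -
      have "2 * T * (\<epsilon> * D) = 2 * T * D * \<epsilon>" by simp
      then have "(2 * T * (\<epsilon> * D)) ^ (2 * N) = (2 * T * D) ^ (2 * N) * (\<epsilon> ^ N * \<epsilon> ^ N)"
        by (simp only: power_mult_distrib[of "2 * T * D" \<epsilon>] mult_2[of N] power_add) (simp only: ac_simps)
      then show ?thesis using that by (simp add: power2_eq_square)
    qed
    ultimately show ?thesis unfolding F_def sum_distrib_right by (simp only:)
  qed
  have "((\<lambda>\<epsilon>. Tot \<epsilon> - Main \<epsilon>) \<longlongrightarrow> 0) (at_right 0)"
  proof (rule Lim_null_comparison)
    show "eventually (\<lambda>\<epsilon>. norm (Tot \<epsilon> - Main \<epsilon>) \<le> F * \<epsilon>\<^sup>2) (at_right 0)"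
      using small by eventually_elim (rule diff; simp)
    show "((\<lambda>\<epsilon>. F * \<epsilon>\<^sup>2) \<longlongrightarrow> 0) (at_right 0)"
      by (rule tendsto_eq_intros refl | simp)+
  qed
  from tendsto_add[OF this Mlim] have "(Tot \<longlongrightarrow> complex_of_real (\<Sum>i<N. \<Sum>j<N. \<alpha> i * \<alpha> j * q (i + j))) (at_right 0)"
    by simp
  from tendsto_Re[OF this] have "((\<lambda>\<epsilon>. Re (Tot \<epsilon>)) \<longlongrightarrow> (\<Sum>i<N. \<Sum>j<N. \<alpha> i * \<alpha> j * q (i + j))) (at_right 0)"
    by simp
  moreover have "eventually (\<lambda>\<epsilon>. 0 \<le> Re (Tot \<epsilon>)) (at_right 0)"
    using small by eventually_elim (simp add: nonneg)
  ultimately show "0 \<le> (\<Sum>i<N. \<Sum>j<N. \<alpha> i * \<alpha> j * q (i + j))"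
    by (intro tendsto_lowerbound) auto
qed

text \<open>\<open>compact_distribution T \<pi>\<close> bounds the support by \<open>T\<close>; the strict sign excludes \<open>T = 0\<close>, so that
  \<open>1 / T\<close> is a genuine radius.\<close>

definition compact_distribution :: "real \<Rightarrow> real measure \<Rightarrow> bool" where
  "compact_distribution T \<pi> \<longleftrightarrow> real_distribution \<pi> \<and> T > 0 \<and> (AE t in \<pi>. \<bar>t\<bar> \<le> T)"

lemma compact_distributionD:
  assumes "compact_distribution T \<pi>"
  shows "real_distribution \<pi>" "T > 0" "AE t in \<pi>. \<bar>t\<bar> \<le> T"
  using assms by (auto simp: compact_distribution_def)

lemma power_series_zero_coeffs:
  fixes c :: "nat \<Rightarrow> complex"
  assumes "r > 0" and "\<And>w. norm w < r \<Longrightarrow> (\<lambda>n. c n * w ^ n) sums 0"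
  shows "c n = 0"
proof (rule ccontr)
  assume nz: "c n \<noteq> 0"
  have n0: "n > 0"
  proof (rule ccontr)
    assume "\<not> n > 0"
    then show False using assms(2)[of 0] assms(1) nz powser_sums_zero[of c]
      by (auto dest: sums_unique2)
  qed
  \<comment> \<open>A power series with a nonvanishing coefficient has no zero close to 0 other than
    0 itself; for the zero function this is absurd.\<close>
  obtain s where s: "0 < s" and nz: "\<And>z::complex. z \<in> cball 0 s - {0} \<Longrightarrow> (0 :: complex) \<noteq> 0"
    by (rule powser_0_nonzero[of r 0 c "\<lambda>_. 0" n]) (use assms nz n0 in auto)
  have "complex_of_real s \<in> cball 0 s - {0}" using s(1) by simp
  from nz[OF this] show False by simp
qed

lemma power_series_unique_coeffs:
  fixes a b :: "nat \<Rightarrow> complex"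
  assumes "r > 0" and "\<And>w. norm w < r \<Longrightarrow> (\<lambda>n. a n * w ^ n) sums f w"
    and "\<And>w. norm w < r \<Longrightarrow> (\<lambda>n. b n * w ^ n) sums f w"
  shows "a n = b n"
proof -
  have "(\<lambda>n. (a n - b n) * w ^ n) sums 0" if "norm w < r" for w
    using sums_diff[OF assms(2,3)[OF that]] by (simp add: left_diff_distrib)
  from power_series_zero_coeffs[OF assms(1) this] show ?thesis by simp
qed

section \<open>Integrals against compactly supported laws\<close>

lemma compact_distribution_integrable:
  assumes "compact_distribution T \<pi>" and [measurable]: "f \<in> borel_measurable borel"
    and "\<And>t. \<bar>t\<bar> \<le> T \<Longrightarrow> norm (f t :: 'b::{banach, second_countable_topology}) \<le> B"
  shows "integrable \<pi> f"
proof -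
  interpret real_distribution \<pi> using assms(1) by (rule compact_distributionD)
  show ?thesis
  proof (rule integrable_const_bound)
    show "AE t in \<pi>. norm (f t) \<le> B"
      using compact_distributionD(3)[OF assms(1)] by eventually_elim (rule assms(3))
  qed auto
qed

lemma compact_distribution_integral_norm_le:
  assumes "compact_distribution T \<pi>" and [measurable]: "f \<in> borel_measurable borel"
    and "\<And>t. \<bar>t\<bar> \<le> T \<Longrightarrow> norm (f t :: 'b::{banach, second_countable_topology}) \<le> B"
  shows "norm (LINT t|\<pi>. f t) \<le> B"
proof -
  interpret real_distribution \<pi> using assms(1) by (rule compact_distributionD)
  have int: "integrable \<pi> f" by (rule compact_distribution_integrable[OF assms])
  have "AE t in \<pi>. norm (f t) \<le> B"
    using compact_distributionD(3)[OF assms(1)] by eventually_elim (rule assms(3))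
  then have "(LINT t|\<pi>. norm (f t)) \<le> (LINT t|\<pi>. B)"
    using int by (intro integral_mono_AE) auto
  then have "(LINT t|\<pi>. norm (f t)) \<le> B" using prob_space by simp
  then show ?thesis by (rule order_trans[OF integral_norm_bound])
qed

lemma compact_distribution_moment_series:
  assumes \<pi>: "compact_distribution T \<pi>" and w: "norm w * T < 1"
  shows "(\<lambda>n. complex_of_real (LINT t|\<pi>. t ^ n) * w ^ n) sums (LINT t|\<pi>. 1 / (1 - w * complex_of_real t))"
proof -
  interpret real_distribution \<pi> using \<pi> by (rule compact_distributionD)
  note T = compact_distributionD(2)[OF \<pi>]
  have int: "integrable \<pi> (\<lambda>t. (w * complex_of_real t) ^ n)" for n
    by (rule compact_distribution_integrable[OF \<pi>, of _ "(norm w * T) ^ n"])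
      (auto simp: norm_mult norm_power intro!: power_mono mult_left_mono)
  have bnd: "AE t in \<pi>. norm (w * complex_of_real t) \<le> norm w * T"
    using compact_distributionD(3)[OF \<pi>] by eventually_elim (auto simp: norm_mult intro!: mult_left_mono)
  have "(\<lambda>n. LINT t|\<pi>. (w * complex_of_real t) ^ n) sums (LINT t|\<pi>. (\<Sum>n. (w * complex_of_real t) ^ n))"
  proof (rule sums_integral[OF int])
    show "AE t in \<pi>. summable (\<lambda>n. norm ((w * complex_of_real t) ^ n))"
      using bnd by eventually_elim (use w in \<open>auto simp: norm_power intro!: summable_geometric\<close>)
    show "summable (\<lambda>n. LINT t|\<pi>. norm ((w * complex_of_real t) ^ n))"
    proof (rule summable_comparison_test')
      show "summable (\<lambda>n. (norm w * T) ^ n)" using w T by (intro summable_geometric) auto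
      show "norm (LINT t|\<pi>. norm ((w * complex_of_real t) ^ n)) \<le> (norm w * T) ^ n" for n
        by (rule compact_distribution_integral_norm_le[OF \<pi>])
          (auto simp: norm_mult norm_power intro!: power_mono mult_left_mono)
    qed
  qed
  also have "(LINT t|\<pi>. (\<Sum>n. (w * complex_of_real t) ^ n)) = (LINT t|\<pi>. 1 / (1 - w * complex_of_real t))"
  proof (rule integral_cong_AE)
    show "AE t in \<pi>. (\<Sum>n. (w * complex_of_real t) ^ n) = 1 / (1 - w * complex_of_real t)"
      using bnd by eventually_elim (use w in \<open>auto intro!: suminf_geometric\<close>)
  qed auto
  finally show ?thesis
    by (simp add: power_mult_distrib mult.commute flip: of_real_power)
qed

text \<open>Symmetry under conjugation makes the Taylor coefficients of \<open>R\<close> real,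
  convergence makes them grow at most geometrically, and the kernel condition makes their Hankel
  forms positive. The moment problem then represents them, shifted by one, as moments.\<close>

lemma nevanlinna_representation:
  assumes R: "R holomorphic_on ball 0 r" and r: "r > 0"
    and cnj: "\<And>w. norm w < r \<Longrightarrow> R (cnj w) = cnj (R w)"
    and psd: "conditionally_psd_kernel {w. norm w < r \<and> Re w = 0 \<and> Im w < 0}
       (\<lambda>w z. w * cnj z * (R w - R (cnj z)) / (w - cnj z))"
  obtains T \<beta> \<pi> where "compact_distribution T \<pi>" "\<beta> \<ge> 0" "deriv R 0 = of_real \<beta>"
    "\<And>w. norm w * T < 1 \<Longrightarrow> norm w < r \<Longrightarrow>
        R w = R 0 + of_real \<beta> * (LINT t|\<pi>. w / (1 - w * of_real t))"
proof -
  define a where "a n = (deriv ^^ n) R 0 / fact n" for n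
  have sums: "(\<lambda>n. a n * w ^ n) sums R w" if "norm w < r" for w
    using holomorphic_power_series[OF R, of w] that by (simp add: a_def)
  have "a n = cnj (a n)" for n
  proof (rule power_series_unique_coeffs[OF r sums])
    fix w :: complex assume "norm w < r"
    then have "(\<lambda>n. cnj (a n * cnj w ^ n)) sums cnj (R (cnj w))"
      by (intro bounded_linear.sums[OF bounded_linear_cnj] sums) simp
    then show "(\<lambda>n. cnj (a n) * w ^ n) sums R w" using cnj[of w] \<open>norm w < r\<close> by simp
  qed
  then have real: "a n = of_real (Re (a n))" for n
    by (metis Reals_cnj_iff of_real_Re)
  define q where "q n = Re (a (Suc n))" for n
  \<comment> \<open>Convergence at the interior point \<open>r / 2\<close> bounds the coefficients,
    hence the growth rate \<open>2 / r\<close>.\<close>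
  define T where "T = 2 / r"
  have T: "T > 0" using r by (simp add: T_def)
  have "summable (\<lambda>n. a n * of_real (r / 2) ^ n)"
    using sums[of "of_real (r / 2)"] r by (auto simp: sums_iff)
  then have "Bseq (\<lambda>n. a n * of_real (r / 2) ^ n)"
    by (intro convergent_imp_Bseq) (auto dest: summable_LIMSEQ_zero intro: convergentI)
  then obtain B where B: "B > 0" "\<And>n. norm (a n * of_real (r / 2) ^ n) \<le> B"
    by (auto simp: Bseq_def)
  have bound: "\<bar>q n\<bar> \<le> (B * T) * T ^ n" for n
  proof -
    have "norm (a (Suc n)) \<le> B * T ^ Suc n"
    proof -
      have "norm (a (Suc n)) * (r / 2) ^ Suc n \<le> B"
        using B(2)[of "Suc n"] r by (simp only: norm_mult norm_power norm_of_real abs_of_pos half_gt_zero)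
      then show ?thesis using r by (simp add: T_def field_simps)
    qed
    then show ?thesis using abs_Re_le_cmod[of "a (Suc n)"] by (simp add: q_def mult_ac)
  qed
  have q: "a (Suc n) = complex_of_real (q n)" for n using real[of "Suc n"] by (simp add: q_def)
  have "hankel_psd q"
    by (rule hankel_psd_of_conditionally_psd_kernel[OF sums r q bound _ psd]) (use T in auto)
  then interpret bounded_moment_sequence q "B * T" T
    using T bound by unfold_locales
  obtain \<pi> where \<pi>: "real_distribution \<pi>" "AE t in \<pi>. \<bar>t\<bar> \<le> T" "\<And>n. q n = q 0 * (LINT t|\<pi>. t ^ n)"
    by (rule bounded_moment_problem) blast
  have cd: "compact_distribution T \<pi>" using \<pi> T by (simp add: compact_distribution_def)
  show thesis
  proof
    show "compact_distribution T \<pi>" by (rule cd)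
    show "q 0 \<ge> 0" using square_nonneg[of 1] by (simp add: moment_functional_def)
    show "deriv R 0 = of_real (q 0)" using q[of 0] by (simp add: a_def)
    fix w :: complex assume w: "norm w * T < 1" "norm w < r"
    have "(\<lambda>n. w * of_real (q 0) * (complex_of_real (LINT t|\<pi>. t ^ n) * w ^ n)) sums
        (w * of_real (q 0) * (LINT t|\<pi>. 1 / (1 - w * complex_of_real t)))"
      by (intro sums_mult compact_distribution_moment_series[OF cd w(1)])
    moreover have "w * of_real (q 0) * (complex_of_real (LINT t|\<pi>. t ^ n) * w ^ n) = a (Suc n) * w ^ Suc n" for n
      unfolding q using \<pi>(3)[of n] by simp
    ultimately have "(\<lambda>n. a (Suc n) * w ^ Suc n) sums (w * of_real (q 0) * (LINT t|\<pi>. 1 / (1 - w * complex_of_real t)))"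
      by simp
    then have "(\<lambda>n. a n * w ^ n) sums (w * of_real (q 0) * (LINT t|\<pi>. 1 / (1 - w * complex_of_real t)) + a 0)"
      by (subst (asm) sums_Suc_iff) simp
    then have "R w = w * of_real (q 0) * (LINT t|\<pi>. 1 / (1 - w * complex_of_real t)) + a 0"
      using sums[OF w(2)] by (rule sums_unique2[symmetric])
    also have "(LINT t|\<pi>. w / (1 - w * complex_of_real t)) = w * (LINT t|\<pi>. 1 / (1 - w * complex_of_real t))"
      by (simp flip: integral_mult_right_zero)
    ultimately show "R w = R 0 + of_real (q 0) * (LINT t|\<pi>. w / (1 - w * of_real t))"
      by (simp add: a_def)
  qed
qed

section \<open>Local inverses and regular parts of their reciprocals\<close>

lemma holomorphic_local_inverse:
  assumes g: "g holomorphic_on ball 0 r0" and r0: "r0 > 0" and g0: "g 0 = 0" and dg: "deriv g 0 = 1"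
    and cnj: "\<And>z. norm z < r0 \<Longrightarrow> g (cnj z) = cnj (g z)"
  obtains f r s where "r > 0" "s > 0" "s \<le> r0" "f holomorphic_on ball 0 r" "f 0 = 0" "deriv f 0 = 1"
    "\<And>w. norm w < r \<Longrightarrow> norm (f w) < r0 \<and> g (f w) = w \<and> f (cnj w) = cnj (f w)"
    "\<And>z. norm z < s \<Longrightarrow> norm (g z) < r \<and> f (g z) = z"
proof -
  obtain t where t: "t > 0" "ball (0::complex) t \<subseteq> ball 0 r0" "open (g ` ball 0 t)" "inj_on g (ball 0 t)"
    using has_complex_derivative_locally_invertible[OF g, of 0] r0 dg by auto
  have gt: "g holomorphic_on ball 0 t" by (rule holomorphic_on_subset[OF g t(2)])
  have "t \<le> r0"
  proof -
    have "complex_of_real r0 \<notin> ball 0 r0" using r0 by simp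
    then have "complex_of_real r0 \<notin> ball 0 t" using t(2) by blast
    then show ?thesis using r0 by simp
  qed
  obtain f where f: "f holomorphic_on g ` ball 0 t"
    "\<And>z. z \<in> ball 0 t \<Longrightarrow> deriv g z * deriv f (g z) = 1" "\<And>z. z \<in> ball 0 t \<Longrightarrow> f (g z) = z"
    using holomorphic_has_inverse[OF gt _ t(4)] by auto
  have "0 \<in> g ` ball 0 t" using g0 t(1) by (auto simp: image_iff intro!: bexI[of _ 0])
  then obtain r where r: "r > 0" "ball 0 r \<subseteq> g ` ball 0 t"
    using t(3) open_contains_ball by blast
  have "isCont g 0"
    using gt t(1) by (auto dest!: holomorphic_on_imp_continuous_on simp: continuous_on_eq_continuous_at)
  then obtain s0 where s0: "s0 > 0" "\<And>z. norm z < s0 \<Longrightarrow> norm (g z) < r"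
    using r(1) g0 unfolding continuous_at_eps_delta by (auto simp: dist_norm)
  define s where "s = min s0 t"
  show thesis
  proof
    show "r > 0" "s > 0" using r s0 t by (auto simp: s_def)
    show "s \<le> r0" using \<open>t \<le> r0\<close> by (simp add: s_def)
    show "f holomorphic_on ball 0 r" using f(1) r(2) by (rule holomorphic_on_subset)
    show "f 0 = 0" using f(3)[of 0] t(1) g0 by simp
    show "deriv f 0 = 1" using f(2)[of 0] t(1) g0 dg by simp
    show "norm (f w) < r0 \<and> g (f w) = w \<and> f (cnj w) = cnj (f w)" if "norm w < r" for w
    proof -
      have "w \<in> g ` ball 0 t" using r(2) that by auto
      then obtain z where z: "z \<in> ball 0 t" "w = g z" by blast
      have zr: "norm z < r0" using z(1) \<open>t \<le> r0\<close> by simp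
      have "cnj w = g (cnj z)" using cnj[OF zr] z(2) by simp
      then have "f (cnj w) = cnj z" using f(3)[of "cnj z"] z(1) by simp
      then show ?thesis using f(3)[OF z(1)] z zr by simp
    qed
    show "norm (g z) < r \<and> f (g z) = z" if "norm z < s" for z
      using that s0(2)[of z] f(3)[of z] by (simp add: s_def)
  qed
qed

text \<open>Dividing out the zero, inverting, and dividing once more removes both singularities.
  When \<open>f\<close> inverts a Cauchy transform taken in the variable \<open>1 / z\<close>, the
  regular part \<open>R\<close> of \<open>1 / f\<close> is the R-transform.\<close>

lemma holomorphic_reciprocal_difference:
  assumes f: "f holomorphic_on ball 0 r" and r: "r > 0" and f0: "f 0 = 0" and df: "deriv f 0 = 1"
    and nz: "\<And>w. norm w < r \<Longrightarrow> w \<noteq> 0 \<Longrightarrow> f w \<noteq> 0"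
    and cnj: "\<And>w. norm w < r \<Longrightarrow> f (cnj w) = cnj (f w)"
  obtains R where "R holomorphic_on ball 0 r"
    "\<And>w. norm w < r \<Longrightarrow> w \<noteq> 0 \<Longrightarrow> 1 / f w = 1 / w + R w"
    "\<And>w. norm w < r \<Longrightarrow> R (cnj w) = cnj (R w)"
proof -
  define q where "q w = (if w = 0 then deriv f 0 else (f w - f 0) / (w - 0))" for w
  have q: "q holomorphic_on ball 0 r"
    unfolding q_def by (rule pole_lemma[OF f]) (use r in simp)
  have q0: "q w \<noteq> 0" if "norm w < r" for w using nz[OF that] f0 df by (simp add: q_def)
  define p where "p w = 1 / q w" for w
  have p: "p holomorphic_on ball 0 r"
    unfolding p_def by (intro holomorphic_intros q) (use q0 in auto)
  define R where "R w = (if w = 0 then deriv p 0 else (p w - p 0) / (w - 0))" for w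
  have R: "R holomorphic_on ball 0 r"
    unfolding R_def by (rule pole_lemma[OF p]) (use r in simp)
  have eq: "1 / f w = 1 / w + R w" if "norm w < r" "w \<noteq> 0" for w
    using that nz[OF that] f0 df by (simp add: R_def p_def q_def field_simps)
  have sym: "R (cnj w) = cnj (R w)" if "norm w < r" "w \<noteq> 0" for w
  proof -
    have "norm (cnj w) < r" "cnj w \<noteq> 0" using that by simp_all
    from eq[OF this] have "1 / cnj w + R (cnj w) = cnj (1 / f w)"
      by (simp only: cnj[OF that(1)] complex_cnj_divide complex_cnj_one)
    also have "\<dots> = 1 / cnj w + cnj (R w)"
      by (simp only: eq[OF that] complex_cnj_divide complex_cnj_one complex_cnj_add)
    finally show ?thesis by simp
  qed
  \<comment> \<open>The equation for \<open>1 / f\<close> is silent at 0, where the symmetry has to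
    come from continuity.\<close>
  have "cnj (R 0) = R 0"
  proof (rule tendsto_unique)
    have cont: "(R \<longlongrightarrow> R 0) (at 0)"
      using R r by (auto dest!: holomorphic_on_imp_continuous_on simp: continuous_on_eq_continuous_at isCont_def)
    then show "((\<lambda>w. cnj (R w)) \<longlongrightarrow> cnj (R 0)) (at 0)" by (rule tendsto_cnj)
    have "filterlim cnj (at 0) (at 0)"
      unfolding filterlim_at by (auto simp: eventually_at_filter intro!: tendsto_eq_intros)
    from filterlim_compose[OF cont this] have "((\<lambda>w. R (cnj w)) \<longlongrightarrow> R 0) (at 0)" .
    moreover have "eventually (\<lambda>w. R (cnj w) = cnj (R w)) (at 0)"
      unfolding eventually_at using r sym by (auto simp: dist_norm)
    ultimately show "((\<lambda>w. cnj (R w)) \<longlongrightarrow> R 0) (at 0)"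
      by (simp add: tendsto_cong)
  qed simp
  then have "R (cnj w) = cnj (R w)" if "norm w < r" for w using sym[OF that] by (cases "w = 0") simp_all
  then show thesis using that[OF R eq] by blast
qed

section \<open>Calculus of positive semidefinite kernels\<close>

lemma psd_kernelI:
  assumes "\<And>(n::nat) w c. (\<And>i. i < n \<Longrightarrow> w i \<in> S) \<Longrightarrow>
     0 \<le> Re (\<Sum>i<n. \<Sum>j<n. c i * cnj (c j) * K (w i) (w j))"
  shows "psd_kernel S K"
  using assms unfolding psd_kernel_def by blast

lemma psd_kernelD:
  fixes n :: nat
  assumes "psd_kernel S K" "\<And>i. i < n \<Longrightarrow> w i \<in> S"
  shows "0 \<le> Re (\<Sum>i<n. \<Sum>j<n. c i * cnj (c j) * K (w i) (w j))"
  using assms(1)[unfolded psd_kernel_def, rule_format, of n w c] assms(2) by blast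

lemma psd_imp_conditionally_psd: "psd_kernel S K \<Longrightarrow> conditionally_psd_kernel S K"
  unfolding psd_kernel_def conditionally_psd_kernel_def by blast

lemma psd_kernel_cong:
  assumes "psd_kernel S K" "\<And>w z. w \<in> S \<Longrightarrow> z \<in> S \<Longrightarrow> K w z = K' w z"
  shows "psd_kernel S K'"
proof (rule psd_kernelI)
  fix n :: nat and w c assume w: "\<And>i. i < n \<Longrightarrow> w i \<in> S"
  have "(\<Sum>i<n. \<Sum>j<n. c i * cnj (c j) * K' (w i) (w j)) = (\<Sum>i<n. \<Sum>j<n. c i * cnj (c j) * K (w i) (w j))"
    by (intro sum.cong refl) (simp add: assms(2) w)
  then show "0 \<le> Re (\<Sum>i<n. \<Sum>j<n. c i * cnj (c j) * K' (w i) (w j))"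
    using psd_kernelD[OF assms(1) w, where n = n and c = c] by (simp only:)
qed

lemma psd_kernel_add:
  assumes "psd_kernel S K" "psd_kernel S K'"
  shows "psd_kernel S (\<lambda>w z. K w z + K' w z)"
proof (rule psd_kernelI)
  fix n :: nat and w c assume w: "\<And>i. i < n \<Longrightarrow> w i \<in> S"
  show "0 \<le> Re (\<Sum>i<n. \<Sum>j<n. c i * cnj (c j) * (K (w i) (w j) + K' (w i) (w j)))"
    using psd_kernelD[OF assms(1) w, where n = n and c = c] psd_kernelD[OF assms(2) w, where n = n and c = c]
    by (simp only: distrib_left sum.distrib plus_complex.sel add_nonneg_nonneg)
qed

lemma psd_kernel_weight:
  assumes "psd_kernel S K"
  shows "psd_kernel S (\<lambda>w z. f w * cnj (f z) * K w z)"
proof (rule psd_kernelI)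
  fix n :: nat and w c assume w: "\<And>i. i < n \<Longrightarrow> w i \<in> S"
  have "(\<Sum>i<n. \<Sum>j<n. c i * cnj (c j) * (f (w i) * cnj (f (w j)) * K (w i) (w j))) =
    (\<Sum>i<n. \<Sum>j<n. (c i * f (w i)) * cnj (c j * f (w j)) * K (w i) (w j))"
    by (intro sum.cong refl) simp
  then show "0 \<le> Re (\<Sum>i<n. \<Sum>j<n. c i * cnj (c j) * (f (w i) * cnj (f (w j)) * K (w i) (w j)))"
    using psd_kernelD[OF assms w, where n = n and c = "\<lambda>i. c i * f (w i)"] by (simp only:)
qed

lemma psd_kernel_one: "psd_kernel S (\<lambda>w z. 1)"
proof (rule psd_kernelI)
  fix n :: nat and w c
  have "(\<Sum>i<n. \<Sum>j<n. c i * cnj (c j) * 1) = (\<Sum>i<n. c i) * cnj (\<Sum>i<n. c i)"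
    by (simp add: sum_product)
  moreover have "0 \<le> Re (u * cnj u)" for u by (simp add: complex_mult_cnj)
  ultimately show "0 \<le> Re (\<Sum>i<n. \<Sum>j<n. c i * cnj (c j) * 1)" by (simp only:)
qed

lemma psd_kernel_rank_one: "psd_kernel S (\<lambda>w z. f w * cnj (f z))"
  using psd_kernel_weight[OF psd_kernel_one, of S f] by simp

lemma psd_kernel_scale:
  assumes "psd_kernel S K" "b \<ge> 0"
  shows "psd_kernel S (\<lambda>w z. complex_of_real b * K w z)"
proof (rule psd_kernel_cong[OF psd_kernel_weight[OF assms(1), of "\<lambda>_. complex_of_real (sqrt b)"]])
  show "complex_of_real (sqrt b) * cnj (complex_of_real (sqrt b)) * K w z = complex_of_real b * K w z" for w z
    using assms(2) by (simp flip: of_real_mult)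
qed

lemma psd_kernel_limit:
  assumes "\<And>n. psd_kernel S (K n)"
    and "\<And>w z. w \<in> S \<Longrightarrow> z \<in> S \<Longrightarrow> (\<lambda>n. K n w z) \<longlonglongrightarrow> L w z"
  shows "psd_kernel S L"
proof (rule psd_kernelI)
  fix n :: nat and w c assume w: "\<And>i. i < n \<Longrightarrow> w i \<in> S"
  have "(\<lambda>m. Re (\<Sum>i<n. \<Sum>j<n. c i * cnj (c j) * K m (w i) (w j))) \<longlonglongrightarrow>
      Re (\<Sum>i<n. \<Sum>j<n. c i * cnj (c j) * L (w i) (w j))"
    by (intro tendsto_intros assms(2)) (auto simp: w)
  then show "0 \<le> Re (\<Sum>i<n. \<Sum>j<n. c i * cnj (c j) * L (w i) (w j))"
    by (rule LIMSEQ_le_const) (intro exI[of _ 0] allI impI psd_kernelD[OF assms(1) w])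
qed

text \<open>Closure under multipliers that are visibly of this kind takes the place of the Schur product theorem.\<close>

definition psd_multiplier :: "complex set \<Rightarrow> (complex \<Rightarrow> complex \<Rightarrow> complex) \<Rightarrow> bool" where
  "psd_multiplier S M \<longleftrightarrow> (\<forall>K. psd_kernel S K \<longrightarrow> psd_kernel S (\<lambda>w z. M w z * K w z))"

lemma psd_multiplierD: "psd_multiplier S M \<Longrightarrow> psd_kernel S K \<Longrightarrow> psd_kernel S (\<lambda>w z. M w z * K w z)"
  unfolding psd_multiplier_def by blast

lemma psd_multiplier_imp_psd: "psd_multiplier S M \<Longrightarrow> psd_kernel S M"
  using psd_multiplierD[OF _ psd_kernel_one] by simp

text \<open>For each t the factor \<open>f t w * cnj (f t z)\<close> is a mere weight, which
  preserves positivity; the quadratic form of the product is the integral of nonnegative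
  ones.\<close>

lemma psd_multiplier_integral:
  assumes "real_distribution \<pi>"
    and [measurable]: "\<And>w. w \<in> S \<Longrightarrow> (\<lambda>t. f t w) \<in> borel_measurable borel"
    and bound: "\<And>w. w \<in> S \<Longrightarrow> AE t in \<pi>. norm (f t w) \<le> B w"
  shows "psd_multiplier S (\<lambda>w z. LINT t|\<pi>. f t w * cnj (f t z))"
  unfolding psd_multiplier_def
proof (intro allI impI psd_kernelI)
  interpret real_distribution \<pi> by fact
  fix K and n :: nat and w c assume K: "psd_kernel S K" and w: "\<And>i. i < n \<Longrightarrow> w i \<in> S"
  have int: "integrable \<pi> (\<lambda>t. f t (w i) * cnj (f t (w j)))" if "i < n" "j < n" for i j
  proof (rule integrable_const_bound)
    show "AE t in \<pi>. norm (f t (w i) * cnj (f t (w j))) \<le> B (w i) * B (w j)"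
      using bound[OF w[OF \<open>i < n\<close>]] bound[OF w[OF \<open>j < n\<close>]]
    proof eventually_elim
      case (elim t)
      have "0 \<le> B (w i)" using norm_ge_zero elim(1) by (rule order_trans)
      with elim show ?case unfolding norm_mult complex_mod_cnj by (intro mult_mono) auto
    qed
    have [measurable]: "(\<lambda>t. f t (w i)) \<in> borel_measurable borel" "(\<lambda>t. f t (w j)) \<in> borel_measurable borel"
      using assms(2) w that by auto
    have "(\<lambda>t. f t (w i) * cnj (f t (w j))) \<in> borel_measurable borel"
      by (intro borel_measurable_times borel_measurable_continuous_on[OF continuous_on_cnj[OF continuous_on_id]]) measurable
    then show "(\<lambda>t. f t (w i) * cnj (f t (w j))) \<in> borel_measurable \<pi>" by simp
  qed
  have "(\<Sum>i<n. \<Sum>j<n. c i * cnj (c j) * ((LINT t|\<pi>. f t (w i) * cnj (f t (w j))) * K (w i) (w j))) =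
    (\<Sum>i<n. \<Sum>j<n. (LINT t|\<pi>. (c i * cnj (c j) * K (w i) (w j)) * (f t (w i) * cnj (f t (w j)))))"
    by (subst integral_mult_right_zero) (simp only: mult_ac)
  also have "\<dots> = (LINT t|\<pi>. (\<Sum>i<n. \<Sum>j<n. (c i * cnj (c j) * K (w i) (w j)) * (f t (w i) * cnj (f t (w j)))))"
  proof -
    have int': "integrable \<pi> (\<lambda>t. (c i * cnj (c j) * K (w i) (w j)) * (f t (w i) * cnj (f t (w j))))"
      if "i < n" "j < n" for i j
      using int[OF that] by (rule integrable_mult_right)
    then have "(LINT t|\<pi>. (\<Sum>i<n. \<Sum>j<n. (c i * cnj (c j) * K (w i) (w j)) * (f t (w i) * cnj (f t (w j))))) =
      (\<Sum>i<n. LINT t|\<pi>. (\<Sum>j<n. (c i * cnj (c j) * K (w i) (w j)) * (f t (w i) * cnj (f t (w j)))))"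
      by (intro Bochner_Integration.integral_sum Bochner_Integration.integrable_sum) auto
    also have "\<dots> = (\<Sum>i<n. \<Sum>j<n. (LINT t|\<pi>. (c i * cnj (c j) * K (w i) (w j)) * (f t (w i) * cnj (f t (w j)))))"
      by (rule sum.cong[OF refl], rule Bochner_Integration.integral_sum) (auto intro: int')
    finally show ?thesis by (rule sym)
  qed
  finally have eq: "(\<Sum>i<n. \<Sum>j<n. c i * cnj (c j) * ((LINT t|\<pi>. f t (w i) * cnj (f t (w j))) * K (w i) (w j))) = \<dots>" .
  have "Re \<dots> = (LINT t|\<pi>. Re (\<Sum>i<n. \<Sum>j<n. (c i * cnj (c j) * K (w i) (w j)) * (f t (w i) * cnj (f t (w j)))))"
    by (rule integral_Re[symmetric]) (auto intro!: Bochner_Integration.integrable_sum integrable_mult_right int)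
  also have "0 \<le> \<dots>"
  proof (rule Bochner_Integration.integral_nonneg)
    fix t
    have "(\<Sum>i<n. \<Sum>j<n. (c i * cnj (c j) * K (w i) (w j)) * (f t (w i) * cnj (f t (w j)))) =
      (\<Sum>i<n. \<Sum>j<n. (c i * f t (w i)) * cnj (c j * f t (w j)) * K (w i) (w j))"
      by (intro sum.cong refl) simp
    then show "0 \<le> Re (\<Sum>i<n. \<Sum>j<n. (c i * cnj (c j) * K (w i) (w j)) * (f t (w i) * cnj (f t (w j))))"
      using psd_kernelD[OF K w, where n = n and c = "\<lambda>i. c i * f t (w i)"] by (simp only:)
  qed
  finally show "0 \<le> Re (\<Sum>i<n. \<Sum>j<n. c i * cnj (c j) * ((LINT t|\<pi>. f t (w i) * cnj (f t (w j))) * K (w i) (w j)))"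
    unfolding eq .
qed

lemma psd_multiplier_compact_integral:
  assumes \<pi>: "compact_distribution T \<pi>"
    and "\<And>w. w \<in> S \<Longrightarrow> (\<lambda>t. f t w) \<in> borel_measurable borel"
    and bound: "\<And>w t. w \<in> S \<Longrightarrow> \<bar>t\<bar> \<le> T \<Longrightarrow> norm (f t w) \<le> B w"
  shows "psd_multiplier S (\<lambda>w z. LINT t|\<pi>. f t w * cnj (f t z))"
proof (rule psd_multiplier_integral[OF compact_distributionD(1)[OF \<pi>] assms(2)])
  show "AE t in \<pi>. norm (f t w) \<le> B w" if "w \<in> S" for w
    using compact_distributionD(3)[OF \<pi>] by eventually_elim (rule bound[OF that])
qed

lemma psd_multiplier_weight:
  assumes "psd_multiplier S M"
  shows "psd_multiplier S (\<lambda>w z. f w * cnj (f z) * M w z)"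
  unfolding psd_multiplier_def
  using psd_kernel_weight[OF psd_multiplierD[OF assms], of _ f] by (simp add: mult.assoc)

text \<open>Expand \<open>1 / (1 - M)\<close>: each partial sum consists of iterated multiples of
  \<open>K\<close>, and positivity passes to pointwise limits.\<close>

lemma psd_kernel_geometric:
  assumes M: "psd_multiplier S M" and K: "psd_kernel S K"
    and lt: "\<And>w z. w \<in> S \<Longrightarrow> z \<in> S \<Longrightarrow> norm (M w z) < 1"
  shows "psd_kernel S (\<lambda>w z. K w z / (1 - M w z))"
proof (rule psd_kernel_limit)
  have pow: "psd_kernel S (\<lambda>w z. M w z ^ n * K w z)" for n
    by (induction n) (use K psd_multiplierD[OF M] in \<open>auto simp: mult.assoc\<close>)
  show "psd_kernel S (\<lambda>w z. \<Sum>k<n. M w z ^ k * K w z)" for n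
  proof (induction n)
    case 0
    show ?case by (simp add: psd_kernel_def)
  next
    case (Suc n)
    from psd_kernel_add[OF Suc pow[of n]] show ?case by simp
  qed
  show "(\<lambda>n. \<Sum>k<n. M w z ^ k * K w z) \<longlonglongrightarrow> K w z / (1 - M w z)" if "w \<in> S" "z \<in> S" for w z
    using sums_mult2[OF geometric_sums[OF lt[OF that]], of "K w z"] by (simp add: sums_def)
qed

section \<open>From a Levy representation to free infinite divisibility\<close>

text \<open>The local form of \<open>\<phi>(1/w)\<close> for a function \<open>\<phi>\<close> with the Levy-Khintchine representation
  \<open>\<phi> u = \<alpha> + \<beta> \<integral> 1 / (u - t) d\<pi>\<close> near infinity; the value at 0 stands for \<open>\<alpha>\<close>.\<close>

definition levy_representation :: "(complex \<Rightarrow> complex) \<Rightarrow> real \<Rightarrow> real \<Rightarrow> real \<Rightarrow> real measure \<Rightarrow> bool" where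
  "levy_representation R r T \<beta> \<pi> \<longleftrightarrow> R holomorphic_on ball 0 r \<and> r > 0 \<and> r * T \<le> 1 / 2 \<and>
     (\<forall>w. norm w < r \<longrightarrow> R (cnj w) = cnj (R w)) \<and> compact_distribution T \<pi> \<and> \<beta> \<ge> 0 \<and>
     (\<forall>w. norm w < r \<longrightarrow> R w = R 0 + of_real \<beta> * (LINT t|\<pi>. w / (1 - w * of_real t)))"

lemma levy_representationD:
  assumes "levy_representation R r T \<beta> \<pi>"
  shows "R holomorphic_on ball 0 r" "r > 0" "r * T \<le> 1 / 2" "compact_distribution T \<pi>" "\<beta> \<ge> 0"
    "norm w < r \<Longrightarrow> R (cnj w) = cnj (R w)"
    "norm w < r \<Longrightarrow> R w = R 0 + of_real \<beta> * (LINT t|\<pi>. w / (1 - w * of_real t))"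
  using assms unfolding levy_representation_def by blast+

lemma levy_denominator:
  assumes "norm (w :: complex) < r" "r * T \<le> 1 / 2" "\<bar>t\<bar> \<le> T"
  shows "norm (1 - w * of_real t) \<ge> 1 / 2" "1 - w * of_real t \<noteq> 0"
proof -
  have "norm (w * of_real t) \<le> r * T"
    unfolding norm_mult using assms norm_ge_zero[of w] by (intro mult_mono) (auto simp del: norm_ge_zero)
  then have "norm (w * of_real t) \<le> 1 / 2" using assms by simp
  moreover have "norm (1 - w * of_real t) \<ge> norm (1 :: complex) - norm (w * of_real t)"
    by (rule norm_triangle_ineq2)
  ultimately show "norm (1 - w * of_real t) \<ge> 1 / 2" by simp
  then show "1 - w * of_real t \<noteq> 0" by auto
qed

text \<open>Divided differences of the two transforms. The integrand on the right of the first one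
  becomes a Gram kernel once \<open>z\<close> is replaced by a conjugate point.\<close>

lemma compact_distribution_partial_fractions:
  assumes \<mu>: "compact_distribution B \<mu>" and r: "r * B \<le> 1 / 2" and w: "norm w < r" and z: "norm z < r"
  shows "(LINT t|\<mu>. w / (1 - w * complex_of_real t)) - (LINT t|\<mu>. z / (1 - z * complex_of_real t)) =
      (w - z) * (LINT t|\<mu>. 1 / ((1 - w * of_real t) * (1 - z * of_real t)))"
    and "(LINT t|\<mu>. 1 / (1 - w * complex_of_real t)) - (LINT t|\<mu>. 1 / (1 - z * complex_of_real t)) =
      (w - z) * (LINT t|\<mu>. of_real t / ((1 - w * of_real t) * (1 - z * of_real t)))"
proof -
  interpret real_distribution \<mu> using \<mu> by (rule compact_distributionD)
  have int: "integrable \<mu> (\<lambda>t. c / (1 - w * complex_of_real t))" if "norm w < r" for c w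
  proof (rule compact_distribution_integrable[OF \<mu>])
    show "norm (c / (1 - w * complex_of_real t)) \<le> norm c / (1 / 2)" if "\<bar>t\<bar> \<le> B" for t
      unfolding norm_divide using levy_denominator[OF \<open>norm w < r\<close> r that] by (intro divide_left_mono) auto
  qed auto
  have *: "(LINT t|\<mu>. c / (1 - w * complex_of_real t)) - (LINT t|\<mu>. d / (1 - z * complex_of_real t)) =
      (w - z) * (LINT t|\<mu>. h t / ((1 - w * of_real t) * (1 - z * of_real t)))"
    if h: "\<And>t. c * (1 - z * complex_of_real t) - d * (1 - w * complex_of_real t) = (w - z) * h t"
      and [measurable]: "h \<in> borel_measurable borel" for c d h
  proof -
    have "(LINT t|\<mu>. c / (1 - w * complex_of_real t)) - (LINT t|\<mu>. d / (1 - z * complex_of_real t)) =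
      (LINT t|\<mu>. c / (1 - w * complex_of_real t) - d / (1 - z * complex_of_real t))"
      by (rule Bochner_Integration.integral_diff[symmetric]) (intro int w z)+
    also have "\<dots> = (LINT t|\<mu>. (w - z) * (h t / ((1 - w * of_real t) * (1 - z * of_real t))))"
    proof (rule integral_cong_AE)
      show "AE t in \<mu>. c / (1 - w * complex_of_real t) - d / (1 - z * complex_of_real t) =
        (w - z) * (h t / ((1 - w * of_real t) * (1 - z * of_real t)))"
        using compact_distributionD(3)[OF \<mu>]
      proof eventually_elim
        case (elim t)
        show ?case
          using levy_denominator(2)[OF w r elim] levy_denominator(2)[OF z r elim]
          unfolding times_divide_eq_right h[symmetric] by (rule diff_frac_eq)
      qed
    qed auto
    also have "\<dots> = (w - z) * (LINT t|\<mu>. h t / ((1 - w * of_real t) * (1 - z * of_real t)))"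
      by (rule integral_mult_right_zero)
    finally show ?thesis .
  qed
  show "(LINT t|\<mu>. w / (1 - w * complex_of_real t)) - (LINT t|\<mu>. z / (1 - z * complex_of_real t)) =
      (w - z) * (LINT t|\<mu>. 1 / ((1 - w * of_real t) * (1 - z * of_real t)))"
    by (rule *) (auto simp: algebra_simps)
  show "(LINT t|\<mu>. 1 / (1 - w * complex_of_real t)) - (LINT t|\<mu>. 1 / (1 - z * complex_of_real t)) =
      (w - z) * (LINT t|\<mu>. of_real t / ((1 - w * of_real t) * (1 - z * of_real t)))"
    by (rule *) (auto simp: algebra_simps)
qed

lemma levy_integrable:
  assumes \<pi>: "compact_distribution T \<pi>" and r: "r * T \<le> 1 / 2" and w: "norm w < r" and z: "norm z < r"
  shows "integrable \<pi> (\<lambda>t. 1 / ((1 - w * complex_of_real t) * (1 - z * of_real t)))"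
    and "norm (LINT t|\<pi>. 1 / ((1 - w * complex_of_real t) * (1 - z * of_real t))) \<le> 4"
proof -
  have *: "norm (1 / ((1 - w * complex_of_real t) * (1 - z * of_real t))) \<le> 4" if "\<bar>t\<bar> \<le> T" for t
  proof -
    have "(1 / 2) * (1 / 2) \<le> norm (1 - w * complex_of_real t) * norm (1 - z * of_real t)"
      using levy_denominator(1)[OF w r that] levy_denominator(1)[OF z r that] by (intro mult_mono) auto
    moreover have "(1 - w * complex_of_real t) * (1 - z * of_real t) \<noteq> 0"
      using levy_denominator(2)[OF w r that] levy_denominator(2)[OF z r that] by simp
    ultimately show ?thesis unfolding norm_divide norm_mult by (simp add: divide_le_eq)
  qed
  show "integrable \<pi> (\<lambda>t. 1 / ((1 - w * complex_of_real t) * (1 - z * of_real t)))"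
    by (rule compact_distribution_integrable[OF \<pi> _ *]) auto
  show "norm (LINT t|\<pi>. 1 / ((1 - w * complex_of_real t) * (1 - z * of_real t))) \<le> 4"
    by (rule compact_distribution_integral_norm_le[OF \<pi> _ *]) auto
qed

lemma levy_difference:
  assumes L: "levy_representation R r T \<beta> \<pi>" and w: "norm w < r" and z: "norm z < r"
  shows "R w - R z = of_real \<beta> * (w - z) * (LINT t|\<pi>. 1 / ((1 - w * of_real t) * (1 - z * of_real t)))"
proof -
  note L = levy_representationD[OF L]
  show ?thesis
    unfolding L(7)[OF w] L(7)[OF z]
    by (simp only: add_diff_cancel_left right_diff_distrib[symmetric] mult.assoc
        compact_distribution_partial_fractions(1)[OF L(4,3) w z])
qed

text \<open>If \<open>g\<close> is the inverse of \<open>w / (1 + c w R w)\<close>, the kernel of \<open>g\<close> is a geometric series in the kernel of \<open>c R\<close>,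
  so that \<open>g\<close> is itself the Cauchy transform (in \<open>1 / z\<close>) of a measure.\<close>

lemma exists_distribution_of_levy_representation:
  assumes L: "levy_representation R r T \<beta> \<pi>" and c: "c > 0"
  obtains \<nu> T' \<epsilon> where "compact_distribution T' \<nu>" "\<epsilon> > 0"
    "\<And>w. w \<noteq> 0 \<Longrightarrow> norm w < \<epsilon> \<Longrightarrow> norm (w / (1 + of_real c * w * R w)) * T' < 1 \<and> 1 + of_real c * w * R w \<noteq> 0 \<and>
       (LINT t|\<nu>. 1 / (1 / w + of_real c * R w - of_real t)) = w"
proof -
  note LD = levy_representationD[OF L]
  have contR: "isCont R 0"
    using LD(1,2) by (auto dest!: holomorphic_on_imp_continuous_on simp: continuous_on_eq_continuous_at)
  have "((\<lambda>w. norm (of_real c * w * R w)) \<longlongrightarrow> 0) (nhds 0)"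
    using contR unfolding isCont_def tendsto_at_iff_tendsto_nhds
    by (auto intro!: tendsto_eq_intros filterlim_ident)
  then have "eventually (\<lambda>w. norm (of_real c * w * R w) < 1 / 2) (nhds 0)"
    by (rule order_tendstoD) simp
  then obtain r0 where r0: "r0 > 0" "\<And>w. norm w < r0 \<Longrightarrow> norm (of_real c * w * R w) < 1 / 2"
    unfolding eventually_nhds_metric by (auto simp: dist_norm)
  \<comment> \<open>The integral in the kernel \<open>M\<close> is at most 4, since both
    denominators have modulus at least 1/2; this choice of radius forces
    \<open>norm (M w z) < 1\<close>.\<close>
  have "((\<lambda>x::real. 4 * c * \<beta> * (x * x)) \<longlongrightarrow> 4 * c * \<beta> * (0 * 0)) (at_right 0)"
    by (intro tendsto_intros)
  then have "eventually (\<lambda>x. 4 * c * \<beta> * (x * x) < 1) (at_right 0)"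
    by (rule order_tendstoD) simp
  moreover have "eventually (\<lambda>x. x \<in> {0<..<min r r0}) (at_right 0)"
    using r0(1) LD(2) by (intro eventually_at_right_real) simp
  ultimately have "eventually (\<lambda>x. 0 < x \<and> x < r \<and> x < r0 \<and> 4 * c * \<beta> * (x * x) < 1) (at_right 0)"
    by eventually_elim auto
  then obtain r1 where r1: "r1 > 0" "r1 < r" "r1 < r0" "4 * c * \<beta> * (r1 * r1) < 1"
    using eventually_happens'[OF trivial_limit_at_right_real] by blast
  define h where "h w = 1 + of_real c * w * R w" for w
  have h0: "h w \<noteq> 0" if "norm w < r1" for w
  proof
    assume "h w = 0"
    then have "norm (of_real c * w * R w) = norm (- 1 :: complex)" by (metis h_def add_eq_0_iff)
    then show False using r0(2)[of w] that r1 by simp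
  qed
  define f where "f w = w / h w" for w
  have holR: "R holomorphic_on ball 0 r1"
    by (rule holomorphic_on_subset[OF LD(1)]) (use r1 in auto)
  have holf: "f holomorphic_on ball 0 r1"
    unfolding f_def h_def by (intro holomorphic_intros holR) (use h0 in \<open>auto simp: h_def\<close>)
  have f0: "f 0 = 0" by (simp add: f_def)
  have df: "deriv f 0 = 1"
  proof (rule DERIV_imp_deriv)
    have "(R has_field_derivative deriv R 0) (at 0)"
      using holR r1(1) by (intro holomorphic_derivI[of _ "ball 0 r1"]) auto
    then show "(f has_field_derivative 1) (at 0)"
      unfolding f_def h_def by (auto intro!: derivative_eq_intros)
  qed
  have fcnj: "f (cnj w) = cnj (f w)" if "norm w < r1" for w
    using LD(6)[of w] that r1 by (simp add: f_def h_def)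
  obtain g r2 s where g: "r2 > 0" "s > 0" "s \<le> r1" "g holomorphic_on ball 0 r2" "g 0 = 0" "deriv g 0 = 1"
    "\<And>z. norm z < r2 \<Longrightarrow> norm (g z) < r1 \<and> f (g z) = z \<and> g (cnj z) = cnj (g z)"
    "\<And>w. norm w < s \<Longrightarrow> norm (f w) < r2 \<and> g (f w) = w"
    by (rule holomorphic_local_inverse[OF holf r1(1) f0 df fcnj]) (assumption, rule that, assumption+)
  define S where "S = {z :: complex. norm z < r2 \<and> Re z = 0 \<and> Im z < 0}"
  define F where "F t z = of_real (sqrt (c * \<beta>)) * g z / (1 - g z * of_real t)" for t :: real and z
  define M where "M w z = (LINT t|\<pi>. F t w * cnj (F t z))" for w z
  have F_bound: "norm (F t z) \<le> sqrt (c * \<beta>) * r1 * 2" if "z \<in> S" "\<bar>t\<bar> \<le> T" for t z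
  proof -
    have gz: "norm (g z) < r1" using g(7)[of z] that by (simp add: S_def)
    have d: "1 / 2 \<le> norm (1 - g z * of_real t)"
      by (rule levy_denominator) (use gz r1 LD(3) that in auto)
    have "norm (F t z) = sqrt (c * \<beta>) * norm (g z) / norm (1 - g z * of_real t)"
      using c LD(5) by (simp add: F_def norm_mult norm_divide)
    also have "\<dots> \<le> sqrt (c * \<beta>) * r1 / (1 / 2)"
      using d gz c LD(5) r1(1) by (intro frac_le mult_mono) auto
    finally show ?thesis by simp
  qed
  have [measurable]: "(\<lambda>t. F t z) \<in> borel_measurable borel" for z
    unfolding F_def by measurable
  have mult: "psd_multiplier S M"
    unfolding M_def by (rule psd_multiplier_compact_integral[OF LD(4), of S F]) (use F_bound in auto)
  have M_eq: "M w z = of_real (c * \<beta>) * (g w * cnj (g z)) * (LINT t|\<pi>. 1 / ((1 - g w * of_real t) * (1 - cnj (g z) * of_real t)))" for w z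
  proof -
    have "F t w * cnj (F t z) = (of_real (c * \<beta>) * (g w * cnj (g z))) * (1 / ((1 - g w * of_real t) * (1 - cnj (g z) * of_real t)))" for t
    proof -
      have "complex_of_real (sqrt (c * \<beta>)) * complex_of_real (sqrt (c * \<beta>)) = of_real (c * \<beta>)"
        using c LD(5) by (simp flip: of_real_mult)
      then show ?thesis by (simp add: F_def mult_ac)
    qed
    then show ?thesis unfolding M_def by (simp only: integral_mult_right_zero)
  qed
  have M_lt: "norm (M w z) < 1" if "w \<in> S" "z \<in> S" for w z
  proof -
    have gw: "norm (g w) < r1" "norm (cnj (g z)) < r1" using g(7)[of w] g(7)[of z] that by (auto simp: S_def)
    have "norm (M w z) \<le> c * \<beta> * (r1 * r1) * 4"
      unfolding M_eq norm_mult
      using c LD(5) gw r1(1) by (intro mult_mono levy_integrable(2)[OF LD(4) LD(3)]) (use r1 gw in \<open>auto simp: norm_mult\<close>)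
    then show ?thesis using r1(4) by simp
  qed
  have psd: "psd_kernel S (\<lambda>w z. w * cnj z * (g w - g (cnj z)) / (w - cnj z))"
  proof (rule psd_kernel_cong[OF psd_kernel_geometric[OF mult psd_kernel_rank_one[of S g] M_lt]])
    fix \<zeta> \<eta> assume S: "\<zeta> \<in> S" "\<eta> \<in> S"
    define w z where "w = g \<zeta>" and "z = cnj (g \<eta>)"
    have \<zeta>: "f w = \<zeta>" "norm w < r1" using g(7)[of \<zeta>] S by (auto simp: w_def S_def)
    have \<eta>: "f z = cnj \<eta>" "norm z < r1" "g (cnj \<eta>) = z"
      using g(7)[of \<eta>] g(7)[of "cnj \<eta>"] S by (auto simp: z_def S_def fcnj)
    have ne: "\<zeta> \<noteq> 0" "cnj \<eta> \<noteq> 0" "\<zeta> \<noteq> cnj \<eta>" using S by (auto simp: S_def complex_eq_iff)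
    have hz: "h w \<noteq> 0" "h z \<noteq> 0" using h0 \<zeta> \<eta> by auto
    define J where "J = (LINT t|\<pi>. 1 / ((1 - w * of_real t) * (1 - z * of_real t)))"
    have dR: "R w - R z = of_real \<beta> * (w - z) * J"
      unfolding J_def by (rule levy_difference[OF L]) (use \<zeta> \<eta> r1 in auto)
    have M: "M \<zeta> \<eta> = of_real (c * \<beta>) * (w * z) * J" by (simp add: M_eq w_def z_def J_def)
    have nz: "1 - M \<zeta> \<eta> \<noteq> 0" using M_lt[OF S] by auto
    \<comment> \<open>The divided difference of \<open>R\<close> turns this numerator into
      \<open>(w - z) * (1 - M)\<close>. The factors \<open>h\<close> then cancel and the kernel of
      \<open>g\<close> is \<open>w * z / (1 - M)\<close>.\<close>
    have "\<zeta> - cnj \<eta> = (w * h z - z * h w) / (h w * h z)"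
      unfolding \<zeta>(1)[symmetric] \<eta>(1)[symmetric] f_def using hz by (simp add: field_simps)
    also have "w * h z - z * h w = (w - z) - of_real c * (w * z) * (R w - R z)"
      by (simp add: h_def algebra_simps)
    also have "\<dots> = (w - z) * (1 - M \<zeta> \<eta>)" unfolding dR M by (simp add: algebra_simps)
    finally have diff: "\<zeta> - cnj \<eta> = (w - z) * (1 - M \<zeta> \<eta>) / (h w * h z)" .
    then have "w \<noteq> z" using ne(3) by auto
    have prod: "\<zeta> * cnj \<eta> = w * z / (h w * h z)"
      unfolding \<zeta>(1)[symmetric] \<eta>(1)[symmetric] f_def by simp
    have "\<zeta> * cnj \<eta> * (w - z) / (\<zeta> - cnj \<eta>) = w * z / (1 - M \<zeta> \<eta>)"
    proof -
      have "p / B * d / (d * A / B) = p / A" if "B \<noteq> 0" "d \<noteq> 0" "A \<noteq> 0" for p A B d :: complex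
        using that by (simp add: field_simps)
      then show ?thesis unfolding diff prod using hz nz \<open>w \<noteq> z\<close> by simp
    qed
    then show "g \<zeta> * cnj (g \<eta>) / (1 - M \<zeta> \<eta>) = \<zeta> * cnj \<eta> * (g \<zeta> - g (cnj \<eta>)) / (\<zeta> - cnj \<eta>)"
      unfolding \<eta>(3) by (simp add: w_def z_def)
  qed
  obtain T' \<beta>' \<nu> where \<nu>: "compact_distribution T' \<nu>" "deriv g 0 = of_real \<beta>'"
    "\<And>w. norm w * T' < 1 \<Longrightarrow> norm w < r2 \<Longrightarrow> g w = g 0 + of_real \<beta>' * (LINT t|\<nu>. w / (1 - w * of_real t))"
    by (rule nevanlinna_representation[OF g(4) g(1) _ psd_imp_conditionally_psd[OF psd[unfolded S_def]]]) (use g(7) in blast)+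
  note T' = compact_distributionD(2)[OF \<nu>(1)]
  have "isCont f 0"
    using holf r1 by (auto dest!: holomorphic_on_imp_continuous_on simp: continuous_on_eq_continuous_at)
  then have "\<exists>d>0. \<forall>w. dist w 0 < d \<longrightarrow> dist (f w) (f 0) < 1 / T'"
    unfolding continuous_at_eps_delta using T' by simp
  then obtain s' where s': "s' > 0" "\<And>w. norm w < s' \<Longrightarrow> norm (f w) < 1 / T'"
    by (auto simp: dist_norm f0)
  show thesis
  proof
    show "compact_distribution T' \<nu>" by (rule \<nu>)
    show "min s s' > 0" using g s' by simp
    fix w :: complex assume w: "w \<noteq> 0" "norm w < min s s'"
    have hw: "h w \<noteq> 0" using h0[of w] w g(3) by simp
    have fw: "norm (f w) * T' < 1" using s'(2)[of w] w T' by (simp add: field_simps)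
    have "f w \<noteq> 0" using hw w by (simp add: f_def)
    have inv: "1 / w + of_real c * R w = 1 / f w"
      using hw w by (simp add: f_def h_def field_simps)
    have "w = (LINT t|\<nu>. f w / (1 - f w * of_real t))"
      using \<nu>(3)[OF fw] g(5,6) g(8)[of w] w \<nu>(2) by simp
    also have "\<dots> = (LINT t|\<nu>. 1 / (1 / w + of_real c * R w - of_real t))"
      unfolding inv using \<open>f w \<noteq> 0\<close>
      by (intro Bochner_Integration.integral_cong refl) (simp add: field_simps)
    finally show "norm (w / (1 + of_real c * w * R w)) * T' < 1 \<and> 1 + of_real c * w * R w \<noteq> 0 \<and>
       (LINT t|\<nu>. 1 / (1 / w + of_real c * R w - of_real t)) = w"
      using hw fw by (simp add: h_def f_def)
  qed
qed

text \<open>All heights beyond some bound are allowed, so that finitely many transforms share one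
  cone, as a free convolution demands.\<close>

definition has_free_levy_transform :: "real measure \<Rightarrow> (complex \<Rightarrow> complex) \<Rightarrow> bool" where
  "has_free_levy_transform \<nu> R \<longleftrightarrow>
    (\<exists>b>0. \<forall>b'\<ge>b. is_voiculescu_transform \<nu> 1 b' (\<lambda>z. R (1 / z)))"

text \<open>The integral equation says that \<open>1 / w + R w\<close> inverts the Cauchy transform.
  Near 0 the function \<open>R\<close> is bounded, which yields the growth condition and, high
  enough in the cone, the positive imaginary part.\<close>

lemma has_free_levy_transformI:
  assumes R: "R holomorphic_on ball 0 r" and r: "r > 0" and \<epsilon>: "\<epsilon> > 0"
    and G: "\<And>w. w \<noteq> 0 \<Longrightarrow> norm w < \<epsilon> \<Longrightarrow> (LINT t|\<nu>. 1 / (1 / w + R w - complex_of_real t)) = w"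
  shows "has_free_levy_transform \<nu> R"
proof -
  have "isCont R 0"
    using R r by (auto dest!: holomorphic_on_imp_continuous_on simp: continuous_on_eq_continuous_at)
  then have "((\<lambda>w. norm (R w)) \<longlongrightarrow> norm (R 0)) (nhds 0)"
    unfolding isCont_def tendsto_at_iff_tendsto_nhds by (rule tendsto_norm)
  then have "eventually (\<lambda>w. norm (R w) < norm (R 0) + 1) (nhds 0)"
    by (rule order_tendstoD) simp
  then obtain d where d: "d > 0" "\<And>w. norm w < d \<Longrightarrow> norm (R w) < norm (R 0) + 1"
    unfolding eventually_nhds_metric by (auto simp: dist_norm)
  define C where "C = norm (R 0) + 1"
  have C: "C > 0" unfolding C_def by (rule add_nonneg_pos) auto
  define e where "e = min d (min \<epsilon> r)"
  have e: "e > 0" using d \<epsilon> r by (simp add: e_def)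
  have inv: "norm (1 / z) < e" "z \<noteq> 0" if "norm z > 1 / e" for z :: complex
  proof -
    have "norm z > 0" using that e by (meson divide_pos_pos less_trans zero_less_one)
    then show "norm (1 / z) < e" "z \<noteq> 0" using that e by (auto simp: norm_divide field_simps)
  qed
  \<comment> \<open>The summand \<open>1 / e\<close> sends reciprocals into the disc where the
    equation holds; \<open>C\<close> outweighs the imaginary part of \<open>R\<close>.\<close>
  have "is_voiculescu_transform \<nu> 1 b' (\<lambda>z. R (1 / z))" if b': "b' \<ge> C + 1 / e" for b'
    unfolding is_voiculescu_transform_def
  proof (intro conjI ballI)
    have big: "norm z > 1 / e" "Im z > C" if "z \<in> truncated_cone 1 b'" for z
    proof -
      have "Im z > C + 1 / e" using that b' by (auto simp: truncated_cone_def)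
      moreover have "1 / e > 0" using e by simp
      ultimately show "norm z > 1 / e" "Im z > C" using abs_Im_le_cmod[of z] C by linarith+
    qed
    have "(R \<circ> (\<lambda>z. 1 / z)) holomorphic_on truncated_cone 1 b'"
    proof (rule holomorphic_on_compose_gen[OF _ R])
      show "(\<lambda>z. 1 / z) holomorphic_on truncated_cone 1 b'"
        by (intro holomorphic_intros) (use big inv in blast)
      show "(\<lambda>z. 1 / z) ` truncated_cone 1 b' \<subseteq> ball 0 r"
        using inv big by (force simp: e_def)
    qed
    then show "(\<lambda>z. R (1 / z)) holomorphic_on truncated_cone 1 b'" by (simp add: o_def)
    fix z assume z: "z \<in> truncated_cone 1 b'"
    note inv' = inv[OF big(1)[OF z]]
    have "norm (R (1 / z)) < C" using d(2) inv' by (simp add: e_def C_def)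
    then have "\<bar>Im (R (1 / z))\<bar> < C" using abs_Im_le_cmod le_less_trans by blast
    then show "Im (z + R (1 / z)) > 0" using big(2)[OF z] by simp
    have "cauchy_transform \<nu> (z + R (1 / z)) = 1 / z"
      unfolding cauchy_transform_def using G[of "1 / z"] inv' by (simp add: e_def)
    then show "1 / cauchy_transform \<nu> (z + R (1 / z)) = z" by simp
  next
    have "((\<lambda>z. R (1 / z) / z) \<longlongrightarrow> 0) at_infinity"
    proof (rule Lim_null_comparison)
      show "eventually (\<lambda>z. norm (R (1 / z) / z) \<le> C * norm (inverse z)) at_infinity"
        unfolding eventually_at_infinity
      proof (intro exI[of _ "1 / e + 1"] allI impI)
        fix z :: complex assume "1 / e + 1 \<le> norm z"
        then have "norm (1 / z) < e" by (intro inv) simp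
        then have "norm (R (1 / z)) \<le> C" using d(2)[of "1 / z"] by (simp add: e_def C_def)
        then show "norm (R (1 / z) / z) \<le> C * norm (inverse z)"
          unfolding divide_inverse norm_mult by (rule mult_right_mono) simp
      qed
      have "((\<lambda>z. C * norm (inverse z :: complex)) \<longlongrightarrow> C * norm (0::complex)) at_infinity"
        by (intro tendsto_intros tendsto_inverse_0)
      then show "((\<lambda>z. C * norm (inverse z :: complex)) \<longlongrightarrow> 0) at_infinity" by simp
    qed
    then show "((\<lambda>z. R (1 / z) / z) \<longlongrightarrow> 0) (inf at_infinity (principal (truncated_cone 1 b')))"
      by (rule tendsto_mono[rotated]) simp
  qed
  moreover have "C + 1 / e > 0" using C e by (simp add: add_pos_pos)
  ultimately show ?thesis unfolding has_free_levy_transform_def by blast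
qed

lemma is_free_convolution_of_levy_transforms:
  assumes "real_distribution \<mu>" "real_distribution \<nu>" "real_distribution \<rho>"
    and "has_free_levy_transform \<mu> R" "has_free_levy_transform \<nu> R'"
    and "has_free_levy_transform \<rho> (\<lambda>w. R w + R' w)"
  shows "is_free_convolution \<mu> \<nu> \<rho>"
proof -
  obtain b1 b2 b3 where b: "b1 > 0"
    "\<And>b. b \<ge> b1 \<Longrightarrow> is_voiculescu_transform \<mu> 1 b (\<lambda>z. R (1 / z))"
    "\<And>b. b \<ge> b2 \<Longrightarrow> is_voiculescu_transform \<nu> 1 b (\<lambda>z. R' (1 / z))"
    "\<And>b. b \<ge> b3 \<Longrightarrow> is_voiculescu_transform \<rho> 1 b (\<lambda>z. R (1 / z) + R' (1 / z))"
    using assms(4-6) unfolding has_free_levy_transform_def by blast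
  define b where "b = max b1 (max b2 b3)"
  have "is_voiculescu_transform \<mu> 1 b (\<lambda>z. R (1 / z))" "is_voiculescu_transform \<nu> 1 b (\<lambda>z. R' (1 / z))"
    "is_voiculescu_transform \<rho> 1 b (\<lambda>z. R (1 / z) + R' (1 / z))" "b > 0"
    using b by (simp_all add: b_def)
  then show ?thesis
    unfolding is_free_convolution_def using assms(1-3) zero_less_one by blast
qed

text \<open>Every positive multiple \<open>c * R\<close> is the R-transform of a law
  \<open>N c\<close>. Transforms add up along the laws \<open>N (k / n)\<close>, so
  \<open>N (1 / n)\<close> is an n-th convolution root of \<open>N 1\<close>.\<close>

lemma levy_representation_imp_freely_infinitely_divisible:
  assumes L: "levy_representation R r T \<beta> \<pi>"
  obtains \<nu> T' \<epsilon> where "compact_distribution T' \<nu>" "freely_infinitely_divisible \<nu>" "\<epsilon> > 0"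
    "\<And>w. w \<noteq> 0 \<Longrightarrow> norm w < \<epsilon> \<Longrightarrow> norm (w / (1 + w * R w)) * T' < 1 \<and> 1 + w * R w \<noteq> 0 \<and>
       (LINT t|\<nu>. 1 / (1 / w + R w - complex_of_real t)) = w"
proof -
  define P where "P c \<nu> \<longleftrightarrow> (\<exists>T' \<epsilon>. compact_distribution T' \<nu> \<and> \<epsilon> > 0 \<and>
    (\<forall>w. w \<noteq> 0 \<longrightarrow> norm w < \<epsilon> \<longrightarrow> norm (w / (1 + of_real c * w * R w)) * T' < 1 \<and> 1 + of_real c * w * R w \<noteq> 0 \<and>
       (LINT t|\<nu>. 1 / (1 / w + of_real c * R w - complex_of_real t)) = w))" for c \<nu>
  have "\<exists>\<nu>. P c \<nu>" if "c > 0" for c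
    using exists_distribution_of_levy_representation[OF L that] unfolding P_def by metis
  then obtain N where N: "\<And>c. c > 0 \<Longrightarrow> P c (N c)" by metis
  have real: "real_distribution (N c)" if "c > 0" for c
    using N[OF that] compact_distributionD(1) unfolding P_def by blast
  have tr: "has_free_levy_transform (N c) (\<lambda>w. of_real c * R w)" if c: "c > 0" for c
  proof -
    obtain \<epsilon> where "\<epsilon> > 0" "\<And>w. w \<noteq> 0 \<Longrightarrow> norm w < \<epsilon> \<Longrightarrow>
       (LINT t|N c. 1 / (1 / w + of_real c * R w - complex_of_real t)) = w"
      using N[OF c] unfolding P_def by blast
    then show ?thesis
      by (intro has_free_levy_transformI[of _ r \<epsilon>] holomorphic_intros levy_representationD(1,2)[OF L])
  qed
  have power: "is_free_convolution_power (N (1 / real n)) (Suc k) (N (real (Suc k) / real n))" if n: "n \<ge> 1" for n k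
  proof (induction k)
    case 0
    show ?case using is_free_convolution_power.one[OF real[of "1 / real n"]] n by simp
  next
    case (Suc k)
    have "is_free_convolution (N (real (Suc k) / real n)) (N (1 / real n)) (N (real (Suc (Suc k)) / real n))"
    proof (rule is_free_convolution_of_levy_transforms)
      show "has_free_levy_transform (N (real (Suc k) / real n)) (\<lambda>w. of_real (real (Suc k) / real n) * R w)"
        by (rule tr) (use n in simp)
      show "has_free_levy_transform (N (1 / real n)) (\<lambda>w. of_real (1 / real n) * R w)"
        by (rule tr) (use n in simp)
      have "(\<lambda>w. of_real (real (Suc k) / real n) * R w + of_real (1 / real n) * R w) =
        (\<lambda>w. of_real (real (Suc (Suc k)) / real n) * R w)"
        by (simp add: fun_eq_iff add_divide_distrib algebra_simps)
      then show "has_free_levy_transform (N (real (Suc (Suc k)) / real n))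
         (\<lambda>w. of_real (real (Suc k) / real n) * R w + of_real (1 / real n) * R w)"
        using tr[of "real (Suc (Suc k)) / real n"] n by simp
    qed (rule real, use n in simp)+
    then show ?case by (rule is_free_convolution_power.Suc[OF Suc])
  qed
  have "freely_infinitely_divisible (N 1)"
    unfolding freely_infinitely_divisible_def
  proof (intro conjI allI impI real)
    fix n :: nat assume n: "n \<ge> 1"
    then obtain k where k: "n = Suc k" by (cases n) auto
    show "\<exists>\<mu>. real_distribution \<mu> \<and> is_free_convolution_power \<mu> n (N 1)"
      using power[OF n, of k] real[of "1 / real n"] n by (intro exI[of _ "N (1 / real n)"]) (simp add: k)
  qed simp
  moreover obtain T' \<epsilon> where "compact_distribution T' (N 1)" "\<epsilon> > 0"
    "\<And>w. w \<noteq> 0 \<Longrightarrow> norm w < \<epsilon> \<Longrightarrow> norm (w / (1 + w * R w)) * T' < 1 \<and> 1 + w * R w \<noteq> 0 \<and>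
       (LINT t|N 1. 1 / (1 / w + R w - complex_of_real t)) = w"
    using N[of 1] unfolding P_def by auto
  ultimately show thesis using that by blast
qed

section \<open>From free infinite divisibility to a Levy representation\<close>

text \<open>The defining equation of a Voiculescu transform, restricted to the imaginary axis near infinity.
  It already determines the transform there.\<close>

definition ray_voiculescu :: "real measure \<Rightarrow> (real \<Rightarrow> complex) \<Rightarrow> bool" where
  "ray_voiculescu \<mu> f \<longleftrightarrow>
     (\<forall>\<^sub>F y in at_top. Im (\<i> * of_real y + f y) > 0 \<and>
        cauchy_transform \<mu> (\<i> * of_real y + f y) = 1 / (\<i> * of_real y)) \<and>
     ((\<lambda>y. f y / of_real y) \<longlongrightarrow> 0) at_top"

lemma is_voiculescu_transform_imp_ray:
  assumes "is_voiculescu_transform \<mu> \<alpha> \<beta> \<phi>" "\<alpha> > 0"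
  shows "ray_voiculescu \<mu> (\<lambda>y. \<phi> (\<i> * of_real y))"
proof -
  have cone: "eventually (\<lambda>y. \<i> * of_real y \<in> truncated_cone \<alpha> \<beta>) at_top"
    using eventually_gt_at_top[of "max 0 \<beta>"]
    by eventually_elim (use assms(2) in \<open>auto simp: truncated_cone_def\<close>)
  have "filterlim (\<lambda>y. \<i> * complex_of_real y) at_infinity at_top"
    by (rule filterlim_norm_at_top_imp_at_infinity) (auto simp: norm_mult intro!: filterlim_at_top_mono[OF filterlim_ident] eventually_mono[OF eventually_ge_at_top[of 0]])
  then have "filterlim (\<lambda>y. \<i> * complex_of_real y) (inf at_infinity (principal (truncated_cone \<alpha> \<beta>))) at_top"
    using cone by (auto simp: filterlim_inf filterlim_principal)
  then have lim: "((\<lambda>y. \<phi> (\<i> * of_real y) / (\<i> * of_real y)) \<longlongrightarrow> 0) at_top"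
    using assms(1) unfolding is_voiculescu_transform_def by (auto intro: filterlim_compose)
  have "((\<lambda>y. \<i> * (\<phi> (\<i> * of_real y) / (\<i> * of_real y))) \<longlongrightarrow> \<i> * 0) at_top"
    by (intro tendsto_intros lim)
  then have "((\<lambda>y. \<phi> (\<i> * of_real y) / of_real y) \<longlongrightarrow> 0) at_top" by simp
  moreover have "\<forall>\<^sub>F y in at_top. Im (\<i> * of_real y + \<phi> (\<i> * of_real y)) > 0 \<and>
        cauchy_transform \<mu> (\<i> * of_real y + \<phi> (\<i> * of_real y)) = 1 / (\<i> * of_real y)"
    using cone
  proof eventually_elim
    case (elim y)
    then have "Im (\<i> * of_real y + \<phi> (\<i> * of_real y)) > 0"
      and eq: "1 / cauchy_transform \<mu> (\<i> * of_real y + \<phi> (\<i> * of_real y)) = \<i> * of_real y"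
      using assms(1) unfolding is_voiculescu_transform_def by auto
    then show ?case by (metis divide_divide_eq_right div_by_1 mult_1)
  qed
  ultimately show ?thesis unfolding ray_voiculescu_def by blast
qed

lemma ray_voiculescu_cong:
  assumes "ray_voiculescu \<mu> f" "eventually (\<lambda>y. f y = g y) at_top"
  shows "ray_voiculescu \<mu> g"
proof -
  have "((\<lambda>y. g y / complex_of_real y) \<longlongrightarrow> 0) at_top"
    by (rule Lim_transform_eventually[OF conjunct2[OF assms(1)[unfolded ray_voiculescu_def]]])
      (use assms(2) in eventually_elim, simp)
  moreover have "\<forall>\<^sub>F y in at_top. Im (\<i> * of_real y + g y) > 0 \<and>
        cauchy_transform \<mu> (\<i> * of_real y + g y) = 1 / (\<i> * of_real y)"
    using assms(2) conjunct1[OF assms(1)[unfolded ray_voiculescu_def]] by eventually_elim auto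
  ultimately show ?thesis unfolding ray_voiculescu_def by blast
qed

lemma norm_ge_Im_cauchy: "norm (z - complex_of_real t) \<ge> \<bar>Im z\<bar>"
  using abs_Im_le_cmod[of "z - complex_of_real t"] by simp

lemma cauchy_kernel_integrable:
  assumes "real_distribution \<mu>" "Im z \<noteq> 0"
  shows "integrable \<mu> (\<lambda>t. 1 / (z - complex_of_real t))"
proof -
  interpret real_distribution \<mu> by fact
  show ?thesis
  proof (rule integrable_const_bound)
    show "AE t in \<mu>. norm (1 / (z - complex_of_real t)) \<le> 1 / \<bar>Im z\<bar>"
    proof (rule AE_I2)
      fix t
      have "0 < \<bar>Im z\<bar>" using assms(2) by simp
      then show "norm (1 / (z - complex_of_real t)) \<le> 1 / \<bar>Im z\<bar>"
        using norm_ge_Im_cauchy[of z t] by (simp add: norm_divide frac_le)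
    qed
  qed auto
qed

lemma cauchy_transform_difference:
  assumes "real_distribution \<mu>" "Im a \<noteq> 0" "Im b \<noteq> 0"
  shows "cauchy_transform \<mu> a - cauchy_transform \<mu> b =
    (b - a) * (LINT t|\<mu>. 1 / ((a - complex_of_real t) * (b - of_real t)))"
proof -
  have "cauchy_transform \<mu> a - cauchy_transform \<mu> b = (LINT t|\<mu>. 1 / (a - complex_of_real t) - 1 / (b - complex_of_real t))"
    unfolding cauchy_transform_def
    by (rule Bochner_Integration.integral_diff[symmetric]) (intro cauchy_kernel_integrable assms)+
  also have "\<dots> = (LINT t|\<mu>. (b - a) * (1 / ((a - complex_of_real t) * (b - of_real t))))"
  proof (rule Bochner_Integration.integral_cong[OF refl])
    fix t
    have "a - complex_of_real t \<noteq> 0" "b - complex_of_real t \<noteq> 0" using assms by (auto simp: complex_eq_iff)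
    then show "1 / (a - complex_of_real t) - 1 / (b - complex_of_real t) = (b - a) * (1 / ((a - complex_of_real t) * (b - of_real t)))"
      by (simp add: field_simps)
  qed
  finally show ?thesis by (simp only: integral_mult_right_zero)
qed

lemma ray_voiculescu_bounds:
  assumes "ray_voiculescu \<mu> f"
  shows "eventually (\<lambda>y. y > 0 \<and> norm (f y) \<le> y / 2 \<and> Im (\<i> * of_real y + f y) \<ge> y / 2 \<and>
    norm (\<i> * of_real y + f y) \<le> 2 * y \<and> cauchy_transform \<mu> (\<i> * of_real y + f y) = 1 / (\<i> * of_real y)) at_top"
proof -
  have "((\<lambda>y. norm (f y / of_real y)) \<longlongrightarrow> 0) at_top"
    using assms tendsto_norm_zero unfolding ray_voiculescu_def by blast
  then have "eventually (\<lambda>y. norm (f y / of_real y) < 1 / 2) at_top"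
    by (rule order_tendstoD) simp
  then show ?thesis
    using eventually_gt_at_top[of "0::real"] conjunct1[OF assms[unfolded ray_voiculescu_def]]
  proof eventually_elim
    case (elim y)
    have b: "norm (f y) \<le> y / 2" using elim by (simp add: norm_divide field_simps)
    have "norm (\<i> * of_real y + f y) \<le> y + y / 2"
      by (rule norm_triangle_le) (use b elim in \<open>simp add: norm_mult\<close>)
    then have "norm (\<i> * of_real y + f y) \<le> 2 * y" using elim by simp
    moreover have "Im (\<i> * of_real y + f y) \<ge> y / 2"
      using abs_Im_le_cmod[of "f y"] b by simp
    ultimately show ?case using elim b by simp
  qed
qed

text \<open>Along both curves \<open>z / (z - t)\<close> tends to 1 and is bounded by 4, because
  \<open>norm z \<le> 2 * y\<close> while the imaginary part is at least
  \<open>y / 2\<close>.\<close>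

lemma cauchy_product_tendsto_one:
  assumes \<mu>: "real_distribution \<mu>"
    and f: "ray_voiculescu \<mu> f" and g: "ray_voiculescu \<mu> g"
  defines "a \<equiv> \<lambda>y. \<i> * complex_of_real y + f y" and "b \<equiv> \<lambda>y. \<i> * complex_of_real y + g y"
  shows "((\<lambda>y. LINT t|\<mu>. a y / (a y - complex_of_real t) * (b y / (b y - of_real t))) \<longlongrightarrow> 1) at_top"
proof -
  interpret real_distribution \<mu> by fact
  have ratio: "norm (z / (z - complex_of_real t)) \<le> 4" if "Im z \<ge> y / 2" "norm z \<le> 2 * y" "y > 0" for z y t
  proof -
    have "norm z / norm (z - complex_of_real t) \<le> (2 * y) / (y / 2)"
      using norm_ge_Im_cauchy[of z t] that by (intro frac_le) auto
    then show ?thesis using that by (simp add: norm_divide)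
  qed
  have inf: "filterlim (\<lambda>y. \<i> * complex_of_real y + h y) at_infinity at_top" if "ray_voiculescu \<mu> h" for h
  proof (rule filterlim_norm_at_top_imp_at_infinity, rule filterlim_at_top_mono)
    show "filterlim (\<lambda>y::real. (1 / 2) * y) at_top at_top"
      by (intro filterlim_tendsto_pos_mult_at_top[OF tendsto_const _ filterlim_ident]) simp
    show "eventually (\<lambda>y. (1 / 2) * y \<le> norm (\<i> * complex_of_real y + h y)) at_top"
      using ray_voiculescu_bounds[OF that]
    proof eventually_elim
      case (elim y)
      then show ?case using abs_Im_le_cmod[of "\<i> * complex_of_real y + h y"] by linarith
    qed
  qed
  have pt: "((\<lambda>z. z / (z - complex_of_real t)) \<longlongrightarrow> 1) at_infinity" for t
  proof -
    have "((\<lambda>z. 1 / (1 - complex_of_real t * inverse z)) \<longlongrightarrow> 1 / (1 - complex_of_real t * 0)) at_infinity"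
      by (intro tendsto_intros tendsto_inverse_0) auto
    moreover have "eventually (\<lambda>z. 1 / (1 - complex_of_real t * inverse z) = z / (z - complex_of_real t)) at_infinity"
      using eventually_not_equal_at_infinity[of 0] by eventually_elim (simp add: field_simps)
    ultimately show ?thesis by (simp add: tendsto_cong)
  qed
  have "((\<lambda>y. LINT t|\<mu>. a y / (a y - complex_of_real t) * (b y / (b y - of_real t))) \<longlongrightarrow> (LINT t|\<mu>. 1)) at_top"
  proof (rule integral_dominated_convergence_at_top[where w = "\<lambda>_. 16"])
    show "\<forall>\<^sub>F y in at_top. AE t in \<mu>. norm (a y / (a y - complex_of_real t) * (b y / (b y - of_real t))) \<le> 16"
      using ray_voiculescu_bounds[OF f] ray_voiculescu_bounds[OF g]
    proof eventually_elim
      case (elim y)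
      have "norm (a y / (a y - complex_of_real t) * (b y / (b y - of_real t))) \<le> 4 * 4" for t
        unfolding norm_mult a_def b_def using elim by (intro mult_mono ratio[of y]) auto
      then show ?case by simp
    qed
    show "AE t in \<mu>. ((\<lambda>y. a y / (a y - complex_of_real t) * (b y / (b y - complex_of_real t))) \<longlongrightarrow> 1) at_top"
      unfolding a_def b_def
    proof (rule AE_I2)
      fix t
      show "((\<lambda>y. (\<i> * complex_of_real y + f y) / (\<i> * complex_of_real y + f y - complex_of_real t) *
        ((\<i> * complex_of_real y + g y) / (\<i> * complex_of_real y + g y - complex_of_real t))) \<longlongrightarrow> 1) at_top"
        using tendsto_mult[OF filterlim_compose[OF pt inf[OF f]] filterlim_compose[OF pt inf[OF g]], of t t] by simp
    qed
  qed auto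
  then show ?thesis using prob_space by simp
qed

text \<open>The reciprocal Cauchy transform need not be injective. But two solutions asymptotic to
  \<open>\<i> * y\<close> have equal Cauchy transforms, and the divided difference between them is
  eventually nonzero by the preceding limit.\<close>

lemma ray_voiculescu_unique:
  assumes \<mu>: "real_distribution \<mu>"
    and f: "ray_voiculescu \<mu> f" and g: "ray_voiculescu \<mu> g"
  shows "eventually (\<lambda>y. f y = g y) at_top"
proof -
  define a where "a y = \<i> * complex_of_real y + f y" for y
  define b where "b y = \<i> * complex_of_real y + g y" for y
  have "eventually (\<lambda>y. (LINT t|\<mu>. a y / (a y - complex_of_real t) * (b y / (b y - of_real t))) \<noteq> 0) at_top"
    unfolding a_def b_def
    by (rule tendsto_imp_eventually_ne[OF cauchy_product_tendsto_one[OF \<mu> f g]]) simp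
  then show ?thesis
    using ray_voiculescu_bounds[OF f] ray_voiculescu_bounds[OF g]
  proof eventually_elim
    case (elim y)
    define I where "I = (LINT t|\<mu>. 1 / ((a y - complex_of_real t) * (b y - of_real t)))"
    have "(LINT t|\<mu>. a y / (a y - complex_of_real t) * (b y / (b y - of_real t))) = a y * b y * I"
      unfolding I_def by (subst integral_mult_right_zero[symmetric]) simp
    then have "I \<noteq> 0" using elim by auto
    have "(b y - a y) * I = cauchy_transform \<mu> (a y) - cauchy_transform \<mu> (b y)"
      unfolding I_def by (rule cauchy_transform_difference[OF \<mu>, symmetric]) (use elim in \<open>auto simp: a_def b_def\<close>)
    also have "\<dots> = 0" using elim by (simp add: a_def b_def)
    finally show ?case using \<open>I \<noteq> 0\<close> by (simp add: a_def b_def)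
  qed
qed

lemma is_free_convolution_power_one:
  assumes "is_free_convolution_power \<mu> n \<rho>"
  shows "n \<ge> 1 \<and> (n = 1 \<longrightarrow> \<rho> = \<mu>)"
  using assms by induction auto

text \<open>A convolution only asserts that suitable transforms exist, so each step brings its own;
  uniqueness on the ray identifies them. A first power involves no convolution and thus provides no
  transform, whence \<open>n \<ge> 2\<close>.\<close>

lemma free_convolution_power_ray:
  assumes "is_free_convolution_power \<mu> n \<sigma>" "n \<ge> 2"
  shows "real_distribution \<mu> \<and> (\<exists>f. ray_voiculescu \<mu> f \<and> ray_voiculescu \<sigma> (\<lambda>y. of_nat n * f y))"
  using assms
proof (induction rule: is_free_convolution_power.induct)
  case one
  then show ?case by simp
next
  case (Suc n \<rho> \<sigma>)
  obtain \<alpha> \<beta> \<phi> \<psi> where *: "real_distribution \<rho>" "real_distribution \<mu>" "\<alpha> > 0" "is_voiculescu_transform \<rho> \<alpha> \<beta> \<phi>"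
    "is_voiculescu_transform \<mu> \<alpha> \<beta> \<psi>" "is_voiculescu_transform \<sigma> \<alpha> \<beta> (\<lambda>z. \<phi> z + \<psi> z)"
    using Suc.hyps(2) unfolding is_free_convolution_def by blast
  define p where "p y = \<phi> (\<i> * complex_of_real y)" for y
  define q where "q y = \<psi> (\<i> * complex_of_real y)" for y
  have ray: "ray_voiculescu \<rho> p" "ray_voiculescu \<mu> q" "ray_voiculescu \<sigma> (\<lambda>y. p y + q y)"
    using *(4-6)[THEN is_voiculescu_transform_imp_ray[OF _ *(3)]] by (simp_all add: p_def[abs_def] q_def[abs_def])
  have "eventually (\<lambda>y. p y = of_nat n * q y) at_top"
  proof (cases "n \<ge> 2")
    case True
    then obtain f where f: "ray_voiculescu \<mu> f" "ray_voiculescu \<rho> (\<lambda>y. of_nat n * f y)"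
      using Suc.IH by blast
    show ?thesis
      using ray_voiculescu_unique[OF *(1) ray(1) f(2)] ray_voiculescu_unique[OF *(2) ray(2) f(1)]
      by eventually_elim simp
  next
    case False
    then have n: "n = 1" using Suc.prems by simp
    then have "\<rho> = \<mu>" using is_free_convolution_power_one[OF Suc.hyps(1)] by simp
    then show ?thesis using ray_voiculescu_unique[OF *(2) _ ray(2)] ray(1) n by simp
  qed
  then have "eventually (\<lambda>y. p y + q y = of_nat (Suc n) * q y) at_top"
    by eventually_elim (simp add: algebra_simps)
  from ray_voiculescu_cong[OF ray(3) this] show ?case using ray(2) *(2) by blast
qed

section \<open>Resolvent kernels of the convolution roots\<close>

lemma cauchy_transform_holomorphic:
  assumes \<mu>: "real_distribution \<mu>"
  shows "cauchy_transform \<mu> holomorphic_on {z. Im z > 0}"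
proof (rule holomorphic_onI)
  interpret real_distribution \<mu> by fact
  fix a assume "a \<in> {z. Im z > 0}"
  then have a: "Im a > 0" by simp
  define D where "D z = (LINT t|\<mu>. 1 / ((z - complex_of_real t) * (a - of_real t)))" for z
  have near: "eventually (\<lambda>z. Im z > Im a / 2 \<and> z \<noteq> a) (at a)"
  proof -
    have "(Im \<longlongrightarrow> Im a) (at a)" by (intro tendsto_intros)
    then have "eventually (\<lambda>z. Im z > Im a / 2) (at a)" by (rule order_tendstoD) (use a in simp)
    then show ?thesis using eventually_neq_at_within[of a] by eventually_elim simp
  qed
  have "((\<lambda>z. (cauchy_transform \<mu> z - cauchy_transform \<mu> a) / (z - a) - (- D a)) \<longlongrightarrow> 0) (at a)"
  proof (rule Lim_null_comparison)
    show "eventually (\<lambda>z. norm ((cauchy_transform \<mu> z - cauchy_transform \<mu> a) / (z - a) - (- D a))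
        \<le> norm (z - a) / (Im a / 2 * (Im a * Im a))) (at a)"
      using near
    proof eventually_elim
      case (elim z)
      have Dint: "integrable \<mu> (\<lambda>t. 1 / ((b - complex_of_real t) * (a - of_real t)))" if "Im b > 0" for b
      proof (rule integrable_const_bound)
        show "AE t in \<mu>. norm (1 / ((b - complex_of_real t) * (a - of_real t))) \<le> 1 / (Im b * Im a)"
          unfolding norm_divide norm_mult norm_one
          using norm_ge_Im_cauchy[of b] norm_ge_Im_cauchy[of a] a that
          by (intro AE_I2 divide_left_mono mult_mono mult_pos_pos) (auto intro: less_le_trans)
      qed auto
      have "(cauchy_transform \<mu> z - cauchy_transform \<mu> a) / (z - a) = - D z"
        using cauchy_transform_difference[OF \<mu>, of z a] a elim by (simp add: D_def field_simps)
      then have "(cauchy_transform \<mu> z - cauchy_transform \<mu> a) / (z - a) - (- D a) = D a - D z" by simp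
      also have "D a - D z = (LINT t|\<mu>. 1 / ((a - complex_of_real t) * (a - of_real t)) - 1 / ((z - complex_of_real t) * (a - of_real t)))"
        unfolding D_def by (rule Bochner_Integration.integral_diff[symmetric]) (use a elim in \<open>auto intro: Dint\<close>)
      also have "norm \<dots> \<le> (LINT t|\<mu>. norm (z - a) / (Im a / 2 * (Im a * Im a)))"
      proof (rule order_trans[OF integral_norm_bound], rule integral_mono)
        fix t
        have ne: "a - complex_of_real t \<noteq> 0" "z - complex_of_real t \<noteq> 0" using a elim by (auto simp: complex_eq_iff)
        have eq: "1 / ((a - complex_of_real t) * (a - of_real t)) - 1 / ((z - complex_of_real t) * (a - of_real t)) =
          (z - a) / ((z - complex_of_real t) * ((a - of_real t) * (a - of_real t)))"
        proof -
          have "1 / (p * p) - 1 / (q * p) = (q - p) / (q * (p * p))" if "p \<noteq> 0" "q \<noteq> 0" for p q :: complex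
            using that by (simp add: field_simps)
          from this[OF ne] show ?thesis by simp
        qed
        show "norm (1 / ((a - complex_of_real t) * (a - of_real t)) - 1 / ((z - complex_of_real t) * (a - of_real t)))
          \<le> norm (z - a) / (Im a / 2 * (Im a * Im a))"
          unfolding eq norm_divide norm_mult
          using norm_ge_Im_cauchy[of z t] norm_ge_Im_cauchy[of a t] a elim
          by (intro divide_left_mono mult_mono mult_pos_pos) auto
      qed (use a elim in \<open>auto intro!: Bochner_Integration.integrable_diff Dint\<close>)
      finally show ?case using prob_space by simp
    qed
    show "((\<lambda>z. norm (z - a) / (Im a / 2 * (Im a * Im a))) \<longlongrightarrow> 0) (at a)"
      by (rule tendsto_eq_intros refl | use a in simp)+
  qed
  then have "((\<lambda>z. (cauchy_transform \<mu> z - cauchy_transform \<mu> a) / (z - a)) \<longlongrightarrow> - D a) (at a)"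
    by (rule LIM_zero_cancel)
  then have "(cauchy_transform \<mu> has_field_derivative - D a) (at a)"
    by (simp add: has_field_derivative_iff)
  then show "cauchy_transform \<mu> field_differentiable at a within {z. Im z > 0}"
    using field_differentiable_at_within field_differentiable_def by blast
qed

text \<open>\<open>n (1 / (1 - L / n) - 1)\<close> tends to \<open>L\<close>, and the constant \<open>n\<close> is invisible to conditional positivity.\<close>

lemma conditionally_psd_of_resolvents:
  assumes "\<And>n::nat. n \<ge> 2 \<Longrightarrow> psd_kernel S (\<lambda>w z. 1 / (1 - L w z / of_nat n))"
  shows "conditionally_psd_kernel S L"
  unfolding conditionally_psd_kernel_def
proof (intro allI impI)
  fix n :: nat and w and c :: "nat \<Rightarrow> complex"
  assume w: "\<forall>i<n. w i \<in> S" and c: "(\<Sum>i<n. c i) = 0"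
  define Q where "Q m = (\<Sum>i<n. \<Sum>j<n. c i * cnj (c j) * (L (w i) (w j) / (1 - L (w i) (w j) / of_nat m)))" for m :: nat
  have ev: "eventually (\<lambda>m. \<forall>i<n. \<forall>j<n. 1 - L (w i) (w j) / of_nat m \<noteq> 0) sequentially"
  proof -
    have "eventually (\<lambda>m. 1 - l / of_nat m \<noteq> 0) sequentially" for l :: complex
    proof -
      have "(\<lambda>m. 1 - l / of_nat m) \<longlonglongrightarrow> 1 - 0" by (intro tendsto_intros lim_const_over_n)
      then show ?thesis by (rule tendsto_imp_eventually_ne) simp
    qed
    then have "eventually (\<lambda>m. \<forall>i\<in>{..<n}. \<forall>j\<in>{..<n}. 1 - L (w i) (w j) / of_nat m \<noteq> 0) sequentially"
      by (intro eventually_ball_finite ballI) auto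
    then show ?thesis by eventually_elim blast
  qed
  have "eventually (\<lambda>m. 0 \<le> Re (Q m)) sequentially"
    using ev eventually_ge_at_top[of 2]
  proof eventually_elim
    case (elim m)
    \<comment> \<open>The resolvent is 1 plus \<open>1 / m\<close> times the kernel in
      \<open>Q\<close>, and the constant 1 contributes the squared modulus of the vanishing sum of
      \<open>c\<close>.\<close>
    have "(\<Sum>i<n. \<Sum>j<n. c i * cnj (c j) * (1 / (1 - L (w i) (w j) / of_nat m))) =
      (\<Sum>i<n. \<Sum>j<n. c i * cnj (c j) * 1 + (1 / of_nat m) * (c i * cnj (c j) * (L (w i) (w j) / (1 - L (w i) (w j) / of_nat m))))"
      using elim by (intro sum.cong refl) (simp add: field_simps)
    also have "\<dots> = (\<Sum>i<n. c i) * cnj (\<Sum>i<n. c i) + (1 / of_nat m) * Q m"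
    proof -
      have "(\<Sum>i<n. c i) * cnj (\<Sum>i<n. c i) = (\<Sum>i<n. \<Sum>j<n. c i * cnj (c j) * 1)"
        by (simp only: cnj_sum sum_product mult_1_right)
      then show ?thesis unfolding Q_def by (simp only: sum.distrib sum_distrib_left)
    qed
    also have "\<dots> = Q m / of_nat m" by (simp add: c)
    finally have "0 \<le> Re (Q m / of_nat m)"
      using psd_kernelD[OF assms[OF elim(2)], of n w c] w by simp
    then show ?case using elim(2) by (simp add: zero_le_divide_iff)
  qed
  moreover have "(\<lambda>m. Re (Q m)) \<longlonglongrightarrow> Re (\<Sum>i<n. \<Sum>j<n. c i * cnj (c j) * (L (w i) (w j) / (1 - 0)))"
    unfolding Q_def by (intro tendsto_intros lim_const_over_n) simp
  ultimately show "0 \<le> Re (\<Sum>i<n. \<Sum>j<n. c i * cnj (c j) * L (w i) (w j))"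
    by (intro tendsto_lowerbound[of "\<lambda>m. Re (Q m)" _ sequentially]) auto
qed

text \<open>Away from 0, \<open>g w\<close> is the Cauchy transform at \<open>1 / w\<close>; near 0
  it is \<open>w\<close> times the moment generating function.\<close>

lemma compact_cauchy_properties:
  assumes \<mu>: "compact_distribution B \<mu>"
  defines "g \<equiv> \<lambda>w. LINT t|\<mu>. w / (1 - w * complex_of_real t)"
  shows "g holomorphic_on ball 0 (1 / B)" "g 0 = 0" "deriv g 0 = 1" "g (cnj w) = cnj (g w)"
proof -
  note B = compact_distributionD(2)[OF \<mu>]
  interpret real_distribution \<mu> using \<mu> by (rule compact_distributionD)
  define h where "h w = (LINT t|\<mu>. 1 / (1 - w * complex_of_real t))" for w
  have gh: "g = (\<lambda>w. w * h w)"
    unfolding g_def h_def by (simp flip: integral_mult_right_zero)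
  have h: "h holomorphic_on ball 0 (1 / B)"
  proof (rule power_series_holomorphic)
    fix w :: complex assume "w \<in> ball 0 (1 / B)"
    then show "(\<lambda>n. complex_of_real (LINT t|\<mu>. t ^ n) * (w - 0) ^ n) sums h w"
      unfolding h_def using compact_distribution_moment_series[OF \<mu>, of w] B by (simp add: field_simps)
  qed
  then show "g holomorphic_on ball 0 (1 / B)" unfolding gh by (intro holomorphic_intros)
  show "g 0 = 0" by (simp add: gh)
  have "h 0 = 1" using prob_space by (simp add: h_def)
  moreover have "(h has_field_derivative deriv h 0) (at 0)"
    using h B by (intro holomorphic_derivI[of _ "ball 0 (1 / B)"]) auto
  ultimately have "(g has_field_derivative 1) (at 0)"
    unfolding gh by (auto intro!: derivative_eq_intros)
  then show "deriv g 0 = 1" by (rule DERIV_imp_deriv)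
  have "g (cnj w) = (LINT t|\<mu>. cnj (w / (1 - w * complex_of_real t)))"
    unfolding g_def by simp
  then show "g (cnj w) = cnj (g w)" unfolding g_def by (simp only: Bochner_Integration.integral_cnj)
qed

text \<open>The root may have unbounded support, so its equation is known only far up the imaginary
  axis. As \<open>R / n\<close> is bounded by \<open>C\<close>, both sides are holomorphic on a
  half-plane that does not depend on n, and the identity theorem extends the equation to it. This
  uniformity allows all n to be used on one set of test points.\<close>

lemma free_root_equation_extends:
  assumes \<mu>: "real_distribution \<mu>" and n: "n \<ge> (1 :: nat)"
    and R: "R holomorphic_on ball 0 r" and r: "r > 0"
    and C: "\<And>w. norm w < r \<Longrightarrow> norm (R w) \<le> C" and C0: "C0 \<ge> C" "C0 \<ge> 1 / r"
    and ray: "eventually (\<lambda>y. cauchy_transform \<mu> (\<i> * of_real y + R (1 / (\<i> * of_real y)) / of_nat n) = 1 / (\<i> * of_real y)) at_top"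
    and z: "Im z > C0"
  shows "cauchy_transform \<mu> (z + R (1 / z) / of_nat n) = 1 / z"
proof -
  define U where "U = {z. Im z > C0}"
  have inv: "norm (1 / z) < r" "z \<noteq> 0" if "z \<in> U" for z
  proof -
    have nz: "norm z > 1 / r" using that C0(2) abs_Im_le_cmod[of z] by (auto simp: U_def)
    then show "z \<noteq> 0" using r by auto
    then show "norm (1 / z) < r" using nz r by (simp add: norm_divide field_simps)
  qed
  have Im: "Im (z + R (1 / z) / of_nat n) > 0" if "z \<in> U" for z
  proof -
    have "norm (R (1 / z) / of_nat n) \<le> norm (R (1 / z))"
      using n by (simp add: norm_divide divide_le_eq mult_le_cancel_left1)
    also have "\<dots> \<le> C" by (rule C[OF inv(1)[OF that]])
    finally have "\<bar>Im (R (1 / z) / of_nat n)\<bar> \<le> C" using abs_Im_le_cmod order_trans by blast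
    then show ?thesis using that C0(1) unfolding U_def mem_Collect_eq plus_complex.sel by linarith
  qed
  obtain Y where Y: "\<And>y. y \<ge> Y \<Longrightarrow> cauchy_transform \<mu> (\<i> * of_real y + R (1 / (\<i> * of_real y)) / of_nat n) = 1 / (\<i> * of_real y)"
    using ray unfolding eventually_at_top_linorder by blast
  define Y' where "Y' = max Y (C0 + 1)"
  have "(cauchy_transform \<mu> (z + R (1 / z) / of_nat n) - 1 / z) = 0"
  proof (rule analytic_continuation[where f = "\<lambda>z. cauchy_transform \<mu> (z + R (1 / z) / of_nat n) - 1 / z"])
    have "(R \<circ> (\<lambda>z. 1 / z)) holomorphic_on U"
    proof (rule holomorphic_on_compose_gen[OF _ R])
      show "(\<lambda>z. 1 / z) holomorphic_on U" by (intro holomorphic_intros) (use inv in blast)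
      show "(\<lambda>z. 1 / z) ` U \<subseteq> ball 0 r" using inv by force
    qed
    then have "(\<lambda>z. R (1 / z)) holomorphic_on U" by (simp add: o_def)
    then have "(\<lambda>z. z + R (1 / z) / of_nat n) holomorphic_on U"
      by (intro holomorphic_intros) (use n in auto)
    then have "(cauchy_transform \<mu> \<circ> (\<lambda>z. z + R (1 / z) / of_nat n)) holomorphic_on U"
      by (rule holomorphic_on_compose_gen[OF _ cauchy_transform_holomorphic[OF \<mu>]]) (use Im in blast)
    then show "(\<lambda>z. cauchy_transform \<mu> (z + R (1 / z) / of_nat n) - 1 / z) holomorphic_on U"
      unfolding o_def by (intro holomorphic_intros) (use inv in auto)
    show "open U" unfolding U_def by (rule open_halfspace_Im_gt)
    show "connected U" unfolding U_def by (intro convex_connected convex_halfspace_Im_gt)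
    show "(\<lambda>y. \<i> * complex_of_real y) ` {Y'..} \<subseteq> U" by (auto simp: U_def Y'_def)
    show "\<i> * complex_of_real Y' \<in> U" by (simp add: U_def Y'_def)
    show "\<i> * complex_of_real Y' islimpt (\<lambda>y. \<i> * complex_of_real y) ` {Y'..}"
      unfolding islimpt_approachable
    proof (intro allI impI)
      fix e :: real assume e: "e > 0"
      have "dist (\<i> * complex_of_real (Y' + e / 2)) (\<i> * complex_of_real Y') < e"
        using e by (simp add: dist_norm norm_mult flip: right_diff_distrib of_real_diff)
      moreover have "\<i> * complex_of_real (Y' + e / 2) \<noteq> \<i> * complex_of_real Y'" using e by (simp flip: of_real_add)
      ultimately show "\<exists>x'\<in>(\<lambda>y. \<i> * complex_of_real y) ` {Y'..}. x' \<noteq> \<i> * complex_of_real Y' \<and> dist x' (\<i> * complex_of_real Y') < e"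
        using imageI[of "Y' + e / 2" "{Y'..}" "\<lambda>y. \<i> * complex_of_real y"] e by fastforce
    qed
    show "cauchy_transform \<mu> (x + R (1 / x) / of_nat n) - 1 / x = 0"
      if "x \<in> (\<lambda>y. \<i> * complex_of_real y) ` {Y'..}" for x
      using that Y by (auto simp: Y'_def)
    show "z \<in> U" using z by (simp add: U_def)
  qed
  then show ?thesis by simp
qed

text \<open>The point \<open>a w\<close> is a preimage of \<open>1 / w\<close> under the reciprocal
  Cauchy transform, so the Gram kernel of the resolvents \<open>1 / (a w - t)\<close> is
  \<open>(w - cnj z) / (cnj (a z) - a w)\<close>. Inserting the formula for \<open>a\<close> turns
  it, after the weights \<open>1 / w\<close>, into \<open>1 / (1 - L / n)\<close>.\<close>

lemma resolvent_kernel_psd: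
  assumes \<mu>: "real_distribution \<mu>" and n: "n \<ge> (1 :: nat)"
    and cnj: "\<And>w. w \<in> S \<Longrightarrow> R (cnj w) = cnj (R w)"
    and S: "\<And>w. w \<in> S \<Longrightarrow> Im w < 0"
    and Im: "\<And>w. w \<in> S \<Longrightarrow> Im (1 / w + R w / of_nat n) > 0"
    and eq: "\<And>w. w \<in> S \<Longrightarrow> cauchy_transform \<mu> (1 / w + R w / of_nat n) = w"
  shows "psd_kernel S (\<lambda>w z. 1 / (1 - w * cnj z * (R w - R (cnj z)) / (w - cnj z) / of_nat n))"
proof -
  interpret real_distribution \<mu> by fact
  define a where "a w = 1 / w + R w / of_nat n" for w
  define K where "K w z = (LINT t|\<mu>. 1 / (a w - complex_of_real t) * cnj (1 / (a z - complex_of_real t)))" for w z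
  have "psd_multiplier S K"
    unfolding K_def
  proof (rule psd_multiplier_integral[OF \<mu>])
    show "AE t in \<mu>. norm (1 / (a w - complex_of_real t)) \<le> 1 / Im (a w)" if "w \<in> S" for w
    proof (rule AE_I2)
      fix t show "norm (1 / (a w - complex_of_real t)) \<le> 1 / Im (a w)"
        using Im[OF that] norm_ge_Im_cauchy[of "a w" t] by (simp add: norm_divide a_def[symmetric] frac_le)
    qed
  qed auto
  then have "psd_kernel S (\<lambda>w z. (1 / w) * cnj (1 / z) * K w z)"
    by (intro psd_kernel_weight psd_multiplier_imp_psd)
  then show ?thesis
  proof (rule psd_kernel_cong)
    fix w z assume wz: "w \<in> S" "z \<in> S"
    have nz: "w \<noteq> 0" "cnj z \<noteq> 0" "w \<noteq> cnj z" using S[OF wz(1)] S[OF wz(2)] by (auto simp: complex_eq_iff)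
    have Ima: "Im (a w) > 0" "Im (cnj (a z)) < 0"
      using Im[OF wz(1)] Im[OF wz(2)] unfolding a_def[symmetric] by simp_all
    have "cauchy_transform \<mu> (cnj (a z)) = (LINT t|\<mu>. cnj (1 / (a z - complex_of_real t)))"
      unfolding cauchy_transform_def by simp
    also have "\<dots> = cnj (cauchy_transform \<mu> (a z))"
      unfolding cauchy_transform_def by (rule Bochner_Integration.integral_cnj)
    finally have Gz: "cauchy_transform \<mu> (cnj (a z)) = cnj z" using eq[OF wz(2)] by (simp add: a_def)
    have "K w z = (LINT t|\<mu>. 1 / ((a w - complex_of_real t) * (cnj (a z) - of_real t)))"
      unfolding K_def by simp
    then have diff: "w - cnj z = (cnj (a z) - a w) * K w z"
      using cauchy_transform_difference[OF \<mu>, of "a w" "cnj (a z)"] Ima eq[OF wz(1)] Gz by (simp add: a_def)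
    define L where "L = w * cnj z * (R w - R (cnj z)) / (w - cnj z)"
    have dR: "R w - R (cnj z) = L * (w - cnj z) / (w * cnj z)" using nz by (simp add: L_def)
    have "cnj (a z) - a w = (1 / cnj z - 1 / w) - (R w - R (cnj z)) / of_nat n"
      unfolding a_def using cnj[OF wz(2)] by (simp add: diff_divide_distrib)
    also have "\<dots> = (w - cnj z) / (w * cnj z) * (1 - L / of_nat n)"
      unfolding dR using nz n by (simp add: field_simps)
    finally have e: "cnj (a z) - a w = (w - cnj z) / (w * cnj z) * (1 - L / of_nat n)" .
    have "(w - cnj z) * 1 = (w - cnj z) * ((1 - L / of_nat n) * (K w z / (w * cnj z)))"
      using diff unfolding e by (simp add: mult.assoc)
    then have "(1 - L / of_nat n) * (K w z / (w * cnj z)) = 1"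
      using nz(3) unfolding mult_cancel_left by simp
    moreover have "X = 1 / A" if "A * X = 1" for A X :: complex
    proof -
      have "A \<noteq> 0" using that by auto
      then show ?thesis using that by (simp add: eq_divide_eq mult.commute)
    qed
    ultimately have "K w z / (w * cnj z) = 1 / (1 - L / of_nat n)" by blast
    then show "(1 / w) * cnj (1 / z) * K w z = 1 / (1 - w * cnj z * (R w - R (cnj z)) / (w - cnj z) / of_nat n)"
      by (simp add: L_def)
  qed
qed

text \<open>Uniqueness on the ray forces the transform of an n-th root to be \<open>R / n\<close>,
  whose resolvent kernel is positive; letting n grow leaves the kernel of \<open>R\<close>
  conditionally positive.\<close>

lemma freely_infinitely_divisible_imp_levy_representation:
  assumes \<mu>: "compact_distribution B \<mu>" and fid: "freely_infinitely_divisible \<mu>"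
  defines "g \<equiv> \<lambda>w. LINT t|\<mu>. w / (1 - w * complex_of_real t)"
  obtains R r T \<beta> \<pi> s where "levy_representation R r T \<beta> \<pi>" "s > 0"
    "\<And>z. z \<noteq> 0 \<Longrightarrow> norm z < s \<Longrightarrow> g z \<noteq> 0 \<and> norm (g z) < r \<and> 1 / z = 1 / g z + R (g z)"
proof -
  note B = compact_distributionD(2)[OF \<mu>]
  have B': "1 / B > 0" using B by simp
  have g: "g holomorphic_on ball 0 (1 / B)" "g 0 = 0" "deriv g 0 = 1" "\<And>w. g (cnj w) = cnj (g w)"
    using compact_cauchy_properties[OF \<mu>] unfolding g_def by blast+
  obtain f r1 s1 where f: "r1 > 0" "s1 > 0" "s1 \<le> 1 / B" "f holomorphic_on ball 0 r1" "f 0 = 0" "deriv f 0 = 1"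
    "\<And>w. norm w < r1 \<Longrightarrow> norm (f w) < 1 / B \<and> g (f w) = w \<and> f (cnj w) = cnj (f w)"
    "\<And>z. norm z < s1 \<Longrightarrow> norm (g z) < r1 \<and> f (g z) = z"
    by (rule holomorphic_local_inverse[OF g(1) B' g(2,3,4)]) (rule that, assumption+)
  have f_nz: "f w \<noteq> 0" if "norm w < r1" "w \<noteq> 0" for w using f(7)[OF that(1)] that(2) g(2) by auto
  obtain R where R: "R holomorphic_on ball 0 r1"
    "\<And>w. norm w < r1 \<Longrightarrow> w \<noteq> 0 \<Longrightarrow> 1 / f w = 1 / w + R w"
    "\<And>w. norm w < r1 \<Longrightarrow> R (cnj w) = cnj (R w)"
    by (rule holomorphic_reciprocal_difference[OF f(4,1,5,6) f_nz]) (use f(7) in blast)+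
  have "(LINT t|\<mu>. 1 / (1 / w + R w - complex_of_real t)) = w" if "w \<noteq> 0" "norm w < r1" for w
  proof -
    have "(LINT t|\<mu>. 1 / (1 / w + R w - complex_of_real t)) = (LINT t|\<mu>. f w / (1 - f w * complex_of_real t))"
      unfolding R(2)[OF that(2,1), symmetric] using f_nz[OF that(2,1)]
      by (intro Bochner_Integration.integral_cong refl) (simp add: field_simps)
    then show ?thesis using f(7)[OF that(2)] by (simp add: g_def)
  qed
  from has_free_levy_transformI[OF R(1) f(1) f(1) this]
  obtain b where "is_voiculescu_transform \<mu> 1 b (\<lambda>z. R (1 / z))"
    unfolding has_free_levy_transform_def by blast
  then have ray\<mu>: "ray_voiculescu \<mu> (\<lambda>y. R (1 / (\<i> * of_real y)))"
    by (rule is_voiculescu_transform_imp_ray) simp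
  have "isCont R 0"
    using R(1) f(1) by (auto dest!: holomorphic_on_imp_continuous_on simp: continuous_on_eq_continuous_at)
  then have "((\<lambda>w. norm (R w)) \<longlongrightarrow> norm (R 0)) (nhds 0)"
    unfolding isCont_def tendsto_at_iff_tendsto_nhds by (rule tendsto_norm)
  then have "eventually (\<lambda>w. norm (R w) < norm (R 0) + 1) (nhds 0)"
    by (rule order_tendstoD) simp
  then obtain d where d: "d > 0" "\<And>w. norm w < d \<Longrightarrow> norm (R w) < norm (R 0) + 1"
    unfolding eventually_nhds_metric by (auto simp: dist_norm)
  define C where "C = norm (R 0) + 1"
  define r2 where "r2 = min r1 d"
  define C0 where "C0 = C + 1 / r2"
  have r2: "r2 > 0" "r2 \<le> r1" using d f by (auto simp: r2_def)
  have C: "C > 0" unfolding C_def by (rule add_nonneg_pos) auto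
  have RC: "norm (R w) \<le> C" if "norm w < r2" for w using d(2)[of w] that by (simp add: r2_def C_def)
  have holR: "R holomorphic_on ball 0 r2" by (rule holomorphic_on_subset[OF R(1)]) (use r2 in auto)
  have C0: "C0 \<ge> C" "C0 \<ge> 1 / r2" "C0 > 0" using C r2 by (auto simp: C0_def intro: add_pos_pos)
  \<comment> \<open>On the negative imaginary axis this radius places \<open>1 / w\<close> above
    height \<open>C0\<close>.\<close>
  define r3 where "r3 = 1 / C0"
  have r3: "r3 > 0" "r3 \<le> r2" using C0 r2 by (auto simp: r3_def field_simps)
  define S where "S = {w :: complex. norm w < r3 \<and> Re w = 0 \<and> Im w < 0}"
  have S_inv: "Im (1 / w) > C0" if "w \<in> S" for w
  proof -
    have "Re w = 0" "Im w < 0" "\<bar>Im w\<bar> < r3"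
      using that abs_Im_le_cmod[of w] by (auto simp: S_def)
    then have "Im (1 / w) = - Im w / (Im w)\<^sup>2" by (simp add: Im_divide)
    also have "\<dots> = 1 / \<bar>Im w\<bar>" using \<open>Im w < 0\<close> by (simp add: power2_eq_square)
    also have "\<dots> > C0" using \<open>\<bar>Im w\<bar> < r3\<close> \<open>Im w < 0\<close> C0(3) by (simp add: r3_def field_simps)
    finally show ?thesis .
  qed
  have psd: "conditionally_psd_kernel S (\<lambda>w z. w * cnj z * (R w - R (cnj z)) / (w - cnj z))"
  proof (rule conditionally_psd_of_resolvents)
    fix n :: nat assume n: "n \<ge> 2"
    then have "n \<ge> 1" by simp
    then obtain \<mu>n where "is_free_convolution_power \<mu>n n \<mu>"
      using fid unfolding freely_infinitely_divisible_def by blast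
    from free_convolution_power_ray[OF this n] obtain h where h: "real_distribution \<mu>n" "ray_voiculescu \<mu>n h"
      "ray_voiculescu \<mu> (\<lambda>y. of_nat n * h y)" by blast
    have ray: "eventually (\<lambda>y. cauchy_transform \<mu>n (\<i> * of_real y + R (1 / (\<i> * of_real y)) / of_nat n) = 1 / (\<i> * of_real y)) at_top"
      using ray_voiculescu_unique[OF compact_distributionD(1)[OF \<mu>] ray\<mu> h(3)] ray_voiculescu_bounds[OF h(2)]
      by eventually_elim (use n in simp)
    show "psd_kernel S (\<lambda>w z. 1 / (1 - w * cnj z * (R w - R (cnj z)) / (w - cnj z) / of_nat n))"
    proof (rule resolvent_kernel_psd[OF h(1)])
      fix w assume w: "w \<in> S"
      have nw: "norm w < r2" using w r3 by (simp add: S_def)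
      show "R (cnj w) = cnj (R w)" using R(3) nw r2 by simp
      show "Im w < 0" using w by (simp add: S_def)
      have "norm (R w / of_nat n) \<le> norm (R w)" using n by (simp add: norm_divide divide_le_eq mult_le_cancel_left1)
      then have "\<bar>Im (R w / of_nat n)\<bar> \<le> C" using RC[OF nw] abs_Im_le_cmod[of "R w / of_nat n"] by linarith
      then show "Im (1 / w + R w / of_nat n) > 0"
        using S_inv[OF w] C0(1) unfolding plus_complex.sel by linarith
      show "cauchy_transform \<mu>n (1 / w + R w / of_nat n) = w"
        using free_root_equation_extends[OF h(1) _ holR r2(1) RC C0(1,2) ray S_inv[OF w]] n by simp
    qed (use n in simp)
  qed
  have holR3: "R holomorphic_on ball 0 r3" by (rule holomorphic_on_subset[OF R(1)]) (use r3 r2 in auto)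
  have cnj3: "R (cnj w) = cnj (R w)" if "norm w < r3" for w using R(3) that r3 r2 by simp
  obtain T \<beta> \<pi> where rep: "compact_distribution T \<pi>" "\<beta> \<ge> 0"
    "\<And>w. norm w * T < 1 \<Longrightarrow> norm w < r3 \<Longrightarrow> R w = R 0 + of_real \<beta> * (LINT t|\<pi>. w / (1 - w * of_real t))"
    by (rule nevanlinna_representation[OF holR3 r3(1) cnj3 psd[unfolded S_def]]) (assumption, rule that, assumption+)
  define r where "r = min r3 (1 / (2 * T))"
  note T = compact_distributionD(2)[OF rep(1)]
  have r: "r > 0" "r \<le> r3" "r * T \<le> 1 / 2" using r3 T by (auto simp: r_def min_def field_simps)
  have lev: "levy_representation R r T \<beta> \<pi>"
    unfolding levy_representation_def
  proof (intro conjI allI impI rep(1,2) r(1,3))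
    show "R holomorphic_on ball 0 r" by (rule holomorphic_on_subset[OF R(1)]) (use r r3 r2 in auto)
    fix w :: complex assume w: "norm w < r"
    show "R (cnj w) = cnj (R w)" using R(3) w r r3 r2 by simp
    have "norm w * T \<le> r * T" using w T by (intro mult_right_mono) auto
    then show "R w = R 0 + of_real \<beta> * (LINT t|\<pi>. w / (1 - w * of_real t))"
      using rep(3)[of w] w r by simp
  qed
  have "isCont g 0"
    using g(1) B by (auto dest!: holomorphic_on_imp_continuous_on simp: continuous_on_eq_continuous_at)
  then have "\<exists>d>0. \<forall>w. dist w 0 < d \<longrightarrow> dist (g w) (g 0) < r"
    unfolding continuous_at_eps_delta using r by simp
  then obtain s where s: "s > 0" "\<And>w. norm w < s \<Longrightarrow> norm (g w) < r"
    by (auto simp: dist_norm g(2))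
  show thesis
  proof
    show "levy_representation R r T \<beta> \<pi>" by (rule lev)
    show "min s s1 > 0" using s f by simp
    fix z :: complex assume z: "z \<noteq> 0" "norm z < min s s1"
    have fg: "f (g z) = z" "norm (g z) < r1" using f(8)[of z] z by auto
    then have "g z \<noteq> 0" using z f(5) by auto
    then show "g z \<noteq> 0 \<and> norm (g z) < r \<and> 1 / z = 1 / g z + R (g z)"
      using R(2)[OF fg(2)] s(2)[of z] z fg by simp
  qed
qed

section \<open>Moments of semicircular elements\<close>

text \<open>Intervals rather than initial segments, so that cutting along a block leaves objects of
  the same kind without relabelling.\<close>

definition nc_pairings :: "nat \<Rightarrow> nat \<Rightarrow> nat set set set" where
  "nc_pairings a b = {P. partition_on {a..<b} P \<and> noncrossing P \<and> (\<forall>V\<in>P. card V = 2)}"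

lemma finite_nc_pairings: "finite (nc_pairings a b)"
  by (rule finite_subset[of _ "Pow (Pow {a..<b})"]) (auto simp: nc_pairings_def partition_on_def)

lemma nc_pairings_block_subset:
  "P \<in> nc_pairings a b \<Longrightarrow> V \<in> P \<Longrightarrow> V \<subseteq> {a..<b} \<and> V \<noteq> {}"
  by (auto simp: nc_pairings_def partition_on_def)

lemma nc_pairings_finite: "P \<in> nc_pairings a b \<Longrightarrow> finite P"
  using finite_elements[of "{a..<b}" P] by (auto simp: nc_pairings_def)

lemma nc_pairings_empty: "nc_pairings a a = {{}}"
  by (auto simp: nc_pairings_def partition_on_def noncrossing_def)

lemma noncrossingD:
  assumes "noncrossing P" "V \<in> P" "W \<in> P" "V \<noteq> W" "i < j" "j < k" "k < l" "i \<in> V" "k \<in> V" "j \<in> W" "l \<in> W"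
  shows False
proof -
  have "\<exists>i j k l. i < j \<and> j < k \<and> k < l \<and> i \<in> V \<and> k \<in> V \<and> j \<in> W \<and> l \<in> W"
    using assms(5-11) by (intro exI conjI)
  then show False using assms(1-4) unfolding noncrossing_def by (meson bexI)
qed

lemma noncrossing_mono: "noncrossing P \<Longrightarrow> Q \<subseteq> P \<Longrightarrow> noncrossing Q"
  unfolding noncrossing_def by (meson subsetD)

lemma nc_pairings_insert:
  assumes A: "A \<in> nc_pairings (Suc a) j" and B: "B \<in> nc_pairings (Suc j) b" and j: "a < j" "j < b"
  shows "insert {a, j} (A \<union> B) \<in> nc_pairings a b"
    and "card (insert {a, j} (A \<union> B)) = Suc (card A + card B)"
proof -
  note sub = nc_pairings_block_subset[OF A] nc_pairings_block_subset[OF B]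
  have subA: "V \<subseteq> {Suc a..<j}" "V \<noteq> {}" if "V \<in> A" for V using sub(1)[OF that] by auto
  have subB: "V \<subseteq> {Suc j..<b}" "V \<noteq> {}" if "V \<in> B" for V using sub(2)[OF that] by auto
  have UA: "\<Union>A = {Suc a..<j}" and UB: "\<Union>B = {Suc j..<b}"
    and dA: "disjoint A" and dB: "disjoint B" and nA: "noncrossing A" and nB: "noncrossing B"
    using A B by (auto simp: nc_pairings_def partition_on_def)
  have not: "{a, j} \<notin> A \<union> B" using subA subB by force
  have AB: "A \<inter> B = {}"
  proof (rule ccontr)
    assume "A \<inter> B \<noteq> {}"
    then obtain V where V: "V \<in> A" "V \<in> B" by blast
    then obtain x where "x \<in> V" using subA by blast
    then show False using subA(1)[OF V(1)] subB(1)[OF V(2)] by force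
  qed
  show "card (insert {a, j} (A \<union> B)) = Suc (card A + card B)"
    using not AB nc_pairings_finite[OF A] nc_pairings_finite[OF B] by (simp add: card_Un_disjoint)
  have "partition_on {a..<b} (insert {a, j} (A \<union> B))"
    unfolding partition_on_def
  proof (intro conjI)
    show "\<Union>(insert {a, j} (A \<union> B)) = {a..<b}" unfolding Union_insert Union_Un_distrib UA UB using j by auto
    show "disjoint (insert {a, j} (A \<union> B))"
    proof -
      have dAB: "disjoint (A \<union> B)" by (rule disjoint_union[OF dA dB]) (unfold UA UB, auto)
      have eA: "\<Union>{{a, j}} \<inter> \<Union>(A \<union> B) = {}" unfolding Union_Un_distrib UA UB using j by auto
      have "disjoint ({{a, j}} \<union> (A \<union> B))"
        by (rule disjoint_union[OF _ dAB eA]) (simp add: disjoint_def)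
      then show ?thesis by simp
    qed
    have "{} \<notin> A" "{} \<notin> B" using subA(2) subB(2) by blast+
    then show "{} \<notin> insert {a, j} (A \<union> B)" by simp
  qed
  moreover have "noncrossing (insert {a, j} (A \<union> B))"
    unfolding noncrossing_def
  proof (intro notI, elim bexE conjE exE)
    fix V W p q r s
    assume V: "V \<in> insert {a, j} (A \<union> B)" and W: "W \<in> insert {a, j} (A \<union> B)" and ne: "V \<noteq> W"
      and o: "p < q" "q < r" "r < s" and m: "p \<in> V" "r \<in> V" "q \<in> W" "s \<in> W"
    have cross: "\<not> (V \<in> A \<and> W \<in> A)" "\<not> (V \<in> B \<and> W \<in> B)"
      using noncrossingD[OF nA _ _ ne o m] noncrossingD[OF nB _ _ ne o m] by metis+
    have VA: "p \<ge> Suc a \<and> r < j" if "V \<in> A" using subA(1)[OF that] m by auto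
    have VB: "p \<ge> Suc j" if "V \<in> B" using subB(1)[OF that] m by auto
    have WA: "q \<ge> Suc a \<and> s < j" if "W \<in> A" using subA(1)[OF that] m by auto
    have WB: "q \<ge> Suc j" if "W \<in> B" using subB(1)[OF that] m by auto
    have Va: "p = a \<and> r = j" if "V = {a, j}" using m o j that by auto
    have Wa: "q = a \<and> s = j" if "W = {a, j}" using m o j that by auto
    have Vd: "V = {a, j} \<or> V \<in> A \<or> V \<in> B" and Wd: "W = {a, j} \<or> W \<in> A \<or> W \<in> B" using V W by auto
    from Vd show False
    proof (elim disjE)
      assume V: "V = {a, j}"
      from Wd V ne Va[OF V] show False using WA WB o by (elim disjE) auto
    next
      assume V: "V \<in> A"
      from Wd VA[OF V] cross(1) V show False using Wa WB o j by (elim disjE) fastforce+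
    next
      assume V: "V \<in> B"
      from Wd VB[OF V] cross(2) V show False using Wa WA o j by (elim disjE) fastforce+
    qed
  qed
  moreover have "\<forall>V\<in>insert {a, j} (A \<union> B). card V = 2"
    using A B j by (auto simp: nc_pairings_def)
  ultimately show "insert {a, j} (A \<union> B) \<in> nc_pairings a b" by (simp add: nc_pairings_def)
qed

text \<open>If j is the partner of a, a pair with one end on each side of j would cross
  \<open>{a, j}\<close>. Every other block therefore lies strictly between a and j or strictly
  beyond j.\<close>

lemma nc_pairings_split:
  assumes P: "P \<in> nc_pairings a b" and ab: "a < b"
  obtains j A B where "a < j" "j < b" "A \<in> nc_pairings (Suc a) j" "B \<in> nc_pairings (Suc j) b"
    "P = insert {a, j} (A \<union> B)"
proof -
  have U: "\<Union>P = {a..<b}" and d: "\<And>V W x. V \<in> P \<Longrightarrow> W \<in> P \<Longrightarrow> x \<in> V \<Longrightarrow> x \<in> W \<Longrightarrow> V = W"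
    and nc: "noncrossing P" and c: "\<And>V. V \<in> P \<Longrightarrow> card V = 2"
    using P by (auto simp: nc_pairings_def partition_on_def disjoint_def)
  have "a \<in> \<Union>P" using U ab by auto
  then obtain V where V: "V \<in> P" "a \<in> V" by blast
  obtain j where j: "V = {a, j}" "j \<noteq> a"
    using c[OF V(1)] V(2) by (auto simp: card_2_iff)
  have "j \<in> {a..<b}" using U V j by auto
  then have aj: "a < j" "j < b" using j by auto
  define A where "A = {W \<in> P. W \<subseteq> {Suc a..<j}}"
  define B where "B = {W \<in> P. W \<subseteq> {Suc j..<b}}"
  have cover: "W \<in> A \<or> W \<in> B" if W: "W \<in> P" "W \<noteq> V" for W
  proof -
    obtain p q where pq: "W = {p, q}" "p < q"
    proof -
      obtain p q where "W = {p, q}" "p \<noteq> q" using c[OF W(1)] by (auto simp: card_2_iff)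
      then show thesis using that[of p q] that[of q p] by (cases "p < q") (auto simp: insert_commute)
    qed
    have pqb: "p \<in> {a..<b}" "q \<in> {a..<b}" using U W pq by auto
    moreover have pqne: "p \<noteq> a" "p \<noteq> j" "q \<noteq> a" "q \<noteq> j" using d[OF V(1) W(1)] W(2) j pq by auto
    moreover have "\<not> (p < j \<and> j < q)"
    proof
      assume pjq: "p < j \<and> j < q"
      have "a < p" using pqb pqne by auto
      then show False using noncrossingD[OF nc V(1) W(1) W(2)[symmetric], of a p j q] pjq pq j(1) by auto
    qed
    ultimately show ?thesis using W pq unfolding A_def B_def by auto
  qed
  have UA: "x \<in> \<Union>A" if x: "x \<in> {Suc a..<j}" for x
  proof -
    have "x \<in> \<Union>P" using x aj unfolding U by auto
    then obtain W where W: "W \<in> P" "x \<in> W" by blast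
    have "W \<noteq> V" using x W j by auto
    moreover have "W \<notin> B" using W x by (auto simp: B_def)
    ultimately show ?thesis using cover W by blast
  qed
  have UB: "x \<in> \<Union>B" if x: "x \<in> {Suc j..<b}" for x
  proof -
    have "x \<in> \<Union>P" using x aj unfolding U by auto
    then obtain W where W: "W \<in> P" "x \<in> W" by blast
    have "W \<noteq> V" using x W j aj by auto
    moreover have "W \<notin> A" using W x by (auto simp: A_def)
    ultimately show ?thesis using cover W by blast
  qed
  have part: "C \<in> nc_pairings c e" if C: "C \<subseteq> P" "\<Union>C = {c..<e}" for C c e
  proof -
    have "noncrossing C" using noncrossing_mono[OF nc C(1)] .
    moreover have "{} \<notin> C" using nc_pairings_block_subset[OF P] C(1) by blast
    moreover have "disjoint C" using d C(1) unfolding disjoint_def by blast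
    ultimately show ?thesis using C c by (auto simp: nc_pairings_def partition_on_def)
  qed
  show thesis
  proof
    show "a < j" "j < b" by (fact aj)+
    show "A \<in> nc_pairings (Suc a) j" by (rule part) (use UA in \<open>auto simp: A_def\<close>)
    show "B \<in> nc_pairings (Suc j) b" by (rule part) (use UB in \<open>auto simp: B_def\<close>)
    show "P = insert {a, j} (A \<union> B)"
      using cover V j(1) by (auto simp: A_def B_def)
  qed
qed

lemma nc_pairings_bij:
  assumes "a < b"
  shows "bij_betw (\<lambda>(j, A, B). insert {a, j} (A \<union> B))
    (SIGMA j:{a<..<b}. nc_pairings (Suc a) j \<times> nc_pairings (Suc j) b) (nc_pairings a b)"
  unfolding bij_betw_def
proof
  show "inj_on (\<lambda>(j, A, B). insert {a, j} (A \<union> B)) (SIGMA j:{a<..<b}. nc_pairings (Suc a) j \<times> nc_pairings (Suc j) b)"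
  proof (rule inj_onI)
    fix x y
    assume x: "x \<in> (SIGMA j:{a<..<b}. nc_pairings (Suc a) j \<times> nc_pairings (Suc j) b)"
      and y: "y \<in> (SIGMA j:{a<..<b}. nc_pairings (Suc a) j \<times> nc_pairings (Suc j) b)"
      and xy: "(case x of (j, A, B) \<Rightarrow> insert {a, j} (A \<union> B)) = (case y of (j, A, B) \<Rightarrow> insert {a, j} (A \<union> B))"
    obtain j A B j' A' B' where xyd: "x = (j, A, B)" "y = (j', A', B')" by (metis prod_cases3)
    have j: "j \<in> {a<..<b}" "j' \<in> {a<..<b}"
      and A: "A \<in> nc_pairings (Suc a) j" "A' \<in> nc_pairings (Suc a) j'"
      and B: "B \<in> nc_pairings (Suc j) b" "B' \<in> nc_pairings (Suc j') b"
      and eq: "insert {a, j} (A \<union> B) = insert {a, j'} (A' \<union> B')"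
      using x y xy unfolding xyd by auto
    have "a \<notin> V" if "V \<in> A'" for V using nc_pairings_block_subset[OF A(2) that] by auto
    moreover have "a \<notin> V" if "V \<in> B'" for V using nc_pairings_block_subset[OF B(2) that] j(2) by auto
    moreover have "{a, j} \<in> insert {a, j'} (A' \<union> B')" unfolding eq[symmetric] by simp
    ultimately have "{a, j} = {a, j'}" by auto
    then have jj: "j = j'" using j by (auto simp: doubleton_eq_iff)
    \<comment> \<open>Both halves can be read off from the union by the interval that contains their
      blocks; as blocks are nonempty, none lies in both intervals.\<close>
    have fA: "{V \<in> insert {a, j} (C \<union> D). V \<subseteq> {Suc a..<j}} = C"
      "{V \<in> insert {a, j} (C \<union> D). V \<subseteq> {Suc j..<b}} = D"
      if C: "C \<in> nc_pairings (Suc a) j" and D: "D \<in> nc_pairings (Suc j) b" for C D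
    proof -
      have nsub: "\<not> V \<subseteq> Y" if "V \<subseteq> X \<and> V \<noteq> {}" "X \<inter> Y = {}" for V X Y :: "nat set"
        using that by blast
      have "\<not> V \<subseteq> {Suc a..<j}" if "V \<in> D" for V
        by (rule nsub[OF nc_pairings_block_subset[OF D that]]) auto
      then show "{V \<in> insert {a, j} (C \<union> D). V \<subseteq> {Suc a..<j}} = C"
        using nc_pairings_block_subset[OF C] by auto
      have "\<not> V \<subseteq> {Suc j..<b}" if "V \<in> C" for V
        by (rule nsub[OF nc_pairings_block_subset[OF C that]]) auto
      then show "{V \<in> insert {a, j} (C \<union> D). V \<subseteq> {Suc j..<b}} = D"
        using nc_pairings_block_subset[OF D] by auto
    qed
    have "A = A'" using fA(1)[OF A(1) B(1)] fA(1)[of A' B'] A(2) B(2) eq unfolding jj by simp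
    moreover have "B = B'" using fA(2)[OF A(1) B(1)] fA(2)[of A' B'] A(2) B(2) eq unfolding jj by simp
    ultimately show "x = y" using jj xyd by simp
  qed
  show "(\<lambda>(j, A, B). insert {a, j} (A \<union> B)) ` (SIGMA j:{a<..<b}. nc_pairings (Suc a) j \<times> nc_pairings (Suc j) b) = nc_pairings a b"
  proof (intro equalityI subsetI)
    fix P assume "P \<in> nc_pairings a b"
    from nc_pairings_split[OF this assms] obtain j A B where "a < j" "j < b" "A \<in> nc_pairings (Suc a) j" "B \<in> nc_pairings (Suc j) b"
      "P = insert {a, j} (A \<union> B)" .
    then show "P \<in> (\<lambda>(j, A, B). insert {a, j} (A \<union> B)) ` (SIGMA j:{a<..<b}. nc_pairings (Suc a) j \<times> nc_pairings (Suc j) b)"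
      by (intro image_eqI[of _ _ "(j, A, B)"]) auto
  qed (auto intro!: nc_pairings_insert)
qed

definition pairing_weight :: "complex \<Rightarrow> nat \<Rightarrow> nat \<Rightarrow> complex" where
  "pairing_weight v a b = (\<Sum>P\<in>nc_pairings a b. v ^ card P)"

lemma pairing_weight_rec:
  assumes "a < b"
  shows "pairing_weight v a b = v * (\<Sum>j\<in>{a<..<b}. pairing_weight v (Suc a) j * pairing_weight v (Suc j) b)"
proof -
  have "pairing_weight v a b = (\<Sum>(j, A, B)\<in>(SIGMA j:{a<..<b}. nc_pairings (Suc a) j \<times> nc_pairings (Suc j) b). v ^ card (insert {a, j} (A \<union> B)))"
    unfolding pairing_weight_def using sum.reindex_bij_betw[OF nc_pairings_bij[OF assms], of "\<lambda>P. v ^ card P", symmetric]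
    by (simp add: case_prod_unfold)
  also have "\<dots> = (\<Sum>(j, A, B)\<in>(SIGMA j:{a<..<b}. nc_pairings (Suc a) j \<times> nc_pairings (Suc j) b). v * (v ^ card A * v ^ card B))"
    by (intro sum.cong refl) (auto simp: nc_pairings_insert(2) power_add)
  also have "\<dots> = (\<Sum>j\<in>{a<..<b}. \<Sum>(A, B)\<in>nc_pairings (Suc a) j \<times> nc_pairings (Suc j) b. v * (v ^ card A * v ^ card B))"
    by (subst sum.Sigma[symmetric]) (auto simp: finite_nc_pairings intro!: sum.cong)
  also have "\<dots> = (\<Sum>j\<in>{a<..<b}. v * (pairing_weight v (Suc a) j * pairing_weight v (Suc j) b))"
    unfolding pairing_weight_def sum_product
    by (rule sum.cong[OF refl]) (simp only: sum.cartesian_product sum_distrib_left split_def)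
  also have "\<dots> = v * (\<Sum>j\<in>{a<..<b}. pairing_weight v (Suc a) j * pairing_weight v (Suc j) b)"
    by (rule sum_distrib_left[symmetric])
  finally show ?thesis .
qed

text \<open>The recursion sees only the lengths of intervals, so translation invariance follows by
  induction, without transporting partitions.\<close>

lemma pairing_weight_shift: "pairing_weight v a (a + n) = pairing_weight v 0 n"
proof (induction n arbitrary: a rule: less_induct)
  case (less n)
  show ?case
  proof (cases "n = 0")
    case True
    then show ?thesis by (simp add: pairing_weight_def nc_pairings_empty)
  next
    case False
    have rec: "pairing_weight v a (a + n) = v * (\<Sum>i\<in>{..<n - 1}. pairing_weight v 0 i * pairing_weight v 0 (n - 2 - i))" for a
    proof -
      have "(\<Sum>j\<in>{a<..<a + n}. pairing_weight v (Suc a) j * pairing_weight v (Suc j) (a + n)) =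
        (\<Sum>i\<in>{..<n - 1}. pairing_weight v (Suc a) (Suc a + i) * pairing_weight v (Suc (Suc a + i)) (a + n))"
        by (rule sum.reindex_bij_witness[of _ "\<lambda>i. Suc a + i" "\<lambda>j. j - Suc a"]) auto
      also have "\<dots> = (\<Sum>i\<in>{..<n - 1}. pairing_weight v 0 i * pairing_weight v 0 (n - 2 - i))"
      proof (intro sum.cong refl)
        fix i assume i: "i \<in> {..<n - 1}"
        then have e: "a + n = Suc (Suc a + i) + (n - 2 - i)" by auto
        show "pairing_weight v (Suc a) (Suc a + i) * pairing_weight v (Suc (Suc a + i)) (a + n) = pairing_weight v 0 i * pairing_weight v 0 (n - 2 - i)"
          unfolding e using i by (subst less.IH less.IH[of "n - 2 - i"], simp)+ simp
      qed
      finally show ?thesis using pairing_weight_rec[of a "a + n" v] False by simp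
    qed
    show ?thesis using rec[of a] rec[of 0] by simp
  qed
qed

lemma pairing_weight_catalan:
  "pairing_weight v 0 (Suc n) = v * (\<Sum>i<n. pairing_weight v 0 i * pairing_weight v 0 (n - 1 - i))"
proof -
  have "pairing_weight v 0 (Suc n) = v * (\<Sum>j\<in>{0<..<Suc n}. pairing_weight v (Suc 0) j * pairing_weight v (Suc j) (Suc n))"
    by (rule pairing_weight_rec) simp
  also have "(\<Sum>j\<in>{0<..<Suc n}. pairing_weight v (Suc 0) j * pairing_weight v (Suc j) (Suc n)) =
    (\<Sum>i<n. pairing_weight v 1 (1 + i) * pairing_weight v (2 + i) ((2 + i) + (n - 1 - i)))"
    by (rule sum.reindex_bij_witness[of _ Suc "\<lambda>j. j - 1"]) auto
  finally show ?thesis by (simp only: pairing_weight_shift)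
qed

section \<open>From free cumulants to the moments of a semicircular element\<close>

lemma finite_NC: "finite (NC n)"
  by (rule finite_subset[of _ "Pow (Pow {..<n})"]) (auto simp: NC_def partition_on_def)

text \<open>The recursion for cumulants isolates the one-block partition. For
  \<open>n \<ge> 1\<close> its block is nonempty, so it belongs to \<open>NC n\<close> and its term
  can be put back.\<close>

lemma moment_eq_sum_free_cumulants:
  assumes n: "n \<ge> 1"
  shows "\<tau> (s ^ n) = (\<Sum>P\<in>NC n. \<Prod>V\<in>P. free_cumulant \<tau> (replicate (card V) s))"
proof -
  have nths: "nths (replicate n s) V = replicate (card V) s" if "V \<subseteq> {..<n}" for V
  proof (rule replicate_eqI)
    have "{i. i < n \<and> i \<in> V} = V" using that by auto
    then show "length (nths (replicate n s) V) = card V" by (simp add: length_nths)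
    show "y = s" if "y \<in> set (nths (replicate n s) V)" for y
      using that by (auto simp: set_nths)
  qed
  have sub: "V \<subseteq> {..<n}" if "P \<in> NC n" "V \<in> P" for P V using that by (auto simp: NC_def partition_on_def)
  have "{} \<noteq> {..<n}" using n lessThan_empty_iff[of n] by force
  then have one: "{{..<n}} \<in> NC n" by (auto simp: NC_def noncrossing_def partition_on_def disjoint_def)
  have "free_cumulant \<tau> (replicate n s) = \<tau> (s ^ n) -
    (\<Sum>P \<in> NC n - {{{..<n}}}. \<Prod>V\<in>P. free_cumulant \<tau> (nths (replicate n s) V))"
    by (subst free_cumulant.simps) simp
  also have "(\<Sum>P \<in> NC n - {{{..<n}}}. \<Prod>V\<in>P. free_cumulant \<tau> (nths (replicate n s) V)) =
    (\<Sum>P \<in> NC n - {{{..<n}}}. \<Prod>V\<in>P. free_cumulant \<tau> (replicate (card V) s))"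
    by (intro sum.cong prod.cong refl) (use nths sub in auto)
  finally show ?thesis
    using sum.remove[OF finite_NC one, of "\<lambda>P. \<Prod>V\<in>P. free_cumulant \<tau> (replicate (card V) s)"] by simp
qed

lemma semicircular_moments:
  assumes unit: "\<tau> 1 = 1" and s: "semicircular \<tau> s"
  obtains v where "v > 0" "\<And>n. \<tau> (s ^ n) = pairing_weight (complex_of_real v) 0 n"
proof -
  obtain v where v: "v > 0" "free_cumulant \<tau> (replicate 2 s) = complex_of_real v"
    and zero: "\<And>n. n \<ge> 1 \<Longrightarrow> n \<noteq> 2 \<Longrightarrow> free_cumulant \<tau> (replicate n s) = 0"
    using s unfolding semicircular_def by blast
  have "\<tau> (s ^ n) = pairing_weight (complex_of_real v) 0 n" for n
  proof (cases "n = 0")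
    case True
    then show ?thesis using unit by (simp add: pairing_weight_def nc_pairings_empty)
  next
    case False
    have eq: "(\<Prod>V\<in>P. free_cumulant \<tau> (replicate (card V) s)) = (if \<forall>V\<in>P. card V = 2 then complex_of_real v ^ card P else 0)"
      if P: "P \<in> NC n" for P
    proof (cases "\<forall>V\<in>P. card V = 2")
      case True
      then show ?thesis using v(2) by simp
    next
      case False
      then obtain V where V: "V \<in> P" "card V \<noteq> 2" by blast
      have "V \<subseteq> {..<n}" "V \<noteq> {}" using P V by (auto simp: NC_def partition_on_def)
      then have "card V \<ge> 1" using finite_subset[of V "{..<n}"] by (simp add: Suc_leI card_gt_0_iff)
      then have "free_cumulant \<tau> (replicate (card V) s) = 0" using zero V by blast
      moreover have "finite P" using P finite_elements[of "{..<n}" P] by (simp add: NC_def)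
      ultimately show ?thesis using False V(1) by (auto intro!: prod_zero bexI[of _ V])
    qed
    have "\<tau> (s ^ n) = (\<Sum>P\<in>NC n. if \<forall>V\<in>P. card V = 2 then complex_of_real v ^ card P else 0)"
      unfolding moment_eq_sum_free_cumulants[OF False[unfolded neq0_conv, THEN Suc_leI, unfolded One_nat_def[symmetric]]]
      by (intro sum.cong refl eq)
    also have "\<dots> = (\<Sum>P\<in>{P \<in> NC n. \<forall>V\<in>P. card V = 2}. complex_of_real v ^ card P)"
      by (rule sum.inter_filter[symmetric]) (rule finite_NC)
    also have "{P \<in> NC n. \<forall>V\<in>P. card V = 2} = nc_pairings 0 n"
      by (auto simp: NC_def nc_pairings_def lessThan_atLeast0)
    finally show ?thesis by (simp add: pairing_weight_def)
  qed
  then show thesis using that v by blast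
qed

section \<open>The Schwinger-Dyson equation\<close>

lemma scaleC_minus_one: "(- 1) *\<^sub>C (a :: 'a::unital_cstar_algebra) = - a"
  using scaleC_of_real[of "-1" a] by simp

lemma scaleC_zero_left [simp]: "0 *\<^sub>C (a :: 'a::unital_cstar_algebra) = 0"
  using scaleC_of_real[of 0 a] by simp

lemma diff_eq_add_scaleC: "a - b = a + (- 1) *\<^sub>C (b :: 'a::unital_cstar_algebra)"
  by (simp add: scaleC_minus_one)

context ncps begin

lemmas ncps_add = add

lemma tau_minus: "\<tau> (- a) = - \<tau> a"
  using scaleC[of "-1" a] by (simp add: scaleC_minus_one)

lemma tau_diff: "\<tau> (a - b) = \<tau> a - \<tau> b"
  using add[of a "- b"] by (simp add: tau_minus)

lemma tau_scaleC_one: "\<tau> (c *\<^sub>C 1) = c"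
  using scaleC[of c 1] unit by simp

definition centered :: "'a \<Rightarrow> 'a" where "centered a = a - \<tau> a *\<^sub>C 1"

lemma tau_centered: "\<tau> (centered a) = 0"
  by (simp add: centered_def tau_diff tau_scaleC_one)

lemma centered_mult: "centered a * W = a * W + (- \<tau> a) *\<^sub>C W"
proof -
  have "(- \<tau> a) *\<^sub>C W = (- 1) *\<^sub>C (\<tau> a *\<^sub>C W)" by (simp add: scaleC_scaleC)
  then show ?thesis by (simp add: centered_def left_diff_distrib scaleC_mult_left scaleC_minus_one)
qed

lemma mult_centered: "W * centered a = W * a + (- \<tau> a) *\<^sub>C W"
proof -
  have "(- \<tau> a) *\<^sub>C W = (- 1) *\<^sub>C (\<tau> a *\<^sub>C W)" by (simp add: scaleC_scaleC)
  then show ?thesis by (simp add: centered_def right_diff_distrib scaleC_mult_right scaleC_minus_one)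
qed

lemma centered_in_subalgebra:
  assumes "a \<in> unital_subalgebra S"
  shows "centered a \<in> unital_subalgebra S"
  unfolding centered_def diff_eq_add_scaleC using assms
  by (intro unital_subalgebra.add unital_subalgebra.scaleC unital_subalgebra.one)

end

text \<open>Of semicircularity only the recursion for the moments is kept: it is the Schwinger-Dyson
  equation for the powers of \<open>s\<close>.\<close>

locale semicircular_pair = ncps \<tau> for \<tau> :: "'a::unital_cstar_algebra \<Rightarrow> complex" +
  fixes x s :: 'a and v :: complex
  assumes free: "freely_independent \<tau> x s"
    and catalan: "\<tau> (s ^ Suc n) = v * (\<Sum>i<n. \<tau> (s ^ i) * \<tau> (s ^ (n - 1 - i)))"
begin

abbreviation algebra_of :: "bool \<Rightarrow> 'a set" where
  "algebra_of k \<equiv> unital_subalgebra {if k then x else s}"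

text \<open>\<open>free_diff q \<delta>\<close>: \<open>q\<close> is a polynomial in \<open>s\<close>, and \<open>\<delta> d e\<close> is \<open>\<tau> \<otimes> \<tau>\<close> applied to \<open>d (\<partial>q) e\<close>, where
  \<open>\<partial>\<close> is the free difference quotient \<open>\<partial>(s\<^sup>n) = \<Sum> s\<^sup>i \<otimes> s\<^sup>n\<^sup>-\<^sup>1\<^sup>-\<^sup>i\<close>. The functional is carried along with the
  element because \<open>\<partial>\<close> itself need not be well-defined when \<open>s\<close> satisfies a polynomial relation.\<close>

inductive free_diff :: "'a \<Rightarrow> ('a \<Rightarrow> 'a \<Rightarrow> complex) \<Rightarrow> bool" where
  one: "free_diff 1 (\<lambda>d e. 0)"
| mult: "free_diff q \<delta> \<Longrightarrow> free_diff (s * q) (\<lambda>d e. \<tau> d * \<tau> (q * e) + \<delta> (d * s) e)"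
| add: "free_diff q \<delta> \<Longrightarrow> free_diff q' \<delta>' \<Longrightarrow> free_diff (q + q') (\<lambda>d e. \<delta> d e + \<delta>' d e)"
| scale: "free_diff q \<delta> \<Longrightarrow> free_diff (c *\<^sub>C q) (\<lambda>d e. c * \<delta> d e)"

lemma free_diff_in_algebra: "free_diff q \<delta> \<Longrightarrow> q \<in> algebra_of False"
  by (induction rule: free_diff.induct) (auto intro: unital_subalgebra.intros)

lemma free_diff_linear:
  assumes "free_diff q \<delta>"
  shows "\<delta> (a + b) e = \<delta> a e + \<delta> b e" "\<delta> (c *\<^sub>C a) e = c * \<delta> a e"
proof -
  show "\<delta> (a + b) e = \<delta> a e + \<delta> b e"
    using assms by (induction arbitrary: a b rule: free_diff.induct)
      (simp_all add: distrib_right distrib_left ncps_add)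
  show "\<delta> (c *\<^sub>C a) e = c * \<delta> a e"
    using assms by (induction arbitrary: a rule: free_diff.induct)
      (simp_all add: scaleC scaleC_mult_left algebra_simps)
qed

text \<open>Each term of \<open>\<delta> d e\<close> has a factor \<open>\<tau> (b * e)\<close> with
  \<open>b\<close> a polynomial in \<open>s\<close>.\<close>

lemma free_diff_right_zero:
  assumes "free_diff q \<delta>" and "\<And>b. b \<in> algebra_of False \<Longrightarrow> \<tau> (b * e) = 0"
  shows "\<delta> d e = 0"
  using assms(1)
proof (induction arbitrary: d rule: free_diff.induct)
  case (mult q \<delta>)
  then show ?case using assms(2)[OF free_diff_in_algebra[OF mult.hyps]] by simp
qed simp_all

lemma free_diff_left_zero:
  assumes "free_diff q \<delta>" and "\<And>b. b \<in> algebra_of False \<Longrightarrow> \<tau> (d * b) = 0"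
  shows "\<delta> d 1 = 0"
  using assms
proof (induction arbitrary: d rule: free_diff.induct)
  case (mult q \<delta>)
  have "\<tau> (d * s * b) = 0" if "b \<in> algebra_of False" for b
    using mult.prems[of "s * b"] that by (simp add: mult.assoc unital_subalgebra.intros)
  then show ?case using mult.IH[of "d * s"] mult.prems[of 1] by (simp add: unital_subalgebra.one)
qed simp_all

lemma schwinger_dyson_semicircular: "free_diff q \<delta> \<Longrightarrow> \<tau> (s * q) = v * \<delta> 1 1"
proof -
  assume "free_diff q \<delta>"
  \<comment> \<open>Elements of \<open>free_diff\<close> grow on the left, so a power of
    \<open>s\<close> in front has to be carried through the induction; its own difference quotient
    gives the sum.\<close>
  then have "\<tau> (s * (s ^ n * q)) = v * ((\<Sum>i<n. \<tau> (s ^ i) * \<tau> (s ^ (n - 1 - i) * q)) + \<delta> (s ^ n) 1)" for n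
  proof (induction arbitrary: n rule: free_diff.induct)
    case one
    show ?case using catalan[of n] by simp
  next
    case (mult q \<delta>)
    have "s * (s ^ n * (s * q)) = s * (s ^ Suc n * q)" by (simp only: power_Suc2 mult.assoc)
    also have "\<tau> \<dots> = v * ((\<Sum>i<Suc n. \<tau> (s ^ i) * \<tau> (s ^ (n - i) * q)) + \<delta> (s ^ Suc n) 1)"
      using mult.IH[of "Suc n"] by simp
    also have "(\<Sum>i<Suc n. \<tau> (s ^ i) * \<tau> (s ^ (n - i) * q)) =
       (\<Sum>i<n. \<tau> (s ^ i) * \<tau> (s ^ (n - 1 - i) * (s * q))) + \<tau> (s ^ n) * \<tau> q"
    proof -
      have "s ^ (n - i) * q = s ^ (n - 1 - i) * (s * q)" if "i < n" for i
      proof -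
        have "n - i = Suc (n - 1 - i)" using that by simp
        then show ?thesis by (simp only: power_Suc2 mult.assoc)
      qed
      then show ?thesis by simp
    qed
    finally show ?case by (simp add: power_commutes add.assoc)
  next
    case (add q \<delta> q' \<delta>')
    then show ?case by (simp add: distrib_left ncps_add sum.distrib algebra_simps)
  next
    case (scale q \<delta> c)
    then show ?case by (simp add: scaleC scaleC_mult_right sum_distrib_left algebra_simps)
  qed
  from this[of 0] show ?thesis by simp
qed

definition alternating :: "bool list \<Rightarrow> 'a list \<Rightarrow> bool" where
  "alternating ks as \<longleftrightarrow> distinct_adj ks \<and> list_all2 (\<lambda>k a. a \<in> algebra_of k \<and> \<tau> a = 0) ks as"

lemma alternating_tau_zero:
  assumes "alternating ks as" "ks \<noteq> []"
  shows "\<tau> (prod_list as) = 0"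
proof -
  have "length as = length ks \<and> set ks \<subseteq> UNIV \<and> distinct_adj ks \<and>
    (\<forall>j<length ks. as ! j \<in> algebra_of (ks ! j) \<and> \<tau> (as ! j) = 0)"
    using assms(1) unfolding alternating_def list_all2_conv_all_nth by auto
  then show ?thesis
    using free assms(2) unfolding freely_independent_def free_subalgebras_def by blast
qed

text \<open>The centered part of \<open>b\<close> lengthens the alternating product, and its scalar
  part leaves the old one; freeness kills both.\<close>

lemma alternating_Cons:
  assumes "alternating (k # ks) as" "b \<in> algebra_of (\<not> k)"
  shows "\<tau> (b * prod_list as) = 0"
proof -
  have "alternating ((\<not> k) # k # ks) (centered b # as)"
    using assms centered_in_subalgebra[OF assms(2)] by (auto simp: alternating_def tau_centered)
  then have "\<tau> (centered b * prod_list as) = 0" using alternating_tau_zero by fastforce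
  then show ?thesis using alternating_tau_zero[OF assms(1)] by (simp add: centered_mult ncps_add scaleC)
qed

lemma alternating_snoc:
  assumes "alternating ks as" "ks \<noteq> []" "distinct_adj (ks @ [k])" "b \<in> algebra_of k"
  shows "\<tau> (prod_list as * b) = 0"
proof -
  have "alternating (ks @ [k]) (as @ [centered b])"
    using assms centered_in_subalgebra[OF assms(4)]
    by (auto simp: alternating_def tau_centered list_all2_appendI)
  from alternating_tau_zero[OF this] have "\<tau> (prod_list as * centered b) = 0" by simp
  then show ?thesis using alternating_tau_zero[OF assms(1,2)] by (simp add: mult_centered ncps_add scaleC)
qed

text \<open>\<open>alt_prod k m W \<theta>\<close>: \<open>W\<close> is a product of \<open>m\<close> centered factors taken alternately from the two algebras,
  the first one from \<open>algebra_of k\<close>, and \<open>\<theta> d\<close> is \<open>\<tau> \<otimes> \<tau>\<close> applied to \<open>d (\<partial>W)\<close>.\<close>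

inductive alt_prod :: "bool \<Rightarrow> nat \<Rightarrow> 'a \<Rightarrow> ('a \<Rightarrow> complex) \<Rightarrow> bool" where
  nil: "alt_prod k 0 1 (\<lambda>d. 0)"
| x: "a \<in> algebra_of True \<Longrightarrow> \<tau> a = 0 \<Longrightarrow> alt_prod False m W \<theta> \<Longrightarrow>
      alt_prod True (Suc m) (a * W) (\<lambda>d. \<theta> (d * a))"
| s: "free_diff q \<delta> \<Longrightarrow> \<tau> q = 0 \<Longrightarrow> alt_prod True m W \<theta> \<Longrightarrow>
      alt_prod False (Suc m) (q * W) (\<lambda>d. \<delta> d W + \<theta> (d * q))"

lemma alt_prod_list:
  assumes "alt_prod k m W \<theta>"
  obtains ks as where "alternating ks as" "prod_list as = W" "length ks = m" "m > 0 \<Longrightarrow> hd ks = k"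
  using assms
proof (induction arbitrary: thesis rule: alt_prod.induct)
  case (nil k)
  then show ?case by (auto simp: alternating_def)
next
  case (x a m W \<theta>)
  obtain ks as where *: "alternating ks as" "prod_list as = W" "length ks = m" "m > 0 \<Longrightarrow> hd ks = False"
    using x.IH by blast
  have "alternating (True # ks) (a # as)"
    using * x.hyps by (cases ks) (auto simp: alternating_def)
  then show ?case using x.prems[of "True # ks" "a # as"] * by simp
next
  case (s q \<delta> m W \<theta>)
  obtain ks as where *: "alternating ks as" "prod_list as = W" "length ks = m" "m > 0 \<Longrightarrow> hd ks = True"
    using s.IH by blast
  have "alternating (False # ks) (q # as)"
    using * s.hyps free_diff_in_algebra[OF s.hyps(1)] by (cases ks) (auto simp: alternating_def)
  then show ?case using s.prems[of "False # ks" "q # as"] * by simp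
qed

lemma alt_prod_left_mult_zero:
  assumes "alt_prod k m W \<theta>" "m > 0" "b \<in> algebra_of (\<not> k)"
  shows "\<tau> (b * W) = 0"
proof -
  obtain ks as where *: "alternating ks as" "prod_list as = W" "length ks = m" "hd ks = k"
    using alt_prod_list[OF assms(1)] assms(2) by metis
  then obtain ks' where "ks = k # ks'" using assms(2) by (cases ks) auto
  then show ?thesis using alternating_Cons[of k ks' as b] * assms(3) by simp
qed

lemma alt_prod_linear:
  assumes "alt_prod k m W \<theta>"
  shows "\<theta> (a + b) = \<theta> a + \<theta> b" "\<theta> (c *\<^sub>C a) = c * \<theta> a"
proof -
  show "\<theta> (a + b) = \<theta> a + \<theta> b"
    using assms by (induction arbitrary: a b rule: alt_prod.induct)
      (simp_all add: distrib_right free_diff_linear(1))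
  show "\<theta> (c *\<^sub>C a) = c * \<theta> a"
    using assms by (induction arbitrary: a rule: alt_prod.induct)
      (simp_all add: scaleC_mult_left free_diff_linear(2) distrib_left)
qed

text \<open>Each term of \<open>\<theta>\<close> cuts the word inside a factor from the algebra of
  \<open>s\<close>, giving the trace of a left part times the trace of a right part. One of the two
  is an alternating product with at most one uncentered factor at its end, hence zero. The excluded
  case is a single factor from that algebra with nothing around it.\<close>

lemma alt_prod_prefix_zero:
  assumes "alt_prod k m W \<theta>" "alternating ks as" "distinct_adj (ks @ [k])" "ks \<noteq> [] \<or> k \<or> m \<noteq> 1"
  shows "\<theta> (prod_list as) = 0"
  using assms
proof (induction arbitrary: ks as rule: alt_prod.induct)
  case (nil k)
  show ?case by simp
next
  case (x a m W \<theta>)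
  have "alternating (ks @ [True]) (as @ [a])"
    using x.prems x.hyps by (auto simp: alternating_def list_all2_appendI)
  moreover have "distinct_adj ((ks @ [True]) @ [False])"
    using x.prems(2) by (simp add: distinct_adj_append_iff del: append_assoc)
  ultimately have "\<theta> (prod_list (as @ [a])) = 0" by (intro x.IH) blast+
  then show ?case by simp
next
  case (s q \<delta> m W \<theta>)
  have "alternating (ks @ [False]) (as @ [q])"
    using s.prems s.hyps free_diff_in_algebra[OF s.hyps(1)] by (auto simp: alternating_def list_all2_appendI)
  moreover have "distinct_adj ((ks @ [False]) @ [True])"
    using s.prems(2) by (simp add: distinct_adj_append_iff del: append_assoc)
  ultimately have "\<theta> (prod_list (as @ [q])) = 0" by (intro s.IH) blast+
  moreover have "\<delta> (prod_list as) W = 0"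
  proof (cases "m = 0")
    case True
    then have "W = 1" using s.hyps(3) by (auto elim: alt_prod.cases)
    moreover have "ks \<noteq> []" using s.prems(3) True by simp
    ultimately show ?thesis
      using free_diff_left_zero[OF s.hyps(1)] alternating_snoc[OF s.prems(1) _ s.prems(2)] by blast
  next
    case False
    then show ?thesis
      using free_diff_right_zero[OF s.hyps(1)] alt_prod_left_mult_zero[OF s.hyps(3)] by auto
  qed
  ultimately show ?case by simp
qed

text \<open>Both sides vanish unless \<open>W\<close> is a single factor from the algebra of
  \<open>s\<close>, and then the equation is the one-variable case.\<close>

lemma schwinger_dyson_alt_prod:
  assumes "alt_prod k m W \<theta>"
  shows "\<tau> (s * W) = v * \<theta> 1"
proof -
  have s: "s \<in> algebra_of False" by (auto intro: unital_subalgebra.gen)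
  have nil: "alternating [] []" "distinct_adj ([] @ [k])" for k by (auto simp: alternating_def)
  have ts: "\<tau> s = 0" using schwinger_dyson_semicircular[OF free_diff.one] by simp
  from assms show ?thesis
  proof cases
    case nil
    then show ?thesis using ts by simp
  next
    case (x a m' W' \<theta>')
    then show ?thesis
      using alt_prod_prefix_zero[OF assms nil(1) nil(2)] alt_prod_left_mult_zero[OF assms, of s] s by simp
  next
    case (s q \<delta> m' W' \<theta>')
    show ?thesis
    proof (cases "m' = 0")
      case True
      then have "W' = 1" "\<theta>' = (\<lambda>d. 0)" using s(7) by (auto elim: alt_prod.cases)
      then show ?thesis using schwinger_dyson_semicircular[OF s(5)] s by simp
    next
      case False
      have "s * q \<in> algebra_of False"
        using \<open>s \<in> algebra_of False\<close> free_diff_in_algebra[OF s(5)] by (rule unital_subalgebra.mult)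
      then have "\<tau> (s * q * W') = 0" using alt_prod_left_mult_zero[OF s(7)] False by simp
      moreover have "\<theta> 1 = 0" using alt_prod_prefix_zero[OF assms nil(1) nil(2)] s(2) False by simp
      ultimately show ?thesis using s by (simp add: mult.assoc)
    qed
  qed
qed

text \<open>The pairs \<open>(W, \<theta>)\<close> spanned by alternating products; they turn out to include all words in \<open>x\<close> and \<open>s\<close>.\<close>

inductive sd_pair :: "'a \<Rightarrow> ('a \<Rightarrow> complex) \<Rightarrow> bool" where
  alt: "alt_prod k m W \<theta> \<Longrightarrow> sd_pair W \<theta>"
| add: "sd_pair W \<theta> \<Longrightarrow> sd_pair W' \<theta>' \<Longrightarrow> sd_pair (W + W') (\<lambda>d. \<theta> d + \<theta>' d)"
| scale: "sd_pair W \<theta> \<Longrightarrow> sd_pair (c *\<^sub>C W) (\<lambda>d. c * \<theta> d)"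

lemma sd_pair_cong: "sd_pair W \<theta> \<Longrightarrow> W = W' \<Longrightarrow> (\<And>d. \<theta> d = \<theta>' d) \<Longrightarrow> sd_pair W' \<theta>'"
  by (metis ext)

lemma sd_pair_linear:
  assumes "sd_pair W \<theta>"
  shows "\<theta> (a + b) = \<theta> a + \<theta> b" "\<theta> (c *\<^sub>C a) = c * \<theta> a"
proof -
  show "\<theta> (a + b) = \<theta> a + \<theta> b"
    using assms by (induction rule: sd_pair.induct) (simp_all add: alt_prod_linear(1) distrib_left)
  show "\<theta> (c *\<^sub>C a) = c * \<theta> a"
    using assms by (induction rule: sd_pair.induct) (simp_all add: alt_prod_linear(2) distrib_left)
qed

lemma sd_pair_one: "sd_pair 1 (\<lambda>d. 0)"
  by (rule sd_pair.alt[OF alt_prod.nil])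

lemma schwinger_dyson: "sd_pair W \<theta> \<Longrightarrow> \<tau> (s * W) = v * \<theta> 1"
  by (induction rule: sd_pair.induct)
    (simp_all add: schwinger_dyson_alt_prod distrib_left ncps_add scaleC_mult_right scaleC)

lemma sd_pair_x_alt_prod:
  assumes "alt_prod False m W \<theta>" "a \<in> algebra_of True"
  shows "sd_pair (a * W) (\<lambda>d. \<theta> (d * a))"
proof -
  have "sd_pair (centered a * W) (\<lambda>d. \<theta> (d * centered a))"
    by (rule sd_pair.alt[OF alt_prod.x[OF centered_in_subalgebra[OF assms(2)] tau_centered assms(1)]])
  from sd_pair.add[OF this sd_pair.scale[OF sd_pair.alt[OF assms(1)], of "\<tau> a"]]
  show ?thesis
    by (rule sd_pair_cong) (simp_all add: centered_mult mult_centered alt_prod_linear[OF assms(1)] add.assoc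
        flip: scaleC_add_left)
qed

lemma free_diff_centered:
  assumes "free_diff q \<delta>"
  shows "free_diff (centered q) \<delta>"
proof -
  have "free_diff (q + (- \<tau> q) *\<^sub>C 1) (\<lambda>d e. \<delta> d e + (- \<tau> q) * 0)"
    by (intro free_diff.intros assms)
  moreover have "q + (- \<tau> q) *\<^sub>C 1 = centered q" using centered_mult[of q 1] by simp
  ultimately show ?thesis by simp
qed

lemma sd_pair_s_alt_prod:
  assumes "alt_prod True m W \<theta>" "free_diff q \<delta>"
  shows "sd_pair (q * W) (\<lambda>d. \<delta> d W + \<theta> (d * q))"
proof -
  have "sd_pair (centered q * W) (\<lambda>d. \<delta> d W + \<theta> (d * centered q))"
    by (rule sd_pair.alt[OF alt_prod.s[OF free_diff_centered[OF assms(2)] tau_centered assms(1)]])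
  from sd_pair.add[OF this sd_pair.scale[OF sd_pair.alt[OF assms(1)], of "\<tau> q"]]
  show ?thesis
    by (rule sd_pair_cong) (simp_all add: centered_mult mult_centered alt_prod_linear[OF assms(1)] add.assoc
        flip: scaleC_add_left)
qed

lemma alt_prod_first:
  assumes "alt_prod k m W \<theta>"
  shows "(k \<longleftrightarrow> k') \<and> m > 0 \<or> alt_prod (\<not> k') m W \<theta>"
  using assms by (cases "k = k'"; cases m) (auto elim: alt_prod.cases intro: alt_prod.nil)

text \<open>If the word begins with a factor from the algebra of \<open>x\<close>, the letter is
  merged into it and the product is centered again; otherwise it starts a new factor.\<close>

lemma sd_pair_mult_x: "sd_pair W \<theta> \<Longrightarrow> sd_pair (x * W) (\<lambda>d. \<theta> (d * x))"
proof (induction rule: sd_pair.induct)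
  case (alt k m W \<theta>)
  have x: "x \<in> algebra_of True" by (auto intro: unital_subalgebra.gen)
  show ?case
  proof (cases "k \<and> m > 0")
    case False
    then have "alt_prod False m W \<theta>" using alt_prod_first[OF alt, of True] by auto
    then show ?thesis using x by (rule sd_pair_x_alt_prod)
  next
    case True
    from alt True show ?thesis
    proof cases
      case (x a m' W' \<theta>')
      have "x * a \<in> algebra_of True" using \<open>x \<in> algebra_of True\<close> x(5) by (rule unital_subalgebra.mult)
      from sd_pair_x_alt_prod[OF x(7) this] show ?thesis
        unfolding x(3) by (rule sd_pair_cong) (simp_all add: x mult.assoc)
    qed auto
  qed
next
  case (add W \<theta> W' \<theta>')
  from sd_pair.add[OF add.IH] show ?case by (simp add: distrib_left)
next
  case (scale W \<theta> c)
  from sd_pair.scale[OF scale.IH, of c] show ?case by (simp add: scaleC_mult_right)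
qed

text \<open>The additional term is the contribution \<open>1 \<otimes> W\<close> of the new letter
  to the difference quotient; when \<open>s\<close> is merged into a first factor,
  \<open>free_diff.mult\<close> supplies it.\<close>

lemma sd_pair_mult_s: "sd_pair W \<theta> \<Longrightarrow> sd_pair (s * W) (\<lambda>d. \<tau> d * \<tau> W + \<theta> (d * s))"
proof (induction rule: sd_pair.induct)
  case (alt k m W \<theta>)
  have "free_diff (s * 1) (\<lambda>d e. \<tau> d * \<tau> (1 * e) + 0)" by (intro free_diff.intros)
  then have s1: "free_diff s (\<lambda>d e. \<tau> d * \<tau> e)" by simp
  show ?case
  proof (cases "\<not> k \<and> m > 0")
    case False
    then have "alt_prod True m W \<theta>" using alt_prod_first[OF alt, of False] by auto
    then show ?thesis using s1 by (rule sd_pair_s_alt_prod)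
  next
    case True
    from alt True show ?thesis
    proof cases
      case (s q \<delta> m' W' \<theta>')
      from sd_pair_s_alt_prod[OF s(7) free_diff.mult[OF s(5)]] show ?thesis
        by (rule sd_pair_cong) (simp_all add: s mult.assoc add.assoc)
    qed auto
  qed
next
  case (add W \<theta> W' \<theta>')
  from sd_pair.add[OF add.IH] show ?case
    by (rule sd_pair_cong) (simp_all add: distrib_left ncps_add add_ac)
next
  case (scale W \<theta> c)
  from sd_pair.scale[OF scale.IH, of c] show ?case
    by (rule sd_pair_cong) (simp_all add: scaleC_mult_right scaleC distrib_left)
qed

end

section \<open>Positivity and contractivity of the trace\<close>

lemma scaleC_minus_right: "c *\<^sub>C (- a :: 'a::unital_cstar_algebra) = - (c *\<^sub>C a)"
  using scaleC_scaleC[of c "-1" a] scaleC_scaleC[of "-1" c a] by (simp add: scaleC_minus_one)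

lemma scaleC_minus_left: "(- c) *\<^sub>C (a :: 'a::unital_cstar_algebra) = - (c *\<^sub>C a)"
  using scaleC_scaleC[of "-1" c a] by (simp add: scaleC_minus_one)

lemma scaleC_diff_right: "c *\<^sub>C (a - b :: 'a::unital_cstar_algebra) = c *\<^sub>C a - c *\<^sub>C b"
  using scaleC_add_right[of c a "- b"] by (simp add: scaleC_minus_right)

lemma star_zero [simp]: "star (0 :: 'a::unital_cstar_algebra) = 0"
  using star_scaleC[of 0 "0::'a"] by simp

lemma star_minus: "star (- a :: 'a::unital_cstar_algebra) = - star a"
  using star_scaleC[of "- 1" a] by (simp add: scaleC_minus_one)

lemma star_diff: "star (a - b :: 'a::unital_cstar_algebra) = star a - star b"
  using star_add[of a "- b"] by (simp add: star_minus)

lemma star_one [simp]: "star (1 :: 'a::unital_cstar_algebra) = 1"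
  using star_mult[of "star (1 :: 'a)" 1] by (simp add: star_star)

lemma star_power: "star (a ^ n :: 'a::unital_cstar_algebra) = star a ^ n"
  by (induction n) (simp_all add: star_mult power_commutes)

lemma star_scaleR: "star (r *\<^sub>R a :: 'a::unital_cstar_algebra) = r *\<^sub>R star a"
  using star_scaleC[of "of_real r" a] by (simp add: scaleC_of_real)

lemma norm_star: "norm (star a :: 'a::unital_cstar_algebra) = norm a"
proof -
  have le: "norm b \<le> norm (star b)" for b :: 'a
  proof (cases "b = 0")
    case False
    have "norm b * norm b \<le> norm (star b) * norm b"
      using cstar_identity[of b] norm_mult_ineq[of "star b" b] by (simp add: power2_eq_square)
    then show ?thesis using False by simp
  qed simp
  show ?thesis using le[of a] le[of "star a"] by (simp add: star_star)
qed

text \<open>\<open>e = (h + e\<^sup>2) / 2\<close> is \<open>(1 - e)\<^sup>2 = 1 - h\<close>.\<close>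

lemma selfadjoint_sqrt_one_minus:
  fixes h :: "'a::unital_cstar_algebra"
  assumes h: "star h = h" and norm: "norm h < 1"
  obtains b where "star b = b" "b * b = 1 - h"
proof -
  define r where "r = norm h"
  define S where "S = {e :: 'a. star e = e \<and> norm e \<le> r}"
  define f where "f e = (1 / 2) *\<^sub>R (h + e * e)" for e :: 'a
  have r: "0 \<le> r" "r < 1" using norm by (simp_all add: r_def)
  have "continuous_on UNIV (star :: 'a \<Rightarrow> 'a)"
    unfolding continuous_on_iff dist_norm by (metis norm_star star_diff)
  then have "closed {e :: 'a. star e = e}"
    by (intro closed_Collect_eq) (auto intro: continuous_on_id)
  then have "closed S" unfolding S_def
    by (intro closed_Collect_conj closed_Collect_le) (auto intro!: continuous_intros)
  note comp = complete_eq_closed[THEN iffD2, OF this]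
  have ne: "S \<noteq> {}" using r by (auto simp: S_def intro!: exI[of _ 0])
  have map: "f ` S \<subseteq> S"
  proof
    fix y assume "y \<in> f ` S"
    then obtain e where e: "star e = e" "norm e \<le> r" "y = f e" by (auto simp: S_def)
    have "norm (h + e * e) \<le> r + r * r"
      by (rule norm_triangle_le) (intro add_mono order_trans[OF norm_mult_ineq] mult_mono, use e r in \<open>auto simp: r_def\<close>)
    also have "r * r \<le> r" using r by (simp add: mult_left_le)
    finally have "norm (f e) \<le> r" by (simp add: f_def)
    moreover have "star (f e) = f e" using e h by (simp add: f_def star_scaleR star_add star_mult)
    ultimately show "y \<in> S" using e by (simp add: S_def)
  qed
  have lip: "dist (f d) (f e) \<le> r * dist d e" if "d \<in> S" "e \<in> S" for d e
  proof -
    have de: "norm d \<le> r" "norm e \<le> r" using that by (simp_all add: S_def)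
    have eq: "(h + d * d) - (h + e * e) = d * (d - e) + (d - e) * e" by (simp add: algebra_simps)
    have "f d - f e = (1 / 2) *\<^sub>R (d * (d - e) + (d - e) * e)"
      unfolding f_def eq[symmetric] scaleR_diff_right ..
    moreover have "norm (d * (d - e) + (d - e) * e) \<le> r * norm (d - e) + norm (d - e) * r"
    proof (rule norm_triangle_le, rule add_mono)
      show "norm (d * (d - e)) \<le> r * norm (d - e)"
        using norm_mult_ineq[of d "d - e"] mult_right_mono[OF de(1) norm_ge_zero[of "d - e"]] by linarith
      show "norm ((d - e) * e) \<le> norm (d - e) * r"
        using norm_mult_ineq[of "d - e" e] mult_left_mono[OF de(2) norm_ge_zero[of "d - e"]] by linarith
    qed
    ultimately show ?thesis by (simp add: dist_norm mult.commute)
  qed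
  obtain e where e: "e \<in> S" "f e = e"
    using Banach_fix[OF comp ne r map lip] by blast
  have "h + e * e = 2 *\<^sub>R f e" by (simp add: f_def)
  then have "h + e * e = e + e" using e(2) by (simp add: scaleR_2)
  then have "(1 - e) * (1 - e) = 1 - h" by (simp add: algebra_simps)
  moreover have "star (1 - e) = 1 - e" using e(1) by (simp add: S_def star_diff)
  ultimately show thesis using that by blast
qed

context ncps begin

text \<open>The square root writes \<open>1 - h\<close> as \<open>star b * b\<close>, on which
  \<open>\<tau>\<close> is nonnegative.\<close>

lemma tau_selfadjoint_le:
  assumes h: "star h = h" and "norm h < 1"
  shows "\<tau> h \<in> \<real> \<and> Re (\<tau> h) \<le> 1"
proof -
  obtain b where b: "star b = b" "b * b = 1 - h" by (rule selfadjoint_sqrt_one_minus[OF assms])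
  have "1 - \<tau> h \<in> \<real>\<^sub>\<ge>\<^sub>0" using positive[of b] b by (simp add: tau_diff unit)
  then show ?thesis by (auto simp: nonneg_Reals_def complex_is_Real_iff elim!: Reals_cases) (auto simp: complex_eq_iff)
qed

text \<open>Rescaling by any \<open>c > norm h\<close> reduces to the previous bound, and
  \<open>c\<close> is then lowered to the norm.\<close>

lemma tau_selfadjoint_bound:
  assumes h: "star h = h"
  shows "\<tau> h \<in> \<real>" "\<bar>Re (\<tau> h)\<bar> \<le> norm h"
proof -
  have *: "\<tau> h \<in> \<real> \<and> Re (\<tau> h) \<le> c" if c: "c > norm h" and h: "star h = h" for c and h :: 'a
  proof -
    have c0: "c > 0" using c norm_ge_zero[of h] by linarith
    have "\<tau> ((1 / c) *\<^sub>R h) \<in> \<real> \<and> Re (\<tau> ((1 / c) *\<^sub>R h)) \<le> 1"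
      by (rule tau_selfadjoint_le) (use c c0 h in \<open>simp_all add: star_scaleR divide_less_eq\<close>)
    moreover have "\<tau> ((1 / c) *\<^sub>R h) = of_real (1 / c) * \<tau> h"
      using scaleC[of "of_real (1 / c)" h] unfolding scaleC_of_real .
    ultimately show ?thesis using c0 by (simp add: complex_is_Real_iff field_simps)
  qed
  show "\<tau> h \<in> \<real>" using *[of h "norm h + 1"] h by simp
  have "Re (\<tau> h) \<le> norm h" by (rule dense_ge) (use * h in blast)
  moreover have "Re (\<tau> (- h)) \<le> norm (- h)" by (rule dense_ge) (use *[of "- h"] h in \<open>simp add: star_minus\<close>)
  ultimately show "\<bar>Re (\<tau> h)\<bar> \<le> norm h" by (simp add: tau_minus)
qed

lemma tau_star: "\<tau> (star a) = cnj (\<tau> a)"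
proof -
  have "\<tau> (a + star a) \<in> \<real>"
    by (rule tau_selfadjoint_bound) (simp add: star_add star_star add.commute)
  moreover have "\<tau> (\<i> *\<^sub>C (a - star a)) \<in> \<real>"
    by (rule tau_selfadjoint_bound) (simp add: star_scaleC star_diff star_star scaleC_minus_left scaleC_diff_right)
  ultimately show ?thesis
    by (simp add: ncps_add scaleC tau_diff complex_is_Real_iff complex_eq_iff)
qed

text \<open>Positivity at \<open>a\<close> minus its mean bounds the squared modulus of
  \<open>\<tau> a\<close> by \<open>\<tau> (star a * a)\<close>; the norm identity of the algebra
  does the rest.\<close>

lemma tau_norm_le: "norm (\<tau> a) \<le> norm a"
proof -
  define c where "c = \<tau> a"
  have "star (a - c *\<^sub>C 1) * (a - c *\<^sub>C 1) = star a * a - c *\<^sub>C star a - cnj c *\<^sub>C a + (cnj c * c) *\<^sub>C 1"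
    by (simp add: star_diff star_scaleC left_diff_distrib right_diff_distrib scaleC_mult_left scaleC_mult_right scaleC_scaleC scaleC_diff_right mult.commute)
  then have "\<tau> (star (a - c *\<^sub>C 1) * (a - c *\<^sub>C 1)) = \<tau> (star a * a) - c * cnj c - cnj c * c + cnj c * c"
    by (simp add: ncps_add tau_diff scaleC tau_star unit c_def[symmetric])
  then have "\<tau> (star a * a) - c * cnj c \<in> \<real>\<^sub>\<ge>\<^sub>0"
    using positive[of "a - c *\<^sub>C 1"] by simp
  then have "(norm c)\<^sup>2 \<le> Re (\<tau> (star a * a))"
    unfolding complex_norm_square[symmetric] complex_nonneg_Reals_iff by simp
  also have "\<dots> \<le> norm (star a * a)"
    using tau_selfadjoint_bound(2)[of "star a * a"] by (simp add: star_mult star_star)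
  also have "\<dots> = (norm a)\<^sup>2" by (rule cstar_identity)
  finally show ?thesis unfolding c_def by (rule power2_le_imp_le) simp
qed

end

section \<open>Mixed moments of \<open>y\<close> and \<open>x\<close>\<close>

context semicircular_pair begin

definition y :: 'a where "y = x + \<i> *\<^sub>C commutator x s"

definition t :: "nat \<Rightarrow> nat \<Rightarrow> complex" where "t n j = \<tau> (y ^ n * x ^ j)"

lemma y_mult: "y * W = x * W + \<i> *\<^sub>C (x * (s * W)) + (- \<i>) *\<^sub>C (s * (x * W))"
proof -
  have "(- \<i>) *\<^sub>C (s * (x * W)) = - (\<i> *\<^sub>C (s * (x * W)))"
    using scaleC_scaleC[of "-1" \<i> "s * (x * W)"] by (simp add: scaleC_minus_one)
  moreover have "\<i> *\<^sub>C (x * (s * W) - s * (x * W)) = \<i> *\<^sub>C (x * (s * W)) - \<i> *\<^sub>C (s * (x * W))"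
    unfolding diff_eq_add_scaleC scaleC_add_right scaleC_scaleC by (simp add: mult.commute)
  ultimately show ?thesis
    by (simp add: y_def commutator_def distrib_right left_diff_distrib scaleC_mult_left mult.assoc)
qed

lemma mult_y: "W * y = W * x + \<i> *\<^sub>C (W * x * s) + (- \<i>) *\<^sub>C (W * s * x)"
proof -
  have "(- \<i>) *\<^sub>C (W * s * x) = - (\<i> *\<^sub>C (W * s * x))"
    using scaleC_scaleC[of "-1" \<i> "W * s * x"] by (simp add: scaleC_minus_one)
  moreover have "\<i> *\<^sub>C (W * x * s - W * s * x) = \<i> *\<^sub>C (W * x * s) - \<i> *\<^sub>C (W * s * x)"
    unfolding diff_eq_add_scaleC scaleC_add_right scaleC_scaleC by (simp add: mult.commute)
  ultimately show ?thesis
    by (simp add: y_def commutator_def distrib_left right_diff_distrib scaleC_mult_right mult.assoc)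
qed

text \<open>The difference quotient of \<open>y\<close> is
  \<open>\<i> (x \<otimes> 1 - 1 \<otimes> x)\<close>, because that of \<open>x * s\<close> is
  \<open>x \<otimes> 1\<close> and that of \<open>s * x\<close> is
  \<open>1 \<otimes> x\<close>.\<close>

lemma sd_pair_mult_y:
  assumes "sd_pair W \<theta>"
  shows "sd_pair (y * W) (\<lambda>d. \<theta> (d * y) + \<i> * (\<tau> (d * x) * \<tau> W - \<tau> d * \<tau> (x * W)))"
proof -
  have "sd_pair (x * W + \<i> *\<^sub>C (x * (s * W)) + (- \<i>) *\<^sub>C (s * (x * W)))
    (\<lambda>d. \<theta> (d * x) + \<i> * (\<tau> (d * x) * \<tau> W + \<theta> (d * x * s)) + (- \<i>) * (\<tau> d * \<tau> (x * W) + \<theta> (d * s * x)))"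
    by (intro sd_pair.add sd_pair.scale sd_pair_mult_x[OF sd_pair_mult_s[OF assms]] sd_pair_mult_x[OF assms]
        sd_pair_mult_s[OF sd_pair_mult_x[OF assms]])
  then show ?thesis
    by (rule sd_pair_cong) (simp_all add: y_mult mult_y sd_pair_linear[OF assms] algebra_simps)
qed

text \<open>The k-th term differentiates the letter \<open>y\<close> that has k others in front of
  it.\<close>

lemma sd_pair_y_power:
  "sd_pair (y ^ n * x ^ j) (\<lambda>d. \<i> * (\<Sum>k<n. \<tau> (d * y ^ k * x) * t (n - 1 - k) j - \<tau> (d * y ^ k) * t (n - 1 - k) (Suc j)))"
proof (induction n)
  case 0
  have "sd_pair (x ^ j) (\<lambda>d. 0)"
    by (induction j) (use sd_pair_one sd_pair_mult_x in force)+
  then show ?case by simp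
next
  case (Suc n)
  have t1: "\<tau> (x * (y ^ n * x ^ j)) = t n (Suc j)"
    unfolding t_def by (subst tracial) (simp add: mult.assoc power_commutes)
  show ?case
  proof (rule sd_pair_cong[OF sd_pair_mult_y[OF Suc]])
    show "y * (y ^ n * x ^ j) = y ^ Suc n * x ^ j" by (simp add: mult.assoc)
    fix d
    have "(\<Sum>k<Suc n. \<tau> (d * y ^ k * x) * t (Suc n - 1 - k) j - \<tau> (d * y ^ k) * t (Suc n - 1 - k) (Suc j)) =
      (\<tau> (d * x) * t n j - \<tau> d * t n (Suc j)) +
      (\<Sum>k<n. \<tau> (d * y * y ^ k * x) * t (n - 1 - k) j - \<tau> (d * y * y ^ k) * t (n - 1 - k) (Suc j))"
      by (subst sum.lessThan_Suc_shift) (simp add: mult.assoc)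
    then show "\<i> * (\<Sum>k<n. \<tau> (d * y * y ^ k * x) * t (n - 1 - k) j - \<tau> (d * y * y ^ k) * t (n - 1 - k) (Suc j)) +
         \<i> * (\<tau> (d * x) * \<tau> (y ^ n * x ^ j) - \<tau> d * \<tau> (x * (y ^ n * x ^ j))) =
         \<i> * (\<Sum>k<Suc n. \<tau> (d * y ^ k * x) * t (Suc n - 1 - k) j - \<tau> (d * y ^ k) * t (Suc n - 1 - k) (Suc j))"
      unfolding t1 by (simp only: t_def[of n j] distrib_left add.commute)
  qed
qed

text \<open>One factor \<open>y\<close> is expanded and the Schwinger-Dyson equation is applied to
  the two words containing \<open>s\<close>, the first after moving \<open>x\<close> cyclically to
  the end. Traciality brings every remaining trace to the form \<open>t n j\<close>, so the system
  closes; the signs come from \<open>\<i> * \<i>\<close>.\<close>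

lemma moment_recursion:
  "t (Suc n) j = t n (Suc j)
     - v * (\<Sum>k<n. t k 1 * t (n - 1 - k) (Suc j) - t k 0 * t (n - 1 - k) (Suc (Suc j)))
     + v * (\<Sum>k<n. t k 2 * t (n - 1 - k) j - t k 1 * t (n - 1 - k) (Suc j))"
proof -
  define W where "W = y ^ n * x ^ j"
  have "\<tau> (x * W) = t n (Suc j)"
    unfolding t_def W_def by (subst tracial) (simp add: mult.assoc power_commutes)
  moreover have "\<tau> (x * (s * W)) = v * (\<i> * (\<Sum>k<n. t k 1 * t (n - 1 - k) (Suc j) - t k 0 * t (n - 1 - k) (Suc (Suc j))))"
  proof -
    have "\<tau> (x * (s * W)) = \<tau> (s * (y ^ n * x ^ Suc j))"
      unfolding W_def by (subst tracial) (simp add: mult.assoc power_commutes)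
    then show ?thesis using schwinger_dyson[OF sd_pair_y_power[of n "Suc j"]] by (simp add: t_def)
  qed
  moreover have "\<tau> (s * (x * W)) = v * (\<i> * (\<Sum>k<n. t k 2 * t (n - 1 - k) j - t k 1 * t (n - 1 - k) (Suc j)))"
  proof -
    have t2: "\<tau> (x * y ^ k * x) = t k 2" "\<tau> (x * y ^ k) = t k 1" for k
      unfolding t_def using tracial[of x "y ^ k * x"] tracial[of x "y ^ k"]
      by (simp_all add: mult.assoc power2_eq_square)
    show ?thesis unfolding W_def schwinger_dyson[OF sd_pair_mult_x[OF sd_pair_y_power[of n j]]] by (simp add: t2)
  qed
  ultimately show ?thesis
    unfolding t_def[of "Suc n"] power_Suc mult.assoc W_def[symmetric] y_mult[of W] ncps_add scaleC
    by (simp add: algebra_simps)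
qed

lemma t_bound: "norm (t n j) \<le> norm y ^ n * norm x ^ j"
proof -
  have "norm (t n j) \<le> norm (y ^ n * x ^ j)" unfolding t_def by (rule tau_norm_le)
  also have "\<dots> \<le> norm (y ^ n) * norm (x ^ j)" by (rule norm_mult_ineq)
  also have "\<dots> \<le> norm y ^ n * norm x ^ j" by (intro mult_mono norm_power_ineq) auto
  finally show ?thesis .
qed

end

section \<open>The moment series of \<open>x + i[x,s]\<close>\<close>

text \<open>From here on only numbers remain. The bound is geometric in both indices: the one in
  \<open>n\<close> makes the series converge, the one in \<open>j\<close> singles out their solution
  of a recursion in \<open>j\<close>.\<close>

locale commutator_series =
  fixes t :: "nat \<Rightarrow> nat \<Rightarrow> complex" and v :: complex and X Y B :: real and \<mu> :: "real measure"
  assumes recursion: "\<And>n j. t (Suc n) j = t n (Suc j)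
     - v * (\<Sum>k<n. t k 1 * t (n - 1 - k) (Suc j) - t k 0 * t (n - 1 - k) (Suc (Suc j)))
     + v * (\<Sum>k<n. t k 2 * t (n - 1 - k) j - t k 1 * t (n - 1 - k) (Suc j))"
    and bound: "\<And>n j. norm (t n j) \<le> Y ^ n * X ^ j" and Y: "Y > 0" and X: "X \<ge> 0"
    and \<mu>: "compact_distribution B \<mu>"
    and init: "\<And>j. t 0 j = complex_of_real (LINT u|\<mu>. u ^ j)"
begin

definition S :: "nat \<Rightarrow> complex \<Rightarrow> complex" where "S j z = (\<Sum>n. t n j * z ^ n)"

lemma summable_S: "norm z * Y < 1 \<Longrightarrow> summable (\<lambda>n. norm (t n j * z ^ n))"
proof (rule summable_comparison_test')
  assume "norm z * Y < 1"
  then show "summable (\<lambda>n. X ^ j * (norm z * Y) ^ n)"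
    using Y by (intro summable_mult summable_geometric) auto
  show "norm (norm (t n j * z ^ n)) \<le> X ^ j * (norm z * Y) ^ n" for n
    using mult_right_mono[OF bound[of n j], of "norm z ^ n"]
    by (simp add: norm_mult norm_power power_mult_distrib mult_ac)
qed

lemma sums_S: "norm z * Y < 1 \<Longrightarrow> (\<lambda>n. t n j * z ^ n) sums S j z"
  unfolding S_def by (rule summable_sums[OF summable_norm_cancel[OF summable_S]])

lemma S_holomorphic: "S j holomorphic_on ball 0 (1 / Y)"
  by (rule power_series_holomorphic[where a = "\<lambda>n. t n j"]) (use sums_S Y in \<open>auto simp: field_simps\<close>)

lemma S_zero: "S j 0 = t 0 j"
  unfolding S_def by simp

lemma S_isCont: "isCont (S j) 0"
  using S_holomorphic[of j] Y by (auto dest!: holomorphic_on_imp_continuous_on simp: continuous_on_eq_continuous_at)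

lemma S_bound:
  assumes "norm z * Y \<le> 1 / 2"
  shows "norm (S j z) \<le> 2 * X ^ j"
proof -
  have "norm (S j z) \<le> X ^ j * (1 / (1 - norm z * Y))"
  proof (rule norm_sums_le[OF sums_S])
    show "norm z * Y < 1" using assms by simp
    show "(\<lambda>n. X ^ j * (norm z * Y) ^ n) sums (X ^ j * (1 / (1 - norm z * Y)))"
      using assms Y by (intro sums_mult geometric_sums) auto
    show "norm (t n j * z ^ n) \<le> X ^ j * (norm z * Y) ^ n" for n
      using mult_right_mono[OF bound[of n j], of "norm z ^ n"]
      by (simp add: norm_mult norm_power power_mult_distrib mult_ac)
  qed
  also have "\<dots> \<le> X ^ j * 2"
    using assms X by (intro mult_left_mono) (auto simp: field_simps)
  finally show ?thesis by simp
qed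

lemma S_product:
  assumes "norm z * Y < 1"
  shows "(\<lambda>n. (\<Sum>k\<le>n. t k a * t (n - k) b) * z ^ n) sums (S a z * S b z)"
proof -
  have "(\<lambda>n. \<Sum>k\<le>n. (t k a * z ^ k) * (t (n - k) b * z ^ (n - k))) sums (S a z * S b z)"
    using Cauchy_product_sums[OF summable_S[OF assms] summable_S[OF assms]] by (simp add: S_def)
  moreover have "(\<Sum>k\<le>n. (t k a * z ^ k) * (t (n - k) b * z ^ (n - k))) = (\<Sum>k\<le>n. t k a * t (n - k) b) * z ^ n" for n
    unfolding sum_distrib_right
  proof (intro sum.cong refl)
    fix k assume "k \<in> {..n}"
    then have "z ^ n = z ^ k * z ^ (n - k)" by (simp flip: power_add)
    then show "(t k a * z ^ k) * (t (n - k) b * z ^ (n - k)) = t k a * t (n - k) b * z ^ n" by simp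
  qed
  ultimately show ?thesis by simp
qed

text \<open>The recursion is quadratic, but with \<open>S 0\<close>, \<open>S 1\<close>,
  \<open>S 2\<close> frozen as coefficients it is linear and of second order in
  \<open>j\<close>.\<close>

lemma S_equation:
  assumes z: "norm z * Y < 1"
  shows "(1 - v * z\<^sup>2 * S 2 z) * S j z - (z - 2 * v * z\<^sup>2 * S 1 z) * S (Suc j) z - v * z\<^sup>2 * S 0 z * S (Suc (Suc j)) z = t 0 j"
proof -
  define c where "c a b n = (\<Sum>k\<le>n. t k a * t (n - k) b)" for a b n
  define D where "D n = - v * (c 1 (Suc j) n - c 0 (Suc (Suc j)) n) + v * (c 2 j n - c 1 (Suc j) n)" for n
  define E where "E n = t (Suc n) j - t n (Suc j)" for n
  have E0: "E 0 = 0" using recursion[of 0 j] by (simp add: E_def)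
  have ES: "E (Suc n) = D n" for n
    using recursion[of "Suc n" j] by (simp add: E_def D_def c_def lessThan_Suc_atMost sum_subtractf)
  have "(\<lambda>n. D n * z ^ n) sums (- v * (S 1 z * S (Suc j) z - S 0 z * S (Suc (Suc j)) z) + v * (S 2 z * S j z - S 1 z * S (Suc j) z))"
  proof -
    have "(\<lambda>n. - v * (c 1 (Suc j) n * z ^ n - c 0 (Suc (Suc j)) n * z ^ n) + v * (c 2 j n * z ^ n - c 1 (Suc j) n * z ^ n)) sums
      (- v * (S 1 z * S (Suc j) z - S 0 z * S (Suc (Suc j)) z) + v * (S 2 z * S j z - S 1 z * S (Suc j) z))"
      unfolding c_def by (intro sums_add sums_mult sums_diff S_product z)
    then show ?thesis by (simp add: D_def algebra_simps)
  qed
  from sums_mult[OF this, of z] have "(\<lambda>n. E (Suc n) * z ^ Suc n) sums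
      (z * (- v * (S 1 z * S (Suc j) z - S 0 z * S (Suc (Suc j)) z) + v * (S 2 z * S j z - S 1 z * S (Suc j) z)))"
    by (simp add: ES mult_ac)
  then have "(\<lambda>n. E n * z ^ n) sums
      (z * (- v * (S 1 z * S (Suc j) z - S 0 z * S (Suc (Suc j)) z) + v * (S 2 z * S j z - S 1 z * S (Suc j) z)))"
    by (subst (asm) sums_Suc_iff) (simp add: E0)
  from sums_mult[OF sums_add[OF sums_S[OF z, of "Suc j"] this], of z]
  have "(\<lambda>n. t (Suc n) j * z ^ Suc n) sums (z * (S (Suc j) z +
      z * (- v * (S 1 z * S (Suc j) z - S 0 z * S (Suc (Suc j)) z) + v * (S 2 z * S j z - S 1 z * S (Suc j) z))))"
    by (simp add: E_def algebra_simps)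
  moreover have "(\<lambda>n. t (Suc n) j * z ^ Suc n) sums (S j z - t 0 j)"
    using sums_S[OF z, of j] by (subst sums_Suc_iff) simp
  ultimately have "S j z - t 0 j = z * (S (Suc j) z +
      z * (- v * (S 1 z * S (Suc j) z - S 0 z * S (Suc (Suc j)) z) + v * (S 2 z * S j z - S 1 z * S (Suc j) z)))"
    by (rule sums_unique2[symmetric])
  then have "S j z = t 0 j + z * (S (Suc j) z +
      z * (- v * (S 1 z * S (Suc j) z - S 0 z * S (Suc (Suc j)) z) + v * (S 2 z * S j z - S 1 z * S (Suc j) z)))"
    by (simp add: algebra_simps)
  then show ?thesis by (simp add: power2_eq_square algebra_simps)
qed

definition ca :: "complex \<Rightarrow> complex" where "ca z = 1 - v * z\<^sup>2 * S 2 z"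
definition cc :: "complex \<Rightarrow> complex" where "cc z = z - 2 * v * z\<^sup>2 * S 1 z"
definition ce :: "complex \<Rightarrow> complex" where "ce z = v * z\<^sup>2 * S 0 z"

text \<open>Multiplying out the denominator shows that the integrals solve the same recursion in
  \<open>j\<close>. The difference of the two solutions is homogeneous and grows at most like
  \<open>K ^ j\<close>; as the coefficients of the two later terms are small, each use of the
  equation halves the bound, so the difference is zero.\<close>

lemma S_eq_integral:
  assumes z: "norm z * Y \<le> 1 / 2" and a: "norm (ca z) \<ge> 3 / 4"
    and K: "K \<ge> X" "K \<ge> B" and small: "norm (cc z) * K + norm (ce z) * K\<^sup>2 \<le> 1 / 4"
  shows "S j z = (LINT u|\<mu>. of_real (u ^ j) / (ca z - cc z * of_real u - ce z * (of_real u)\<^sup>2))"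
proof -
  interpret real_distribution \<mu> using \<mu> by (rule compact_distributionD)
  have B: "B > 0" by (rule compact_distributionD(2)[OF \<mu>])
  have K0: "K > 0" using K B by linarith
  define d where "d u = ca z - cc z * of_real u - ce z * (of_real u)\<^sup>2" for u :: real
  have d: "norm (d u) \<ge> 1 / 2" if u: "\<bar>u\<bar> \<le> B" for u
  proof -
    have "norm (cc z * of_real u + ce z * (of_real u)\<^sup>2) \<le> norm (cc z) * K + norm (ce z) * K\<^sup>2"
    proof (rule norm_triangle_le, rule add_mono)
      have uK: "\<bar>u\<bar> \<le> K" using u K by simp
      then show "norm (cc z * of_real u) \<le> norm (cc z) * K"
        unfolding norm_mult norm_of_real by (rule mult_left_mono) simp
      have "\<bar>u\<bar>\<^sup>2 \<le> K\<^sup>2" by (rule power_mono[OF uK]) simp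
      then show "norm (ce z * (of_real u)\<^sup>2) \<le> norm (ce z) * K\<^sup>2"
        unfolding norm_mult norm_power norm_of_real by (rule mult_left_mono) simp
    qed
    moreover have "norm (ca z) - norm (cc z * of_real u + ce z * (of_real u)\<^sup>2) \<le> norm (ca z - (cc z * of_real u + ce z * (of_real u)\<^sup>2))"
      by (rule norm_triangle_ineq2)
    ultimately show ?thesis using a small by (simp add: d_def diff_diff_eq)
  qed
  define J where "J j u = of_real (u ^ j) / d u" for j and u :: real
  define I where "I j = (LINT u|\<mu>. J j u)" for j
  have Jb: "norm (J j u) \<le> 2 * K ^ j" if u: "\<bar>u\<bar> \<le> B" for u j
  proof -
    have "norm (J j u) = \<bar>u\<bar> ^ j / norm (d u)" by (simp add: J_def norm_divide norm_power)
    also have "\<dots> \<le> K ^ j / (1 / 2)" using d[OF u] u K K0 by (intro frac_le power_mono) auto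
    finally show ?thesis by simp
  qed
  have meas: "J j \<in> borel_measurable borel" for j
    unfolding J_def d_def by measurable
  have int: "integrable \<mu> (J j)" for j
    by (rule compact_distribution_integrable[OF \<mu> meas Jb])
  have Ibound: "norm (I j) \<le> 2 * K ^ j" for j
    unfolding I_def by (rule compact_distribution_integral_norm_le[OF \<mu> meas Jb])
  have Ieq: "ca z * I j - cc z * I (Suc j) - ce z * I (Suc (Suc j)) = t 0 j" for j
  proof -
    have "ca z * I j - cc z * I (Suc j) - ce z * I (Suc (Suc j)) =
      (LINT u|\<mu>. ca z * J j u - cc z * J (Suc j) u - ce z * J (Suc (Suc j)) u)"
      unfolding I_def by (simp add: int)
    also have "\<dots> = (LINT u|\<mu>. complex_of_real (u ^ j))"
    proof (rule integral_cong_AE)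
      show "AE u in \<mu>. ca z * J j u - cc z * J (Suc j) u - ce z * J (Suc (Suc j)) u = complex_of_real (u ^ j)"
        using compact_distributionD(3)[OF \<mu>]
      proof eventually_elim
        case (elim u)
        then have "d u \<noteq> 0" using d[OF elim] by auto
        have "J (Suc j) u = of_real u * J j u" "J (Suc (Suc j)) u = (of_real u)\<^sup>2 * J j u"
          by (simp_all add: J_def power2_eq_square)
        then have "ca z * J j u - cc z * J (Suc j) u - ce z * J (Suc (Suc j)) u = d u * J j u"
          by (simp add: d_def algebra_simps)
        then show ?case using \<open>d u \<noteq> 0\<close> by (simp add: J_def)
      qed
    qed (unfold J_def d_def, measurable)
    finally show ?thesis by (simp only: init integral_complex_of_real)
  qed
  define E where "E j = S j z - I j" for j
  have Eeq: "ca z * E j = cc z * E (Suc j) + ce z * E (Suc (Suc j))" for j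
  proof -
    have "ca z * S j z - cc z * S (Suc j) z - ce z * S (Suc (Suc j)) z = t 0 j"
      unfolding ca_def cc_def ce_def by (rule S_equation) (use z in simp)
    then show ?thesis using Ieq[of j] by (simp add: E_def algebra_simps)
  qed
  have Eb: "norm (E j) \<le> 4 * K ^ j * (1 / 2) ^ m" for m j
  proof (induction m arbitrary: j)
    case 0
    have "norm (S j z) \<le> 2 * K ^ j"
      by (rule order_trans[OF S_bound[OF z]]) (use X K in \<open>auto intro: power_mono\<close>)
    then have "norm (E j) \<le> 2 * K ^ j + 2 * K ^ j"
      unfolding E_def using Ibound[of j] norm_triangle_ineq4[of "S j z" "I j"] by linarith
    then show ?case by simp
  next
    case (Suc m)
    define c0 where "c0 = 4 * K ^ j * (1 / 2) ^ m"
    have c0: "c0 \<ge> 0" using K0 by (simp add: c0_def)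
    have "norm (ca z) * norm (E j) = norm (cc z * E (Suc j) + ce z * E (Suc (Suc j)))"
      using Eeq[of j] by (simp flip: norm_mult)
    also have "\<dots> \<le> norm (cc z) * (4 * K ^ Suc j * (1 / 2) ^ m) + norm (ce z) * (4 * K ^ Suc (Suc j) * (1 / 2) ^ m)"
      by (rule norm_triangle_le, rule add_mono) (unfold norm_mult, (rule mult_left_mono[OF Suc.IH norm_ge_zero])+)
    also have "\<dots> = (norm (cc z) * K + norm (ce z) * K\<^sup>2) * c0"
      by (simp add: c0_def power2_eq_square algebra_simps)
    also have "\<dots> \<le> (1 / 4) * c0" using small c0 by (intro mult_right_mono)
    finally have "norm (ca z) * norm (E j) \<le> (1 / 4) * c0" .
    moreover have "(3 / 4) * norm (E j) \<le> norm (ca z) * norm (E j)" using a by (intro mult_right_mono) auto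
    ultimately have "norm (E j) \<le> c0 / 2" using c0 by linarith
    then show ?case by (simp add: c0_def)
  qed
  have "norm (E j) \<le> 0"
  proof (rule LIMSEQ_le_const)
    have "(\<lambda>m. 4 * K ^ j * (1 / 2 :: real) ^ m) \<longlonglongrightarrow> 4 * K ^ j * 0"
      by (intro tendsto_intros LIMSEQ_realpow_zero) auto
    then show "(\<lambda>m. 4 * K ^ j * (1 / 2 :: real) ^ m) \<longlonglongrightarrow> 0" by simp
  qed (use Eb in auto)
  then show ?thesis by (simp add: E_def I_def J_def d_def)
qed

end

text \<open>Here \<open>p\<close> and \<open>r\<close> are the roots of \<open>a - c t - e t\<^sup>2\<close>, and \<open>P\<close>, \<open>Q\<close> the values of the Cauchy transform there;
  the conclusions say that \<open>z S\<^sub>0\<close> and its reciprocal difference to \<open>z\<close> split into contributions of \<open>P\<close> and \<open>Q\<close>.\<close>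

lemma commutator_root_relations:
  fixes z v a c e p r P Q S0 S1 S2 :: complex
  assumes 1: "S0 * e * (p - r) = P - Q" and 2: "S1 * e * (p - r) = p * P - r * Q"
    and 3: "c = - e * (p + r)" and 4: "a = - e * (p * r)"
    and 5: "c = z - 2 * v * z\<^sup>2 * S1" and 6: "e = v * z\<^sup>2 * S0" and 7: "a = 1 - v * z\<^sup>2 * S2"
    and 8: "a * S0 - c * S1 - e * S2 = 1" and ne: "p \<noteq> r"
  shows "P + Q = z * S0" "v * (z * S0)\<^sup>2 * (p - r) = P - Q" "S0 = p * P + r * Q - 1"
proof -
  show "v * (z * S0)\<^sup>2 * (p - r) = P - Q"
    using 1 unfolding 6 by (simp add: power2_eq_square mult_ac)
  have "c * (S0 * (p - r)) = - (p + r) * (S0 * e * (p - r))" unfolding 3 by (simp add: algebra_simps)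
  then have "- (p + r) * (P - Q) = c * (S0 * (p - r))" unfolding 1 by simp
  also have "\<dots> = z * S0 * (p - r) - 2 * (S1 * (v * z\<^sup>2 * S0) * (p - r))"
    unfolding 5 by (simp add: algebra_simps)
  also have "\<dots> = z * S0 * (p - r) - 2 * (p * P - r * Q)"
    unfolding 6[symmetric] 2 ..
  finally have "(p - r) * (P + Q) = (p - r) * (z * S0)" by (simp add: algebra_simps)
  then show "P + Q = z * S0" using ne by simp
  \<comment> \<open>This eliminates \<open>S2\<close> and leaves relation 8 in terms of
    \<open>S0\<close> and \<open>S1\<close>.\<close>
  have "e * S2 = S0 * (v * z\<^sup>2 * S2)" unfolding 6 by simp
  also have "v * z\<^sup>2 * S2 = 1 - a" unfolding 7 by simp
  finally have eS2: "e * S2 = S0 * (1 - a)" .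
  from 8 have "2 * a * S0 - S0 - c * S1 = 1" unfolding eS2 by (simp add: algebra_simps)
  then have "(2 * a * S0 - S0 - c * S1) * (p - r) = p - r" by simp
  moreover have "(2 * a * S0 - S0 - c * S1) * (p - r) =
    - 2 * (p * r) * (S0 * e * (p - r)) - S0 * (p - r) + (p + r) * (S1 * e * (p - r))"
    unfolding 3 4 by (simp add: algebra_simps)
  ultimately have "- 2 * (p * r) * (P - Q) - S0 * (p - r) + (p + r) * (p * P - r * Q) = p - r"
    unfolding 1 2 by simp
  then have "(p - r) * S0 = (p - r) * (p * P + r * Q - 1)" by (simp add: algebra_simps)
  then show "S0 = p * P + r * Q - 1" using ne by simp
qed

text \<open>The divided difference of \<open>R\<close> at \<open>P\<close> and \<open>Q\<close> is
  \<open>\<beta> * J\<close>, and \<open>H\<close> is \<open>g\<close> times it. Subtracting the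
  equations for \<open>p\<close> and \<open>r'\<close> gives the relation between \<open>N\<close>
  and \<open>H\<close>; forming \<open>p * P + r' * Q\<close> gives the expansion of
  \<open>1 / z - 1 / g\<close>.\<close>

lemma levy_commutator_relations:
  fixes v z p r' P Q S0 :: complex
  assumes L: "levy_representation R r T \<beta> \<pi>"
    and rel: "P + Q = z * S0" "v * (z * S0)\<^sup>2 * (p - r') = P - Q" "S0 = p * P + r' * Q - 1"
    and p: "p = 1 / P + R P" and r': "r' = 1 / Q + R Q"
    and PQ: "P \<noteq> 0" "Q \<noteq> 0" "P \<noteq> Q" "norm P < r" "norm Q < r" and z: "z \<noteq> 0" and S0: "S0 \<noteq> 0"
  defines "g \<equiv> z * S0" and "N \<equiv> - (P * Q) / (z * S0)"
  defines "d \<equiv> \<lambda>t. 1 / g - complex_of_real t - N * (of_real t)\<^sup>2"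
  defines "H \<equiv> of_real \<beta> * (LINT t|\<pi>. 1 / d t)"
  shows "d t = (1 - P * of_real t) * (1 - Q * of_real t) / g"
    and "N * (1 / g - v * H) = v"
    and "1 / z - 1 / g = R 0 + of_real \<beta> * (LINT t|\<pi>. (1 + N * of_real t)\<^sup>2 / d t + N) + N * (1 / g) * H"
proof -
  note LD = levy_representationD[OF L]
  have g0: "g \<noteq> 0" using z S0 by (simp add: g_def)
  have gPQ: "g = P + Q" using rel by (simp add: g_def)
  have NPQ: "N * g = - (P * Q)" using g0 by (simp add: N_def g_def)
  show d: "d t = (1 - P * of_real t) * (1 - Q * of_real t) / g" for t
  proof -
    have "g * d t = 1 - g * of_real t - (N * g) * (of_real t)\<^sup>2"
      using g0 by (simp add: d_def right_diff_distrib mult_ac)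
    also have "\<dots> = (1 - P * of_real t) * (1 - Q * of_real t)"
      unfolding NPQ unfolding gPQ by (simp add: power2_eq_square algebra_simps)
    finally show ?thesis using g0 by (simp add: eq_divide_eq mult.commute)
  qed
  define J where "J = (LINT t|\<pi>. 1 / ((1 - P * of_real t) * (1 - Q * of_real t)))"
  have H: "H = g * (of_real \<beta> * J)"
  proof -
    have "1 / d t = g * (1 / ((1 - P * of_real t) * (1 - Q * of_real t)))" for t unfolding d by simp
    then show ?thesis unfolding H_def J_def by (simp only: integral_mult_right_zero) (simp add: mult_ac)
  qed
  have dR: "R P - R Q = (P - Q) * (of_real \<beta> * J)"
    unfolding J_def levy_difference[OF L PQ(4,5)] by (simp add: mult_ac)
  have "p - r' = (Q - P) / (P * Q) + (P - Q) * (of_real \<beta> * J)"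
    unfolding p r' dR[symmetric] using PQ by (simp add: field_simps)
  also have "\<dots> = (P - Q) * (of_real \<beta> * J - 1 / (P * Q))" using PQ by (simp add: field_simps)
  finally have "(P - Q) * (v * g\<^sup>2 * (of_real \<beta> * J - 1 / (P * Q))) = (P - Q) * 1"
    using rel(2) by (simp add: g_def mult_ac)
  then have one: "v * g\<^sup>2 * (of_real \<beta> * J - 1 / (P * Q)) = 1" using PQ(3) unfolding mult_cancel_left by simp
  have "N \<noteq> 0" using PQ g0 by (simp add: N_def g_def[symmetric])
  have "1 / (P * Q) = - 1 / (N * g)" unfolding NPQ by simp
  then have "v * (g * (g * (of_real \<beta> * J)) + g / N) = 1"
  proof -
    have "g * (g * (of_real \<beta> * J)) + g / N = g\<^sup>2 * (of_real \<beta> * J - - 1 / (N * g))"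
      using g0 \<open>N \<noteq> 0\<close> by (simp add: power2_eq_square field_simps)
    then show ?thesis using one unfolding \<open>1 / (P * Q) = - 1 / (N * g)\<close> by (simp only: mult.assoc)
  qed
  then have "v * (g * H + g / N) = 1" unfolding H .
  then have "N * (v * (g * H) + v * g / N) = N" by (simp add: distrib_left)
  then have "N = v * g * (1 + N * H)" using \<open>N \<noteq> 0\<close> by (simp add: algebra_simps)
  then have "N / g = v + v * N * H" using g0 by (simp add: field_simps)
  then show "N * (1 / g - v * H) = v" by (simp add: algebra_simps)
  have int: "integrable \<pi> (\<lambda>t. w / (1 - w * complex_of_real t))" if w: "norm w < r" for w
  proof (rule compact_distribution_integrable[OF LD(4)])
    show "norm (w / (1 - w * complex_of_real t)) \<le> norm w / (1 / 2)" if "\<bar>t\<bar> \<le> T" for t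
      unfolding norm_divide using levy_denominator[OF w LD(3) that] by (intro divide_left_mono) auto
  qed auto
  have intd: "integrable \<pi> (\<lambda>t. 1 / d t)"
  proof -
    have "(\<lambda>t. 1 / d t) = (\<lambda>t. g * (1 / ((1 - P * of_real t) * (1 - Q * of_real t))))" by (simp add: fun_eq_iff d)
    then show ?thesis using integrable_mult_right[OF levy_integrable(1)[OF LD(4,3) PQ(4,5)], of g] by (simp only:)
  qed
  \<comment> \<open>The joint contribution of the two points is symmetric in \<open>P\<close> and
    \<open>Q\<close>, so over the common denominator it depends on \<open>g\<close> and
    \<open>N\<close> alone.\<close>
  have pt: "AE t in \<pi>. (P * (P / (1 - P * of_real t)) + Q * (Q / (1 - Q * of_real t))) =
     g * (((1 + N * of_real t)\<^sup>2 / d t + N) + N * (1 / g) * (1 / d t))"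
    using compact_distributionD(3)[OF LD(4)]
  proof eventually_elim
    case (elim t)
    define A where "A = 1 - P * complex_of_real t"
    define B where "B = 1 - Q * complex_of_real t"
    have AB: "A \<noteq> 0" "B \<noteq> 0"
      using levy_denominator(2)[OF PQ(4) LD(3) elim] levy_denominator(2)[OF PQ(5) LD(3) elim] by (auto simp: A_def B_def)
    have dt: "d t = A * B / g" unfolding d A_def B_def ..
    have dt0: "d t \<noteq> 0" using AB g0 by (simp add: dt)
    have "g * (((1 + N * of_real t)\<^sup>2 / d t + N) + N * (1 / g) * (1 / d t)) =
      g * ((1 + N * of_real t)\<^sup>2 + N * d t + N * (1 / g)) / d t"
      using dt0 by (simp add: field_simps)
    also have "(1 + N * of_real t)\<^sup>2 + N * d t + N * (1 / g) = 1 + N * of_real t + 2 * N / g"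
      by (simp add: d_def power2_eq_square algebra_simps)
    also have "g * (1 + N * of_real t + 2 * N / g) / d t = g * (g + N * g * of_real t + 2 * N) / (A * B)"
    proof -
      have "1 + N * of_real t + 2 * N / g = (g + N * g * of_real t + 2 * N) / g" using g0 by (simp add: field_simps)
      then show ?thesis using g0 unfolding dt by simp
    qed
    also have "g * (g + N * g * of_real t + 2 * N) = g * g + (N * g) * g * of_real t + 2 * (N * g)" by (simp add: algebra_simps)
    also have "\<dots> = P * P * B + Q * Q * A"
      unfolding NPQ A_def B_def unfolding gPQ by (simp add: algebra_simps)
    finally have "g * (((1 + N * of_real t)\<^sup>2 / d t + N) + N * (1 / g) * (1 / d t)) = (P * P * B + Q * Q * A) / (A * B)" .
    also have "\<dots> = P * (P / A) + Q * (Q / B)" using AB by (simp add: add_divide_distrib)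
    finally show ?case unfolding A_def[symmetric] B_def[symmetric] by (rule sym)
  qed
  have NI: "integrable \<pi> (\<lambda>t. (1 + N * of_real t)\<^sup>2 / d t + N)"
  proof -
    have b: "norm (1 / d t) \<le> norm g * 4" if "\<bar>t\<bar> \<le> T" for t
    proof -
      have "norm (1 / d t) = norm g / (norm (1 - P * complex_of_real t) * norm (1 - Q * complex_of_real t))"
        unfolding d by (simp add: norm_divide norm_mult)
      also have "\<dots> \<le> norm g / (1 / 2 * (1 / 2))"
        using levy_denominator(1)[OF PQ(4) LD(3) that] levy_denominator(1)[OF PQ(5) LD(3) that]
        by (intro divide_left_mono mult_mono mult_pos_pos) auto
      finally show ?thesis by simp
    qed
    show ?thesis
    proof (rule compact_distribution_integrable[OF LD(4)])
      show "norm ((1 + N * of_real t)\<^sup>2 / d t + N) \<le> (1 + norm N * T)\<^sup>2 * (norm g * 4) + norm N" if t: "\<bar>t\<bar> \<le> T" for t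
      proof (rule norm_triangle_le, rule add_mono)
        have "norm (1 + N * of_real t) \<le> 1 + norm N * T"
          by (rule norm_triangle_le) (use t in \<open>simp add: norm_mult mult_left_mono\<close>)
        then have "(norm (1 + N * of_real t))\<^sup>2 * norm (1 / d t) \<le> (1 + norm N * T)\<^sup>2 * (norm g * 4)"
          using b[OF t] by (intro mult_mono power_mono) auto
        then show "norm ((1 + N * of_real t)\<^sup>2 / d t) \<le> (1 + norm N * T)\<^sup>2 * (norm g * 4)"
          by (simp add: norm_divide norm_mult norm_power)
      qed simp
    qed (unfold d_def, measurable)
  qed
  have "(P * R P + Q * R Q) = g * R 0 + of_real \<beta> * (P * (LINT t|\<pi>. P / (1 - P * of_real t)) + Q * (LINT t|\<pi>. Q / (1 - Q * of_real t)))"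
    unfolding LD(7)[OF PQ(4)] LD(7)[OF PQ(5)] gPQ by (simp add: algebra_simps)
  also have "P * (LINT t|\<pi>. P / (1 - P * of_real t)) + Q * (LINT t|\<pi>. Q / (1 - Q * of_real t)) =
    (LINT t|\<pi>. P * (P / (1 - P * of_real t)) + Q * (Q / (1 - Q * of_real t)))"
    by (subst Bochner_Integration.integral_add) (use int PQ in \<open>auto simp only: integral_mult_right_zero intro!: integrable_mult_right\<close>)
  also have "\<dots> = (LINT t|\<pi>. g * (((1 + N * of_real t)\<^sup>2 / d t + N) + N * (1 / g) * (1 / d t)))"
  proof (rule integral_cong_AE[OF _ _ pt])
    interpret real_distribution \<pi> using LD(4) by (rule compact_distributionD)
    show "(\<lambda>t. P * (P / (1 - P * complex_of_real t)) + Q * (Q / (1 - Q * complex_of_real t))) \<in> borel_measurable \<pi>" by measurable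
    show "(\<lambda>t. g * ((1 + N * complex_of_real t)\<^sup>2 / d t + N + N * (1 / g) * (1 / d t))) \<in> borel_measurable \<pi>"
      unfolding d_def by measurable
  qed
  also have "\<dots> = g * ((LINT t|\<pi>. (1 + N * of_real t)\<^sup>2 / d t + N) + N * (1 / g) * (LINT t|\<pi>. 1 / d t))"
    unfolding integral_mult_right_zero
    by (subst Bochner_Integration.integral_add[OF NI integrable_mult_right[OF intd]]) (simp only: integral_mult_right_zero)
  finally have key: "P * R P + Q * R Q = g * (R 0 + of_real \<beta> * (LINT t|\<pi>. (1 + N * of_real t)\<^sup>2 / d t + N) + N * (1 / g) * H)"
    by (simp add: H_def algebra_simps)
  have "p * P + r' * Q - 1 = 1 + (P * R P + Q * R Q)"
    unfolding p r' using PQ by (simp add: algebra_simps)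
  then have "g / z = 1 + (P * R P + Q * R Q)" using rel(3) z by (simp add: g_def)
  then have "1 / z = 1 / g + (P * R P + Q * R Q) / g" using g0 z by (simp add: field_simps)
  then show "1 / z - 1 / g = R 0 + of_real \<beta> * (LINT t|\<pi>. (1 + N * of_real t)\<^sup>2 / d t + N) + N * (1 / g) * H"
    unfolding key using g0 by simp
qed

text \<open>All relations are differenced between \<open>w\<close> and the conjugate of
  \<open>z\<close>. The one for \<open>N\<close> becomes linear in the divided difference of
  \<open>N\<close> and is solved by a geometric series, convergent because
  \<open>\<beta> * q^2 < 1\<close>; those of \<open>H\<close> and \<open>\<phi>\<close> follow by
  substitution. The minus sign anticipates \<open>u w = 1 / w\<close>.\<close>

lemma commutator_kernel_psd:
  fixes S :: "complex set" and u N H \<phi> :: "complex \<Rightarrow> complex" and v \<beta> \<alpha> :: real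
  assumes \<pi>: "compact_distribution T \<pi>" and \<beta>: "\<beta> \<ge> 0" and v: "v > 0"
  defines "d \<equiv> \<lambda>w t. u w - complex_of_real t - N w * (of_real t)\<^sup>2"
  assumes D: "\<And>w t. w \<in> S \<Longrightarrow> \<bar>t\<bar> \<le> T \<Longrightarrow> d w t \<noteq> 0 \<and> norm (1 / d w t) \<le> D w"
    and q: "\<And>w t. w \<in> S \<Longrightarrow> \<bar>t\<bar> \<le> T \<Longrightarrow> norm (N w * of_real t / d w t) \<le> q" "\<beta> * q\<^sup>2 < 1"
    and H: "\<And>w. w \<in> S \<Longrightarrow> H w = of_real \<beta> * (LINT t|\<pi>. 1 / d w t)"
    and N: "\<And>w. w \<in> S \<Longrightarrow> N w * (u w - of_real v * H w) = of_real v"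
    and \<phi>: "\<And>w. w \<in> S \<Longrightarrow> \<phi> w = of_real \<alpha> + of_real \<beta> * (LINT t|\<pi>. (1 + N w * of_real t)\<^sup>2 / d w t + N w) + N w * u w * H w"
    and ne: "\<And>w z. w \<in> S \<Longrightarrow> z \<in> S \<Longrightarrow> u w \<noteq> cnj (u z)"
  shows "psd_kernel S (\<lambda>w z. - (\<phi> w - cnj (\<phi> z)) / (u w - cnj (u z)))"
proof -
  interpret real_distribution \<pi> using \<pi> by (rule compact_distributionD)
  have T: "T > 0" by (rule compact_distributionD(2)[OF \<pi>])
  have meas [measurable]: "(\<lambda>t. 1 / d w t) \<in> borel_measurable borel" "(\<lambda>t. of_real t / d w t) \<in> borel_measurable borel"
    "(\<lambda>t. (1 + N w * of_real t) / d w t) \<in> borel_measurable borel"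
    "(\<lambda>t. N w * of_real t / d w t) \<in> borel_measurable borel" for w
    unfolding d_def by measurable
  have bt: "norm (of_real t / d w t) \<le> T * D w" if "w \<in> S" "\<bar>t\<bar> \<le> T" for w t
  proof -
    have "norm (of_real t / d w t) = \<bar>t\<bar> * norm (1 / d w t)" by (simp add: norm_divide)
    also have "\<dots> \<le> T * D w" using D[OF that] that by (intro mult_mono) auto
    finally show ?thesis .
  qed
  have b1: "norm ((1 + N w * of_real t) / d w t) \<le> (1 + norm (N w) * T) * D w" if "w \<in> S" "\<bar>t\<bar> \<le> T" for w t
  proof -
    have "norm (1 + N w * of_real t) \<le> 1 + norm (N w) * T"
      by (rule norm_triangle_le) (use that in \<open>simp add: norm_mult mult_left_mono\<close>)
    then have "norm (1 + N w * of_real t) * norm (1 / d w t) \<le> (1 + norm (N w) * T) * D w"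
      using D[OF that] T by (intro mult_mono) auto
    then show ?thesis by (simp add: norm_divide)
  qed
  define A where "A w z = (LINT t|\<pi>. 1 / d w t * cnj (1 / d z t))" for w z
  define B where "B w z = (LINT t|\<pi>. of_real t / d w t * cnj (of_real t / d z t))" for w z
  define C where "C w z = (LINT t|\<pi>. (1 + N w * of_real t) / d w t * cnj ((1 + N z * of_real t) / d z t))" for w z
  define M where "M w z = N w * cnj (N z) * (of_real \<beta> * B w z)" for w z
  have psdA: "psd_multiplier S A" unfolding A_def
    by (rule psd_multiplier_compact_integral[OF \<pi>]) (use D in auto)
  have psdB: "psd_multiplier S B" unfolding B_def
    by (rule psd_multiplier_compact_integral[OF \<pi>]) (use bt in auto)
  have psdC: "psd_kernel S C" unfolding C_def
    by (rule psd_multiplier_imp_psd, rule psd_multiplier_compact_integral[OF \<pi>]) (use b1 in auto)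
  have scale: "psd_multiplier S (\<lambda>w z. of_real \<beta> * G w z)" if "psd_multiplier S G" for G
    unfolding psd_multiplier_def
    using psd_kernel_scale[OF psd_multiplierD[OF that] \<beta>] by (simp add: mult.assoc)
  have psdM: "psd_multiplier S M"
    unfolding M_def by (intro psd_multiplier_weight scale psdB)
  have M_lt: "norm (M w z) < 1" if "w \<in> S" "z \<in> S" for w z
  proof -
    have "N w * cnj (N z) * B w z = (LINT t|\<pi>. N w * of_real t / d w t * cnj (N z * of_real t / d z t))"
      unfolding B_def by (subst integral_mult_right_zero[symmetric]) (simp add: mult_ac)
    also have "norm \<dots> \<le> q * q"
    proof (rule compact_distribution_integral_norm_le[OF \<pi>])
      show "norm (N w * of_real t / d w t * cnj (N z * of_real t / d z t)) \<le> q * q" if "\<bar>t\<bar> \<le> T" for t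
        unfolding norm_mult[of "N w * of_real t / d w t"] complex_mod_cnj
        using q(1)[OF \<open>w \<in> S\<close> that] q(1)[OF \<open>z \<in> S\<close> that] by (intro mult_mono) (auto intro: order_trans[OF norm_ge_zero])
      show "(\<lambda>t. N w * of_real t / d w t * cnj (N z * of_real t / d z t)) \<in> borel_measurable borel"
        by (intro borel_measurable_times borel_measurable_continuous_on[OF continuous_on_cnj[OF continuous_on_id]] meas)
    qed
    finally have "\<beta> * norm (N w * cnj (N z) * B w z) \<le> \<beta> * (q * q)" using \<beta> by (rule mult_left_mono)
    moreover have "norm (M w z) = \<beta> * norm (N w * cnj (N z) * B w z)"
      using \<beta> by (simp add: M_def norm_mult mult_ac)
    ultimately show ?thesis using q(2) by (simp add: power2_eq_square)
  qed
  \<comment> \<open>Up to sign, \<open>LN\<close> and \<open>LH\<close> are the divided differences of \<open>N\<close> and \<open>H\<close> with respect to \<open>u\<close>; the hypothesis \<open>N\<close>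
    gives a linear equation for \<open>LN\<close>, of which this is the solution.\<close>
  define LN where "LN w z = N w * cnj (N z) * (of_real (1 / v) + of_real \<beta> * A w z) / (1 - M w z)" for w z
  define LH where "LH w z = of_real \<beta> * A w z + of_real \<beta> * (B w z * LN w z)" for w z
  have psd_one: "psd_kernel S (\<lambda>w z. of_real (1 / v))"
    using psd_kernel_scale[OF psd_kernel_one, of "1 / v" S] v by simp
  have psdLN: "psd_kernel S LN"
    unfolding LN_def
    by (intro psd_kernel_geometric psdM M_lt psd_kernel_weight psd_kernel_add psd_one psd_kernel_scale[OF psd_multiplier_imp_psd[OF psdA] \<beta>])
  have psdLH: "psd_kernel S LH"
    unfolding LH_def
    by (intro psd_kernel_add psd_kernel_scale[OF _ \<beta>] psd_multiplier_imp_psd[OF psdA] psd_multiplierD[OF psdB] psdLN)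
  \<comment> \<open>The first two summands come from the integral in \<open>\<phi>\<close>, one as a
    Gram kernel and one through the variation of \<open>N\<close>; the last two come from the
    difference of \<open>N * u * H\<close>.\<close>
  have "psd_kernel S (\<lambda>w z. of_real \<beta> * C w z + of_real \<beta> * (u w * cnj (u z) * (A w z * LN w z)) +
      of_real (1 / v) * ((u w * N w) * cnj (u z * N z) * LH w z) + (N w * H w) * cnj (N z * H z))"
    by (intro psd_kernel_add psd_kernel_scale[OF _ \<beta>] psdC psd_kernel_weight psd_multiplierD[OF psdA] psdLN psdLH
        psd_kernel_rank_one psd_kernel_scale[of S _ "1 / v"]) (use v in simp_all)
  then show ?thesis
  proof (rule psd_kernel_cong)
    fix w z assume w: "w \<in> S" and z: "z \<in> S"
    define U U' n n' h h' where "U = u w" and "U' = cnj (u z)" and "n = N w" and "n' = cnj (N z)"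
      and "h = H w" and "h' = cnj (H z)"
    define e where "e t = d w t" for t
    define e' where "e' t = cnj (d z t)" for t
    have e_def': "e t = U - of_real t - n * (of_real t)\<^sup>2" "e' t = U' - of_real t - n' * (of_real t)\<^sup>2" for t
      by (simp_all add: e_def e'_def d_def U_def U'_def n_def n'_def)
    have e_nz: "e t \<noteq> 0" "e' t \<noteq> 0" if "\<bar>t\<bar> \<le> T" for t
      using D[OF w that] D[OF z that] by (simp_all add: e_def e'_def)
    have Une: "U - U' \<noteq> 0" using ne[OF w z] by (simp add: U_def U'_def)
    have eqs: "n * (U - of_real v * h) = of_real v" "n' * (U' - of_real v * h') = of_real v"
      using N[OF w] arg_cong[OF N[OF z], of cnj] by (simp_all add: U_def U'_def n_def n'_def h_def h'_def)
    have Aeq: "A w z = (LINT t|\<pi>. 1 / (e t * e' t))"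
      unfolding A_def e_def e'_def by simp
    have Beq: "B w z = (LINT t|\<pi>. (of_real t)\<^sup>2 / (e t * e' t))"
      unfolding B_def e_def e'_def by (simp add: power2_eq_square)
    have Ceq: "C w z = (LINT t|\<pi>. (1 + n * of_real t) * (1 + n' * of_real t) / (e t * e' t))"
      unfolding C_def e_def e'_def n_def n'_def by simp
    have int_prod: "integrable \<pi> (\<lambda>t. f t * cnj (g t))"
      if f: "f \<in> borel_measurable borel" "\<And>t. \<bar>t\<bar> \<le> T \<Longrightarrow> norm (f t) \<le> F"
        and g: "g \<in> borel_measurable borel" "\<And>t. \<bar>t\<bar> \<le> T \<Longrightarrow> norm (g t) \<le> G" for f g :: "real \<Rightarrow> complex" and F G
    proof (rule compact_distribution_integrable[OF \<pi>])
      show "norm (f t * cnj (g t)) \<le> F * G" if "\<bar>t\<bar> \<le> T" for t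
        unfolding norm_mult complex_mod_cnj using f(2)[OF that] g(2)[OF that]
        by (intro mult_mono) (auto intro: order_trans[OF norm_ge_zero])
      show "(\<lambda>t. f t * cnj (g t)) \<in> borel_measurable borel"
        by (intro borel_measurable_times f borel_measurable_continuous_on[OF continuous_on_cnj[OF continuous_on_id]] g)
    qed
    have iA: "integrable \<pi> (\<lambda>t. 1 / (e t * e' t))"
      using int_prod[OF meas(1) _ meas(1), of w "D w" z "D z"] D[OF w] D[OF z] by (simp add: e_def e'_def)
    have iB: "integrable \<pi> (\<lambda>t. (of_real t)\<^sup>2 / (e t * e' t))"
      using int_prod[OF meas(2) bt[OF w] meas(2) bt[OF z]] by (simp add: e_def e'_def power2_eq_square)
    have iC: "integrable \<pi> (\<lambda>t. (1 + n * of_real t) * (1 + n' * of_real t) / (e t * e' t))"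
      using int_prod[OF meas(3) b1[OF w] meas(3) b1[OF z]] by (simp add: e_def e'_def n_def n'_def)
    have i1: "integrable \<pi> (\<lambda>t. 1 / d w t)" if "w \<in> S" for w
      by (rule compact_distribution_integrable[OF \<pi> meas(1)]) (use D[OF that] in blast)
    have i2: "integrable \<pi> (\<lambda>t. (1 + N w * of_real t)\<^sup>2 / d w t + N w)" if "w \<in> S" for w
    proof (rule compact_distribution_integrable[OF \<pi>])
      show "norm ((1 + N w * of_real t)\<^sup>2 / d w t + N w) \<le> (1 + norm (N w) * T) * ((1 + norm (N w) * T) * D w) + norm (N w)"
        if t: "\<bar>t\<bar> \<le> T" for t
      proof (rule norm_triangle_le, rule add_mono)
        have "norm (1 + N w * of_real t) \<le> 1 + norm (N w) * T"
          by (rule norm_triangle_le) (use t in \<open>simp add: norm_mult mult_left_mono\<close>)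
        then have "norm (1 + N w * of_real t) * norm ((1 + N w * of_real t) / d w t) \<le> (1 + norm (N w) * T) * ((1 + norm (N w) * T) * D w)"
          using b1[OF \<open>w \<in> S\<close> t] T by (intro mult_mono) auto
        then show "norm ((1 + N w * of_real t)\<^sup>2 / d w t) \<le> (1 + norm (N w) * T) * ((1 + norm (N w) * T) * D w)"
          by (simp add: norm_divide norm_mult power2_eq_square)
      qed simp
    qed (unfold d_def, measurable)
    have h': "h' = of_real \<beta> * (LINT t|\<pi>. 1 / e' t)"
    proof -
      have "(LINT t|\<pi>. 1 / e' t) = (LINT t|\<pi>. cnj (1 / d z t))" by (simp add: e'_def)
      also have "\<dots> = cnj (LINT t|\<pi>. 1 / d z t)" by (rule Bochner_Integration.integral_cnj)
      finally show ?thesis using H[OF z] by (simp add: h'_def)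
    qed
    have i1': "integrable \<pi> (\<lambda>t. 1 / e' t)"
      using integrable_cnj[OF i1[OF z]] by (simp add: e'_def)
    have i2': "integrable \<pi> (\<lambda>t. (1 + n' * of_real t)\<^sup>2 / e' t + n')"
      using integrable_cnj[OF i2[OF z]] by (simp add: e'_def n'_def)
    have dh: "h - h' = - of_real \<beta> * ((U - U') * A w z - (n - n') * B w z)"
    proof -
      have "(LINT t|\<pi>. 1 / e t) - (LINT t|\<pi>. 1 / e' t) = (LINT t|\<pi>. 1 / e t - 1 / e' t)"
        using i1[OF w] i1' by (simp add: e_def)
      also have "\<dots> = (LINT t|\<pi>. (n - n') * ((of_real t)\<^sup>2 / (e t * e' t)) - (U - U') * (1 / (e t * e' t)))"
      proof (rule integral_cong_AE)
        show "AE t in \<pi>. 1 / e t - 1 / e' t = (n - n') * ((of_real t)\<^sup>2 / (e t * e' t)) - (U - U') * (1 / (e t * e' t))"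
          using compact_distributionD(3)[OF \<pi>]
        proof eventually_elim
          case (elim t)
          have "1 / e t - 1 / e' t = (e' t - e t) / (e t * e' t)" using e_nz[OF elim] by (simp add: diff_divide_distrib)
          also have "e' t - e t = (n - n') * (of_real t)\<^sup>2 - (U - U')" unfolding e_def' by (simp add: algebra_simps)
          finally show ?case by (simp add: diff_divide_distrib)
        qed
      qed (unfold e_def', measurable)
      also have "\<dots> = (n - n') * B w z - (U - U') * A w z"
        unfolding Aeq Beq
        by (subst Bochner_Integration.integral_diff[OF integrable_mult_right[OF iB] integrable_mult_right[OF iA]])
          (simp only: integral_mult_right_zero)
      finally have I: "(LINT t|\<pi>. 1 / e t) - (LINT t|\<pi>. 1 / e' t) = (n - n') * B w z - (U - U') * A w z" .
      have "h - h' = of_real \<beta> * ((LINT t|\<pi>. 1 / e t) - (LINT t|\<pi>. 1 / e' t))"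
        unfolding h' h_def H[OF w] by (simp add: e_def right_diff_distrib)
      then show ?thesis unfolding I by (simp add: algebra_simps)
    qed
    \<comment> \<open>Each relation is multiplied by the other value of \<open>N\<close>, and the
      results are subtracted.\<close>
    have dn0: "of_real v * (n - n') = n * n' * (of_real v * (h - h') - (U - U'))"
      using arg_cong[OF eqs(1), of "\<lambda>x. n' * x"] arg_cong[OF eqs(2), of "\<lambda>x. n * x"] by (simp add: algebra_simps)
    define k where "k = complex_of_real (1 / v)"
    have vk: "of_real v * k = 1" using v by (simp add: k_def)
    have v0: "complex_of_real v \<noteq> 0" using v by simp
    have dn: "n - n' = - (U - U') * LN w z"
    proof -
      have M1: "1 - M w z \<noteq> 0" using M_lt[OF w z] by auto
      have "n - n' = n * n' * ((h - h') - k * (U - U'))"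
      proof -
        have "of_real v * (n * n' * ((h - h') - k * (U - U'))) = n * n' * (of_real v * (h - h') - (of_real v * k) * (U - U'))"
          by (simp add: algebra_simps)
        then have "of_real v * (n - n') = of_real v * (n * n' * ((h - h') - k * (U - U')))"
          using dn0 unfolding vk by (simp only: mult_1_left)
        then show ?thesis using v0 by simp
      qed
      also have "\<dots> = - (U - U') * (n * n' * (k + of_real \<beta> * A w z)) + (n - n') * M w z"
        unfolding dh M_def by (simp add: n_def[symmetric] n'_def[symmetric] algebra_simps)
      finally have "(n - n') * (1 - M w z) = - (U - U') * (n * n' * (k + of_real \<beta> * A w z))"
        by (simp add: algebra_simps)
      then have "n - n' = - (U - U') * (n * n' * (k + of_real \<beta> * A w z)) / (1 - M w z)"
        using M1 by (simp add: eq_divide_eq)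
      then show ?thesis unfolding LN_def n_def[symmetric] n'_def[symmetric] k_def[symmetric] by (simp add: mult.assoc)
    qed
    have dh2: "h - h' = - (U - U') * LH w z"
      unfolding dh dn LH_def by (simp add: algebra_simps)
    have G: "(LINT t|\<pi>. (1 + n * of_real t)\<^sup>2 / e t + n) - (LINT t|\<pi>. (1 + n' * of_real t)\<^sup>2 / e' t + n') =
      - (U - U') * C w z + U * U' * (n - n') * A w z"
    proof -
      have "(LINT t|\<pi>. (1 + n * of_real t)\<^sup>2 / e t + n) - (LINT t|\<pi>. (1 + n' * of_real t)\<^sup>2 / e' t + n') =
        (LINT t|\<pi>. ((1 + n * of_real t)\<^sup>2 / e t + n) - ((1 + n' * of_real t)\<^sup>2 / e' t + n'))"
        by (rule Bochner_Integration.integral_diff[symmetric]) (use i2[OF w] i2' in \<open>simp_all add: e_def n_def\<close>)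
      also have "\<dots> = (LINT t|\<pi>. - (U - U') * ((1 + n * of_real t) * (1 + n' * of_real t) / (e t * e' t)) + U * U' * (n - n') * (1 / (e t * e' t)))"
      proof (rule integral_cong_AE)
        show "AE t in \<pi>. ((1 + n * of_real t)\<^sup>2 / e t + n) - ((1 + n' * of_real t)\<^sup>2 / e' t + n') =
          - (U - U') * ((1 + n * of_real t) * (1 + n' * of_real t) / (e t * e' t)) + U * U' * (n - n') * (1 / (e t * e' t))"
          using compact_distributionD(3)[OF \<pi>]
        proof eventually_elim
          case (elim t)
          define x where "x = complex_of_real t"
          have "((1 + n * x)\<^sup>2 / e t + n) - ((1 + n' * x)\<^sup>2 / e' t + n') =
            ((1 + n * x)\<^sup>2 * e' t - (1 + n' * x)\<^sup>2 * e t + (n - n') * (e t * e' t)) / (e t * e' t)"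
            using e_nz[OF elim] by (simp add: field_simps)
          \<comment> \<open>The summand \<open>n\<close> in the integrand is what makes this
            numerator collapse to two terms.\<close>
          also have "(1 + n * x)\<^sup>2 * e' t - (1 + n' * x)\<^sup>2 * e t + (n - n') * (e t * e' t) =
            - (U - U') * ((1 + n * x) * (1 + n' * x)) + U * U' * (n - n')"
            unfolding e_def' x_def[symmetric] by (simp add: power2_eq_square algebra_simps)
          finally show ?case by (simp add: x_def add_divide_distrib)
        qed
      qed (unfold e_def', measurable)
      also have "\<dots> = - (U - U') * C w z + U * U' * (n - n') * A w z"
        unfolding Aeq Ceq using iA iC
        by (subst Bochner_Integration.integral_add) (auto simp only: integral_mult_right_zero intro!: integrable_mult_right)
      finally show ?thesis .
    qed
    have d\<phi>: "\<phi> w - cnj (\<phi> z) = of_real \<beta> * (- (U - U') * C w z + U * U' * (n - n') * A w z) + (n * U * h - n' * U' * h')"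
    proof -
      have "cnj (\<phi> z) = of_real \<alpha> + of_real \<beta> * (LINT t|\<pi>. cnj ((1 + N z * of_real t)\<^sup>2 / d z t + N z)) + n' * U' * h'"
        unfolding \<phi>[OF z] Bochner_Integration.integral_cnj by (simp add: n'_def U'_def h'_def)
      also have "(LINT t|\<pi>. cnj ((1 + N z * of_real t)\<^sup>2 / d z t + N z)) = (LINT t|\<pi>. (1 + n' * of_real t)\<^sup>2 / e' t + n')"
        by (simp add: n'_def e'_def)
      finally show ?thesis
        unfolding G[symmetric] \<phi>[OF w] by (simp add: e_def n_def U_def h_def right_diff_distrib)
    qed
    \<comment> \<open>The relation for \<open>N\<close> turns the mixed difference into a weighted
      difference of \<open>h\<close> and a rank-one term, whose kernels are both positive.\<close>
    have E: "n * U * h - n' * U' * h' = k * (U * n * (U' * n') * (h - h')) - (U - U') * ((n * h) * (n' * h'))"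
    proof -
      have nU: "n * U = of_real v * (1 + n * h)" "n' * U' = of_real v * (1 + n' * h')"
        using eqs by (simp_all add: algebra_simps)
      have nn: "n * n' * (U - U') = of_real v * (n * n' * (h - h') - (n - n'))"
        using dn0 by (simp add: algebra_simps)
      have "k * (U * n * (U' * n') * (h - h')) = k * ((n * U) * (n' * U') * (h - h'))" by (simp add: mult_ac)
      also have "\<dots> = of_real v * ((1 + n * h) * (1 + n' * h') * (h - h'))"
        proof -
        have "k * ((of_real v * (1 + n * h)) * (of_real v * (1 + n' * h')) * (h - h')) =
          (of_real v * k) * (of_real v * ((1 + n * h) * (1 + n' * h') * (h - h')))" by (simp only: mult_ac)
        then show ?thesis unfolding nU vk by simp
      qed
      finally have "k * (U * n * (U' * n') * (h - h')) - (U - U') * ((n * h) * (n' * h')) =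
        of_real v * ((1 + n * h) * (1 + n' * h') * (h - h')) - (n * n' * (U - U')) * (h * h')" by (simp add: mult_ac)
      also have "\<dots> = of_real v * ((1 + n * h) * h - (1 + n' * h') * h')"
        unfolding nn by (simp add: algebra_simps)
      also have "\<dots> = n * U * h - n' * U' * h'" unfolding nU by (simp add: algebra_simps)
      finally show ?thesis ..
    qed
    have "\<phi> w - cnj (\<phi> z) = - (U - U') * (of_real \<beta> * C w z + of_real \<beta> * (U * U' * (A w z * LN w z)) +
      k * ((U * n) * (U' * n') * LH w z) + (n * h) * (n' * h'))"
      unfolding d\<phi> E unfolding dn dh2 by (simp add: algebra_simps)
    then have "- (\<phi> w - cnj (\<phi> z)) / (U - U') = of_real \<beta> * C w z + of_real \<beta> * (U * U' * (A w z * LN w z)) +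
      k * ((U * n) * (U' * n') * LH w z) + (n * h) * (n' * h')"
      by (simp only: mult_minus_left minus_minus nonzero_mult_div_cancel_left[OF Une])
    then show "of_real \<beta> * C w z + of_real \<beta> * (u w * cnj (u z) * (A w z * LN w z)) +
      of_real (1 / v) * ((u w * N w) * cnj (u z * N z) * LH w z) + (N w * H w) * cnj (N z * H z) =
      - (\<phi> w - cnj (\<phi> z)) / (u w - cnj (u z))"
      by (simp add: U_def U'_def n_def n'_def h_def h'_def k_def)
  qed
qed

section \<open>Roots of the denominator and the resulting R-transform\<close>

lemma eventually_at_0_complexE:
  assumes "\<forall>\<^sub>F w in at (0 :: complex). P w"
  obtains \<epsilon> where "\<epsilon> > 0" "\<And>w. w \<noteq> 0 \<Longrightarrow> norm w < \<epsilon> \<Longrightarrow> P w"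
  using assms unfolding eventually_at by (auto simp: dist_norm)

text \<open>No continuous branch is chosen: the modulus of the square root is the root of the
  modulus, and this alone sends both solutions to 0.\<close>

lemma quadratic_roots_tendsto_zero:
  fixes b c :: "'a \<Rightarrow> complex"
  assumes "(b \<longlongrightarrow> 0) F" "(c \<longlongrightarrow> 0) F"
  obtains x y where "(x \<longlongrightarrow> 0) F" "(y \<longlongrightarrow> 0) F" "\<And>z. x z + y z = b z" "\<And>z. x z * y z = c z"
    "\<And>z. (x z - y z)\<^sup>2 = (b z)\<^sup>2 - 4 * c z"
proof -
  define q where "q z = csqrt ((b z)\<^sup>2 - 4 * c z)" for z
  have "((\<lambda>z. (b z)\<^sup>2 - 4 * c z) \<longlongrightarrow> 0\<^sup>2 - 4 * 0) F" by (intro tendsto_intros assms)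
  then have "((\<lambda>z. sqrt (norm ((b z)\<^sup>2 - 4 * c z))) \<longlongrightarrow> sqrt 0) F"
    by (intro tendsto_real_sqrt tendsto_norm_zero) simp
  then have "((\<lambda>z. norm (q z)) \<longlongrightarrow> 0) F" unfolding q_def norm_csqrt by simp
  then have q: "(q \<longlongrightarrow> 0) F" by (rule tendsto_norm_zero_cancel)
  have q2: "q z * q z = b z * b z - 4 * c z" for z
    using power2_csqrt[of "(b z)\<^sup>2 - 4 * c z"] by (simp add: q_def power2_eq_square)
  show thesis
  proof
    have "((\<lambda>z. (b z + q z) / 2) \<longlongrightarrow> (0 + 0) / 2) F" "((\<lambda>z. (b z - q z) / 2) \<longlongrightarrow> (0 - 0) / 2) F"
      by (intro tendsto_intros assms q; simp)+
    then show "((\<lambda>z. (b z + q z) / 2) \<longlongrightarrow> 0) F" "((\<lambda>z. (b z - q z) / 2) \<longlongrightarrow> 0) F" by simp_all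
    show "(b z + q z) / 2 + (b z - q z) / 2 = b z" for z by (simp add: field_simps)
    have "(b z + q z) * (b z - q z) = 4 * c z" for z using q2[of z] by (simp add: algebra_simps)
    then show "(b z + q z) / 2 * ((b z - q z) / 2) = c z" for z by simp
    have "(b z + q z) / 2 - (b z - q z) / 2 = q z" for z by (simp add: field_simps)
    then show "((b z + q z) / 2 - (b z - q z) / 2)\<^sup>2 = (b z)\<^sup>2 - 4 * c z" for z
      using q2[of z] by (simp add: power2_eq_square)
  qed
qed

context commutator_series begin

text \<open>The reciprocals of the roots of the denominator are used, because they tend to 0 with
  \<open>z\<close>. Their squared difference is \<open>z^2\<close> times a quantity tending to
  \<open>1 + 4 * v\<close>, so they are eventually distinct, and partial fractions express
  \<open>S 0\<close> and \<open>S 1\<close> through the Cauchy transform of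
  \<open>\<mu>\<close>.\<close>

lemma commutator_roots_eventually:
  assumes G: "\<And>z. z \<noteq> 0 \<Longrightarrow> norm z < s \<Longrightarrow> (LINT u|\<mu>. z / (1 - z * complex_of_real u)) \<noteq> 0 \<and>
      1 / z = 1 / (LINT u|\<mu>. z / (1 - z * complex_of_real u)) + R (LINT u|\<mu>. z / (1 - z * complex_of_real u))"
    and s: "s > 0" and v: "v \<noteq> 0" "1 + 4 * v \<noteq> 0" and \<delta>: "\<delta> > 0"
  shows "\<forall>\<^sub>F z in at 0. \<exists>P Q p q. P + Q = z * S 0 z \<and> v * (z * S 0 z)\<^sup>2 * (p - q) = P - Q \<and>
    S 0 z = p * P + q * Q - 1 \<and> p = 1 / P + R P \<and> q = 1 / Q + R Q \<and>
    P \<noteq> 0 \<and> Q \<noteq> 0 \<and> P \<noteq> Q \<and> norm P < \<delta> \<and> norm Q < \<delta>"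
proof -
  interpret real_distribution \<mu> using \<mu> by (rule compact_distributionD)
  have B: "B > 0" by (rule compact_distributionD(2)[OF \<mu>])
  define g where "g w = (LINT u|\<mu>. w / (1 - w * complex_of_real u))" for w
  have t00: "t 0 0 = 1" using init[of 0] prob_space by simp
  have lim: "(S j \<longlongrightarrow> t 0 j) (at 0)" for j
    using S_isCont[of j] unfolding isCont_def S_zero .
  have z0: "((\<lambda>z. z) \<longlongrightarrow> (0::complex)) (at 0)" by (rule tendsto_ident_at)
  \<comment> \<open>Removing the powers of \<open>z\<close> leaves factors with the limits 1 and
    \<open>v\<close>, which decide about the discriminant.\<close>
  define c1 where "c1 z = 1 - 2 * v * z * S 1 z" for z
  define e1 where "e1 z = v * S 0 z" for z
  have cc: "cc z = z * c1 z" and ce: "ce z = z\<^sup>2 * e1 z" for z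
    by (simp_all add: cc_def c1_def ce_def e1_def power2_eq_square algebra_simps)
  have "(ca \<longlongrightarrow> 1 - v * 0\<^sup>2 * t 0 2) (at 0)"
    unfolding ca_def[abs_def] by (intro tendsto_intros lim z0)
  then have a_lim: "(ca \<longlongrightarrow> 1) (at 0)" by simp
  have "(c1 \<longlongrightarrow> 1 - 2 * v * 0 * t 0 1) (at 0)"
    unfolding c1_def[abs_def] by (intro tendsto_intros lim z0)
  then have c1_lim: "(c1 \<longlongrightarrow> 1) (at 0)" by simp
  have "(e1 \<longlongrightarrow> v * t 0 0) (at 0)"
    unfolding e1_def[abs_def] by (intro tendsto_intros lim)
  then have e1_lim: "(e1 \<longlongrightarrow> v) (at 0)" by (simp add: t00)
  have "((\<lambda>z. z * c1 z) \<longlongrightarrow> 0 * 1) (at 0)" "((\<lambda>z. z\<^sup>2 * e1 z) \<longlongrightarrow> 0\<^sup>2 * v) (at 0)"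
    by (intro tendsto_intros z0 c1_lim e1_lim)+
  then have cc_lim: "(cc \<longlongrightarrow> 0) (at 0)" and ce_lim: "(ce \<longlongrightarrow> 0) (at 0)" by (simp_all add: cc[abs_def] ce[abs_def])
  have "((\<lambda>z. cc z / ca z) \<longlongrightarrow> 0 / 1) (at 0)" "((\<lambda>z. - ce z / ca z) \<longlongrightarrow> - 0 / 1) (at 0)"
    by (intro tendsto_intros a_lim cc_lim ce_lim; simp)+
  then have "((\<lambda>z. cc z / ca z) \<longlongrightarrow> 0) (at 0)" "((\<lambda>z. - ce z / ca z) \<longlongrightarrow> 0) (at 0)" by simp_all
  note lims = this
  obtain x y where x: "(x \<longlongrightarrow> 0) (at 0)" and y: "(y \<longlongrightarrow> 0) (at 0)"
    and sum: "\<And>z. x z + y z = cc z / ca z" and prod: "\<And>z. x z * y z = - ce z / ca z"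
    and disc: "\<And>z. (x z - y z)\<^sup>2 = (cc z / ca z)\<^sup>2 - 4 * (- ce z / ca z)"
    by (rule quadratic_roots_tendsto_zero[OF lims]) (rule that, assumption+)
  note g = compact_cauchy_properties[OF \<mu>, folded g_def]
  have "isCont g 0"
    using g(1) B by (auto dest!: holomorphic_on_imp_continuous_on simp: continuous_on_eq_continuous_at)
  then obtain \<eta>' where \<eta>': "\<eta>' > 0" "\<And>w. norm w < \<eta>' \<Longrightarrow> norm (g w) < \<delta>"
    using \<delta> g(2) unfolding continuous_at_eps_delta by (auto simp: dist_norm)
  \<comment> \<open>Within this radius \<open>G\<close> applies, the values of \<open>g\<close> stay
    below \<open>\<delta>\<close>, and the margin needed for partial fractions holds.\<close>
  define \<eta> where "\<eta> = min s (min \<eta>' (1 / (2 * B)))"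
  have \<eta>: "\<eta> > 0" "\<eta> \<le> s" "\<eta> \<le> \<eta>'" "\<eta> \<le> 1 / (2 * B)" using s \<eta>' B by (simp_all add: \<eta>_def)
  have \<eta>B: "\<eta> * B \<le> 1 / 2" using \<eta>(4) B by (simp add: field_simps)
  define K where "K = max X B"
  have nz: "\<forall>\<^sub>F z in at 0. z \<noteq> (0::complex)" by (rule eventually_neq_at_within)
  have "((\<lambda>z. norm z * Y) \<longlongrightarrow> 0 * Y) (at (0::complex))"
    by (intro tendsto_mult_right tendsto_norm_zero z0)
  then have ev1: "\<forall>\<^sub>F z::complex in at 0. norm z * Y < 1 / 2" by (rule order_tendstoD) simp
  have "((\<lambda>z. norm (ca z)) \<longlongrightarrow> norm (1::complex)) (at 0)" by (intro tendsto_intros a_lim)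
  then have ev2: "\<forall>\<^sub>F z in at 0. norm (ca z) > 3 / 4" by (rule order_tendstoD) simp
  have "((\<lambda>z. norm (cc z) * K + norm (ce z) * K\<^sup>2) \<longlongrightarrow> norm (0::complex) * K + norm (0::complex) * K\<^sup>2) (at 0)"
    by (intro tendsto_intros cc_lim ce_lim)
  then have ev3: "\<forall>\<^sub>F z in at 0. norm (cc z) * K + norm (ce z) * K\<^sup>2 < 1 / 4" by (rule order_tendstoD) simp
  have ev4: "\<forall>\<^sub>F z in at 0. norm (x z) < \<eta>" "\<forall>\<^sub>F z in at 0. norm (y z) < \<eta>"
    using order_tendstoD(2)[OF tendsto_norm_zero[OF x] \<eta>(1)] order_tendstoD(2)[OF tendsto_norm_zero[OF y] \<eta>(1)] .
  have ev5: "\<forall>\<^sub>F z in at 0. S 0 z \<noteq> 0" using tendsto_imp_eventually_ne[OF lim[of 0], of 0] t00 by simp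
  have "((\<lambda>z. (c1 z / ca z)\<^sup>2 + 4 * (e1 z / ca z)) \<longlongrightarrow> (1 / 1)\<^sup>2 + 4 * (v / 1)) (at 0)"
    by (intro tendsto_intros a_lim c1_lim e1_lim) simp_all
  then have ev6: "\<forall>\<^sub>F z in at 0. (c1 z / ca z)\<^sup>2 + 4 * (e1 z / ca z) \<noteq> 0"
    by (rule tendsto_imp_eventually_ne) (use v in simp)
  show ?thesis
    using nz ev1 ev2 ev3 ev4 ev5 ev6
  proof eventually_elim
    case (elim z)
    define a b where "a = x z" and "b = y z"
    have ca0: "ca z \<noteq> 0" using elim(3) by auto
    have ce0: "ce z \<noteq> 0" using elim(1,7) v by (simp add: ce_def)
    have ab: "ca z * (a + b) = cc z" "ca z * (a * b) = - ce z"
      using sum[of z] prod[of z] ca0 by (simp_all add: a_def b_def)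
    have nab: "a \<noteq> 0" "b \<noteq> 0" using ab(2) ce0 by auto
    have "(a - b)\<^sup>2 = z\<^sup>2 * ((c1 z / ca z)\<^sup>2 + 4 * (e1 z / ca z))"
      unfolding a_def b_def disc cc ce by (simp add: power_mult_distrib power_divide algebra_simps)
    then have neq: "a \<noteq> b" using elim(1,8) by auto
    have small: "norm a < \<eta>" "norm b < \<eta>" using elim by (simp_all add: a_def b_def)
    have den: "ca z - cc z * of_real u - ce z * (of_real u)\<^sup>2 = ca z * ((1 - a * of_real u) * (1 - b * of_real u))" for u
    proof -
      have "ca z - cc z * of_real u - ce z * (of_real u)\<^sup>2 = ca z - ca z * (a + b) * of_real u + ca z * (a * b) * (of_real u)\<^sup>2"
        unfolding ab by simp
      then show ?thesis by (simp add: power2_eq_square algebra_simps)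
    qed
    have S: "S j z = (LINT u|\<mu>. of_real (u ^ j) / ((1 - a * of_real u) * (1 - b * of_real u))) / ca z" for j
    proof -
      have "S j z = (LINT u|\<mu>. of_real (u ^ j) / (ca z * ((1 - a * of_real u) * (1 - b * of_real u))))"
        unfolding den[symmetric] by (rule S_eq_integral[where K = K]) (use elim in \<open>auto simp: K_def\<close>)
      also have "\<dots> = (LINT u|\<mu>. (of_real (u ^ j) / ((1 - a * of_real u) * (1 - b * of_real u))) / ca z)"
        by (simp add: mult_ac)
      also have "\<dots> = (LINT u|\<mu>. of_real (u ^ j) / ((1 - a * of_real u) * (1 - b * of_real u))) / ca z"
        by (rule integral_divide_zero)
      finally show ?thesis .
    qed
    define P Q p q where "P = g a" and "Q = g b" and "p = 1 / a" and "q = 1 / b"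
    note pf = compact_distribution_partial_fractions[OF \<mu> \<eta>B small]
    have epq: "ce z * (p * q) = - ca z" "ce z * (p + q) = - cc z" "ce z * (p - q) = ca z * (a - b)"
    proof -
      have ce: "ce z = - (ca z * (a * b))" using ab(2) by simp
      show "ce z * (p * q) = - ca z" "ce z * (p + q) = - cc z" "ce z * (p - q) = ca z * (a - b)"
        unfolding ce ab(1)[symmetric] p_def q_def using nab by (simp_all add: field_simps)
    qed
    have pP: "p * P = (LINT u|\<mu>. 1 / (1 - a * complex_of_real u))" "q * Q = (LINT u|\<mu>. 1 / (1 - b * complex_of_real u))"
      unfolding p_def q_def P_def Q_def g_def using nab by (simp_all flip: integral_mult_right_zero)
    have r1: "S 0 z * ce z * (p - q) = P - Q"
      unfolding mult.assoc epq(3) P_def Q_def g_def pf(1) S using ca0 by simp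
    have r2: "S 1 z * ce z * (p - q) = p * P - q * Q"
      unfolding mult.assoc epq(3) pP pf(2) S using ca0 by simp
    have r3: "cc z = - ce z * (p + q)" "ca z = - ce z * (p * q)" using epq by simp_all
    have r4: "ca z * S 0 z - cc z * S 1 z - ce z * S 2 z = 1"
      using S_equation[of z 0] elim(2) t00 by (simp add: ca_def cc_def ce_def numeral_2_eq_2)
    have pq: "p \<noteq> q" using neq nab by (simp add: p_def q_def)
    note rel = commutator_root_relations[OF r1 r2 r3 cc_def ce_def ca_def r4 pq]
    have "p = 1 / P + R P \<and> P \<noteq> 0" "q = 1 / Q + R Q \<and> Q \<noteq> 0"
      unfolding p_def q_def P_def Q_def g_def
      using G[of a] G[of b] nab small \<eta>(2) by (auto intro: less_le_trans)
    moreover have "P \<noteq> Q" using rel(2) pq v(1) elim(1,7) by auto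
    moreover have "norm P < \<delta>" "norm Q < \<delta>" unfolding P_def Q_def using \<eta>'(2) small \<eta>(3) by auto
    ultimately show ?case using rel by blast
  qed
qed

text \<open>Only \<open>N\<close>, symmetric in the two points, is exported. The constant 4 comes
  from two denominators of modulus at least 1/2; the bound \<open>2 * \<delta>\<close> from
  \<open>norm P < \<delta>\<close> and \<open>norm (Q * t) \<le> 1/2\<close> over the same
  denominators.\<close>

lemma commutator_levy_kernel:
  assumes L: "levy_representation R r T \<beta> \<pi>" and z: "z \<noteq> 0" and S0: "S 0 z \<noteq> 0"
    and \<delta>: "\<delta> \<le> r" and w: "w = z * S 0 z"
    and ex: "\<exists>P Q p q. P + Q = z * S 0 z \<and> v * (z * S 0 z)\<^sup>2 * (p - q) = P - Q \<and>
      S 0 z = p * P + q * Q - 1 \<and> p = 1 / P + R P \<and> q = 1 / Q + R Q \<and>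
      P \<noteq> 0 \<and> Q \<noteq> 0 \<and> P \<noteq> Q \<and> norm P < \<delta> \<and> norm Q < \<delta>"
  obtains N where
    "\<And>t. \<bar>t\<bar> \<le> T \<Longrightarrow> 1 / w - of_real t - N * (of_real t)\<^sup>2 \<noteq> 0 \<and>
       norm (1 / (1 / w - of_real t - N * (of_real t)\<^sup>2)) \<le> 4 * norm w \<and>
       norm (N * of_real t / (1 / w - of_real t - N * (of_real t)\<^sup>2)) \<le> 2 * \<delta>"
    "N * (1 / w - v * (of_real \<beta> * (LINT t|\<pi>. 1 / (1 / w - of_real t - N * (of_real t)\<^sup>2)))) = v"
    "1 / z - 1 / w = R 0 + of_real \<beta> * (LINT t|\<pi>. (1 + N * of_real t)\<^sup>2 / (1 / w - of_real t - N * (of_real t)\<^sup>2) + N) +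
       N * (1 / w) * (of_real \<beta> * (LINT t|\<pi>. 1 / (1 / w - of_real t - N * (of_real t)\<^sup>2)))"
proof -
  obtain P Q p q where rel: "P + Q = z * S 0 z" "v * (z * S 0 z)\<^sup>2 * (p - q) = P - Q" "S 0 z = p * P + q * Q - 1"
    and pq: "p = 1 / P + R P" "q = 1 / Q + R Q"
    and PQ: "P \<noteq> 0" "Q \<noteq> 0" "P \<noteq> Q" "norm P < \<delta>" "norm Q < \<delta>"
    using ex by blast
  have PQr: "norm P < r" "norm Q < r" using PQ \<delta> by simp_all
  define N where "N = - (P * Q) / w"
  have w0: "w \<noteq> 0" using z S0 w by simp
  note LD = levy_representationD[OF L]
  have T: "T > 0" using compact_distributionD(2)[OF LD(4)] .
  note rels = levy_commutator_relations[OF L rel pq PQ(1,2,3) PQr z S0, folded w, folded N_def]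
  show thesis
  proof
    fix t assume t: "\<bar>t\<bar> \<le> T"
    define A where "A = 1 - P * complex_of_real t"
    define B where "B = 1 - Q * complex_of_real t"
    have A: "norm A \<ge> 1 / 2" "A \<noteq> 0" unfolding A_def by (rule levy_denominator[OF PQr(1) LD(3) t])+
    have B: "norm B \<ge> 1 / 2" "B \<noteq> 0" unfolding B_def by (rule levy_denominator[OF PQr(2) LD(3) t])+
    have d: "1 / w - of_real t - N * (of_real t)\<^sup>2 = A * B / w" unfolding A_def B_def by (rule rels(1))
    have AB: "norm A * norm B \<ge> 1 / 2 * (1 / 2)" using A B by (intro mult_mono) auto
    have "norm (1 / (A * B / w)) = norm w / (norm A * norm B)" by (simp add: norm_divide norm_mult)
    also have "\<dots> \<le> norm w / (1 / 2 * (1 / 2))" using AB by (intro divide_left_mono) auto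
    finally have b1: "norm (1 / (A * B / w)) \<le> 4 * norm w" by simp
    have "N * of_real t / (A * B / w) = - (P * (Q * of_real t)) / (A * B)"
      using w0 by (simp add: N_def)
    then have "norm (N * of_real t / (A * B / w)) = norm P * (norm Q * \<bar>t\<bar>) / (norm A * norm B)"
      by (simp add: norm_divide norm_mult)
    also have "\<dots> \<le> \<delta> * (1 / 2) / (1 / 2 * (1 / 2))"
    proof (rule frac_le)
      have "norm Q * \<bar>t\<bar> \<le> r * T" using PQr t T LD(2) by (intro mult_mono) auto
      then have Qt: "norm Q * \<bar>t\<bar> \<le> 1 / 2" using LD(3) by simp
      show \<delta>0: "0 \<le> \<delta> * (1 / 2)" using order_le_less_trans[OF norm_ge_zero PQ(4)] by simp
      show "norm P * (norm Q * \<bar>t\<bar>) \<le> \<delta> * (1 / 2)"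
        by (rule mult_mono) (use PQ(4) Qt \<delta>0 in auto)
    qed (use AB in auto)
    finally have "norm (N * of_real t / (A * B / w)) \<le> 2 * \<delta>" by simp
    with b1 show "1 / w - of_real t - N * (of_real t)\<^sup>2 \<noteq> 0 \<and>
       norm (1 / (1 / w - of_real t - N * (of_real t)\<^sup>2)) \<le> 4 * norm w \<and>
       norm (N * of_real t / (1 / w - of_real t - N * (of_real t)\<^sup>2)) \<le> 2 * \<delta>"
      unfolding d using A B w0 by (intro conjI) (simp_all only: divide_eq_0_iff mult_eq_0_iff, simp_all)
  next
    show "N * (1 / w - v * (of_real \<beta> * (LINT t|\<pi>. 1 / (1 / w - of_real t - N * (of_real t)\<^sup>2)))) = v"
      by (rule rels(2))
    show "1 / z - 1 / w = R 0 + of_real \<beta> * (LINT t|\<pi>. (1 + N * of_real t)\<^sup>2 / (1 / w - of_real t - N * (of_real t)\<^sup>2) + N) +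
       N * (1 / w) * (of_real \<beta> * (LINT t|\<pi>. 1 / (1 / w - of_real t - N * (of_real t)\<^sup>2)))"
      by (rule rels(3))
  qed
qed

lemma S_cnj:
  assumes "\<And>n. cnj (t n j) = t n j" and "norm z * Y < 1"
  shows "S j (cnj z) = cnj (S j z)"
proof -
  have "(\<lambda>n. cnj (t n j * z ^ n)) sums cnj (S j z)"
    by (rule bounded_linear.sums[OF bounded_linear_cnj sums_S[OF assms(2)]])
  moreover have "(\<lambda>n. t n j * cnj z ^ n) sums S j (cnj z)"
    by (rule sums_S) (use assms(2) in simp)
  ultimately show ?thesis using sums_unique2 assms(1) by (simp, blast)
qed

text \<open>The law sought must have \<open>z * S 0 z\<close> as its Cauchy transform at
  \<open>1 / z\<close>, so the regular part of the reciprocal of the local inverse is the candidate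
  \<open>R\<close>. On the ray a value \<open>N w\<close> is picked separately for each point;
  kernel positivity asks for no regularity in \<open>w\<close>.\<close>

lemma commutator_levy_representation:
  assumes fid: "freely_infinitely_divisible \<mu>" and v: "v = complex_of_real v'" "v' > 0"
    and real: "\<And>n. cnj (t n 0) = t n 0"
  obtains R r T \<beta> \<pi> s where "levy_representation R r T \<beta> \<pi>" "s > 0"
    "\<And>z. z \<noteq> 0 \<Longrightarrow> norm z < s \<Longrightarrow> norm z * Y < 1 \<and> z * S 0 z \<noteq> 0 \<and> norm (z * S 0 z) < r \<and>
       1 / z = 1 / (z * S 0 z) + R (z * S 0 z)"
proof -
  obtain Rx rx Tx \<beta> \<pi> sx where Lx: "levy_representation Rx rx Tx \<beta> \<pi>" "sx > 0"
    and Gx: "\<And>z. z \<noteq> 0 \<Longrightarrow> norm z < sx \<Longrightarrow> (LINT u|\<mu>. z / (1 - z * complex_of_real u)) \<noteq> 0 \<and>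
      norm (LINT u|\<mu>. z / (1 - z * complex_of_real u)) < rx \<and>
      1 / z = 1 / (LINT u|\<mu>. z / (1 - z * complex_of_real u)) + Rx (LINT u|\<mu>. z / (1 - z * complex_of_real u))"
    by (rule freely_infinitely_divisible_imp_levy_representation[OF \<mu> fid]) (rule that, assumption+)
  note LxD = levy_representationD[OF Lx(1)]
  have Y': "1 / Y > 0" using Y by simp
  have zY: "norm z * Y < 1 \<longleftrightarrow> norm z < 1 / Y" for z :: complex using Y by (simp add: field_simps)
  interpret real_distribution \<mu> using \<mu> by (rule compact_distributionD)
  have t00: "t 0 0 = 1" using init[of 0] prob_space by simp
  define M where "M z = z * S 0 z" for z
  have Mh: "M holomorphic_on ball 0 (1 / Y)" unfolding M_def[abs_def] by (intro holomorphic_intros S_holomorphic)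
  have M0: "M 0 = 0" by (simp add: M_def)
  have dM: "deriv M 0 = 1"
  proof -
    have "(S 0 has_field_derivative deriv (S 0) 0) (at 0)"
      by (rule holomorphic_derivI[OF S_holomorphic]) (use Y in auto)
    then have "(M has_field_derivative (1 * S 0 0 + deriv (S 0) 0 * 0)) (at 0)"
      unfolding M_def[abs_def] by (intro DERIV_mult' DERIV_mult DERIV_ident)
    then show ?thesis by (simp add: DERIV_imp_deriv S_zero t00)
  qed
  have Mcnj: "M (cnj z) = cnj (M z)" if "norm z < 1 / Y" for z
    using S_cnj[OF real, of z] that by (simp add: M_def zY)
  obtain f r s where r: "r > 0" "s > 0" "s \<le> 1 / Y" and f: "f holomorphic_on ball 0 r" "f 0 = 0" "deriv f 0 = 1"
    "\<And>w. norm w < r \<Longrightarrow> norm (f w) < 1 / Y \<and> M (f w) = w \<and> f (cnj w) = cnj (f w)"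
    "\<And>z. norm z < s \<Longrightarrow> norm (M z) < r \<and> f (M z) = z"
    by (rule holomorphic_local_inverse[OF Mh Y' M0 dM Mcnj]) (assumption | rule that)+
  have f_nz: "f w \<noteq> 0" if "norm w < r" "w \<noteq> 0" for w using f(4)[OF that(1)] that(2) M0 by auto
  have fcnj: "f (cnj w) = cnj (f w)" if "norm w < r" for w using f(4)[OF that] by blast
  obtain R where R: "R holomorphic_on ball 0 r"
    "\<And>w. norm w < r \<Longrightarrow> w \<noteq> 0 \<Longrightarrow> 1 / f w = 1 / w + R w"
    "\<And>w. norm w < r \<Longrightarrow> R (cnj w) = cnj (R w)"
    by (rule holomorphic_reciprocal_difference[OF f(1) r(1) f(2,3) f_nz fcnj]) (assumption | rule that)+
  \<comment> \<open>The bound \<open>2 * \<delta>\<close> will serve as \<open>q\<close>; this size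
    makes \<open>\<beta> * q^2\<close> at most \<open>\<beta> / (\<beta> + 1)^2\<close>, which is
    below 1.\<close>
  define \<delta> where "\<delta> = min rx (1 / (2 * (\<beta> + 1)))"
  have \<delta>: "\<delta> > 0" "\<delta> \<le> rx" using LxD(2,5) by (simp_all add: \<delta>_def)
  have \<delta>\<beta>: "\<beta> * (2 * \<delta>)\<^sup>2 < 1"
  proof -
    have "2 * \<delta> \<le> 1 / (\<beta> + 1)" using LxD(5) by (simp add: \<delta>_def min_def field_simps)
    then have "(2 * \<delta>)\<^sup>2 \<le> (1 / (\<beta> + 1))\<^sup>2" using \<delta> by (intro power_mono) auto
    then have "\<beta> * (2 * \<delta>)\<^sup>2 \<le> \<beta> * (1 / (\<beta> + 1))\<^sup>2" by (rule mult_left_mono[OF _ LxD(5)])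
    also have "\<dots> < 1" using LxD(5) by (simp add: power_divide divide_less_eq power2_eq_square algebra_simps add_pos_nonneg)
    finally show ?thesis .
  qed
  have v0: "v \<noteq> 0" "1 + 4 * v \<noteq> 0"
  proof -
    have "1 + 4 * v = of_real (1 + 4 * v')" by (simp add: v)
    then show "v \<noteq> 0" "1 + 4 * v \<noteq> 0" using v(2) by (simp_all only: v(1) of_real_eq_0_iff)
  qed
  have roots: "\<forall>\<^sub>F z in at 0. \<exists>P Q p q. P + Q = z * S 0 z \<and> v * (z * S 0 z)\<^sup>2 * (p - q) = P - Q \<and>
    S 0 z = p * P + q * Q - 1 \<and> p = 1 / P + Rx P \<and> q = 1 / Q + Rx Q \<and>
    P \<noteq> 0 \<and> Q \<noteq> 0 \<and> P \<noteq> Q \<and> norm P < \<delta> \<and> norm Q < \<delta>"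
    by (rule commutator_roots_eventually[OF _ Lx(2) v0 \<delta>(1)]) (use Gx in blast)
  have "isCont f 0"
    using f(1) r(1) by (auto dest!: holomorphic_on_imp_continuous_on simp: continuous_on_eq_continuous_at)
  then have f_lim: "(f \<longlongrightarrow> 0) (at 0)" unfolding isCont_def f(2) .
  have ball: "\<forall>\<^sub>F w in at (0::complex). norm w < r"
    using r(1) by (auto simp: eventually_at dist_norm)
  have "\<forall>\<^sub>F w in at 0. f w \<noteq> 0"
    using ball eventually_neq_at_within[of 0] by eventually_elim (rule f_nz)
  with f_lim have "filterlim f (at 0) (at 0)" by (rule filterlim_atI)
  from eventually_conj[OF ball filterlim_iff[THEN iffD1, OF this, rule_format, OF roots]]
  obtain \<epsilon> where \<epsilon>: "\<epsilon> > 0" and \<epsilon>r: "\<And>w::complex. w \<noteq> 0 \<Longrightarrow> norm w < \<epsilon> \<Longrightarrow> norm w < r"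
    and ex: "\<And>w. w \<noteq> 0 \<Longrightarrow> norm w < \<epsilon> \<Longrightarrow> \<exists>P Q p q. P + Q = f w * S 0 (f w) \<and> v * (f w * S 0 (f w))\<^sup>2 * (p - q) = P - Q \<and>
    S 0 (f w) = p * P + q * Q - 1 \<and> p = 1 / P + Rx P \<and> q = 1 / Q + Rx Q \<and>
    P \<noteq> 0 \<and> Q \<noteq> 0 \<and> P \<noteq> Q \<and> norm P < \<delta> \<and> norm Q < \<delta>"
    by (rule eventually_at_0_complexE) blast
  define D where "D = {w::complex. norm w < \<epsilon> \<and> Re w = 0 \<and> Im w < 0}"
  have Dw: "w \<noteq> 0 \<and> norm w < \<epsilon> \<and> norm w < r" if "w \<in> D" for w
  proof -
    have "w \<noteq> 0" "norm w < \<epsilon>" using that by (auto simp: D_def)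
    then show ?thesis using \<epsilon>r by blast
  qed
  define good where "good w N \<longleftrightarrow>
    (\<forall>t. \<bar>t\<bar> \<le> Tx \<longrightarrow> 1 / w - of_real t - N * (of_real t)\<^sup>2 \<noteq> 0 \<and>
       norm (1 / (1 / w - of_real t - N * (of_real t)\<^sup>2)) \<le> 4 * norm w \<and>
       norm (N * of_real t / (1 / w - of_real t - N * (of_real t)\<^sup>2)) \<le> 2 * \<delta>) \<and>
    N * (1 / w - v * (of_real \<beta> * (LINT t|\<pi>. 1 / (1 / w - of_real t - N * (of_real t)\<^sup>2)))) = v \<and>
    R w = Rx 0 + of_real \<beta> * (LINT t|\<pi>. (1 + N * of_real t)\<^sup>2 / (1 / w - of_real t - N * (of_real t)\<^sup>2) + N) +
       N * (1 / w) * (of_real \<beta> * (LINT t|\<pi>. 1 / (1 / w - of_real t - N * (of_real t)\<^sup>2)))" for w N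
  have "\<exists>N. good w N" if "w \<in> D" for w
  proof -
    note w = Dw[OF that]
    have fw: "f w \<noteq> 0" "w = f w * S 0 (f w)" using f_nz f(4)[of w] w by (auto simp: M_def)
    then have S0: "S 0 (f w) \<noteq> 0" using w by auto
    have Rw: "R w = 1 / f w - 1 / w" using R(2)[of w] w by simp
    obtain N where "good w N"
      unfolding good_def Rw
      by (rule commutator_levy_kernel[OF Lx(1) fw(1) S0 \<delta>(2) fw(2) ex]) (use w in \<open>blast+\<close>)
    then show ?thesis by blast
  qed
  then obtain N where N: "\<And>w. w \<in> D \<Longrightarrow> good w (N w)" by metis
  have \<alpha>: "Rx 0 = of_real (Re (Rx 0))"
    using LxD(6)[of 0] LxD(2) by (simp add: complex_eq_iff)
  have "psd_kernel D (\<lambda>w z. - (R w - cnj (R z)) / (1 / w - cnj (1 / z)))"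
  proof (rule commutator_kernel_psd[OF LxD(4,5) v(2), where N = N and q = "2 * \<delta>" and \<alpha> = "Re (Rx 0)"
        and D = "\<lambda>w. 4 * norm w" and H = "\<lambda>w. of_real \<beta> * (LINT t|\<pi>. 1 / (1 / w - of_real t - N w * (of_real t)\<^sup>2))"])
    fix w z assume "w \<in> D" "z \<in> D"
    then have "Im w < 0" "Im (cnj z) > 0" "w \<noteq> 0" "z \<noteq> 0" by (auto simp: D_def)
    then show "1 / w \<noteq> cnj (1 / z)" by auto
  qed (use N \<delta>\<beta> in \<open>simp_all only: good_def \<alpha>[symmetric] v(1)[symmetric], blast+\<close>)
  then have "psd_kernel D (\<lambda>w z. w * cnj z * (R w - R (cnj z)) / (w - cnj z))"
  proof (rule psd_kernel_cong)
    fix w z assume wz: "w \<in> D" "z \<in> D"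
    then have "Im w < 0" "Im (cnj z) > 0" by (auto simp: D_def)
    then have ne: "w - cnj z \<noteq> 0" by auto
    have nz: "w \<noteq> 0" "cnj z \<noteq> 0" using Dw wz by auto
    have *: "- a / (- b / c) = c * a / b" for a b c :: complex by simp
    have "1 / w - cnj (1 / z) = - (w - cnj z) / (w * cnj z)" using nz by (simp add: field_simps)
    then show "- (R w - cnj (R z)) / (1 / w - cnj (1 / z)) = w * cnj z * (R w - R (cnj z)) / (w - cnj z)"
      using R(3)[of z] Dw[OF wz(2)] by (simp only: * simp_thms)
  qed
  then have "conditionally_psd_kernel D (\<lambda>w z. w * cnj z * (R w - R (cnj z)) / (w - cnj z))"
    by (rule psd_imp_conditionally_psd)
  have "\<epsilon> \<le> r"
  proof (rule ccontr)
    assume "\<not> \<epsilon> \<le> r"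
    then show False using \<epsilon>r[of "of_real r"] r(1) by simp
  qed
  have R\<epsilon>: "R holomorphic_on ball 0 \<epsilon>" by (rule holomorphic_on_subset[OF R(1)]) (use \<open>\<epsilon> \<le> r\<close> in auto)
  have R\<epsilon>c: "R (cnj w) = cnj (R w)" if "norm w < \<epsilon>" for w using R(3) that \<open>\<epsilon> \<le> r\<close> by simp
  obtain T \<beta>' \<pi>' where T: "compact_distribution T \<pi>'" "\<beta>' \<ge> 0"
    "\<And>w. norm w * T < 1 \<Longrightarrow> norm w < \<epsilon> \<Longrightarrow> R w = R 0 + of_real \<beta>' * (LINT t|\<pi>'. w / (1 - w * of_real t))"
    by (rule nevanlinna_representation[OF R\<epsilon> \<epsilon> R\<epsilon>c \<open>conditionally_psd_kernel D _\<close>[unfolded D_def]])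
      (assumption | rule that)+
  have T0: "T > 0" by (rule compact_distributionD(2)[OF T(1)])
  define r' where "r' = min \<epsilon> (1 / (2 * T))"
  have r': "r' > 0" "r' \<le> \<epsilon>" "r' \<le> 1 / (2 * T)" using \<epsilon> T0 by (simp_all add: r'_def)
  have r'T: "r' * T \<le> 1 / 2" using r'(3) T0 by (simp add: field_simps)
  have rep: "levy_representation R r' T \<beta>' \<pi>'"
    unfolding levy_representation_def
  proof (intro conjI allI impI)
    show "R holomorphic_on ball 0 r'" by (rule holomorphic_on_subset[OF R\<epsilon>]) (use r' in auto)
    fix w :: complex assume w: "norm w < r'"
    have wT: "norm w * T < 1" using r'T mult_strict_right_mono[OF w T0] by linarith
    have w\<epsilon>: "norm w < \<epsilon>" using w r'(2) by simp
    show "R w = R 0 + of_real \<beta>' * (LINT t|\<pi>'. w / (1 - w * of_real t))" by (rule T(3)[OF wT w\<epsilon>])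
    show "R (cnj w) = cnj (R w)" by (rule R\<epsilon>c[OF w\<epsilon>])
  qed (rule r'(1) r'T T(1,2))+
  have "isCont M 0"
    using Mh Y' by (auto dest!: holomorphic_on_imp_continuous_on simp: continuous_on_eq_continuous_at)
  then obtain s' where s': "s' > 0" "\<And>z. norm z < s' \<Longrightarrow> norm (M z) < r'"
    using r'(1) M0 unfolding continuous_at_eps_delta by (auto simp: dist_norm)
  show thesis
  proof
    show "levy_representation R r' T \<beta>' \<pi>'" by (rule rep)
    show "min s s' > 0" using s' r(2) by simp
    fix z :: complex assume z: "z \<noteq> 0" "norm z < min s s'"
    have fz: "norm (M z) < r" "f (M z) = z" using f(5)[of z] z by auto
    have Mz: "M z \<noteq> 0" using fz(2) f(2) z(1) by auto
    show "norm z * Y < 1 \<and> z * S 0 z \<noteq> 0 \<and> norm (z * S 0 z) < r' \<and> 1 / z = 1 / (z * S 0 z) + R (z * S 0 z)"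
      unfolding M_def[symmetric] zY using R(2)[OF fz(1) Mz] fz Mz z s'(2)[of z] r(3) by simp
  qed
qed

text \<open>The law built from \<open>R\<close> has Cauchy transform \<open>w\<close> at
  \<open>1 / w + R w\<close>. At \<open>w = z * S 0 z\<close> that argument is \<open>1 / z\<close>,
  so its moment generating function is \<open>S 0\<close> near 0 and all moments agree.\<close>

lemma commutator_distribution:
  assumes "freely_infinitely_divisible \<mu>" and "v = complex_of_real v'" "v' > 0"
    and "\<And>n. cnj (t n 0) = t n 0"
  obtains \<nu> T where "compact_distribution T \<nu>" "freely_infinitely_divisible \<nu>"
    "\<And>n. complex_of_real (LINT u|\<nu>. u ^ n) = t n 0"
proof -
  obtain R r T \<beta> \<pi> s where L: "levy_representation R r T \<beta> \<pi>" and s: "s > 0"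
    and R: "\<And>z. z \<noteq> 0 \<Longrightarrow> norm z < s \<Longrightarrow> norm z * Y < 1 \<and> z * S 0 z \<noteq> 0 \<and> norm (z * S 0 z) < r \<and>
       1 / z = 1 / (z * S 0 z) + R (z * S 0 z)"
    by (rule commutator_levy_representation[OF assms]) (rule that, assumption+)
  obtain \<nu> T' \<epsilon> where \<nu>: "compact_distribution T' \<nu>" "freely_infinitely_divisible \<nu>" "\<epsilon> > 0"
    and G: "\<And>w. w \<noteq> 0 \<Longrightarrow> norm w < \<epsilon> \<Longrightarrow> norm (w / (1 + w * R w)) * T' < 1 \<and> 1 + w * R w \<noteq> 0 \<and>
       (LINT t|\<nu>. 1 / (1 / w + R w - complex_of_real t)) = w"
    by (rule levy_representation_imp_freely_infinitely_divisible[OF L]) (rule that, assumption+)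
  interpret \<mu>: real_distribution \<mu> using \<mu> by (rule compact_distributionD)
  interpret \<nu>: real_distribution \<nu> using \<nu>(1) by (rule compact_distributionD)
  have "isCont (\<lambda>z. z * S 0 z) 0" by (intro continuous_intros S_isCont)
  then obtain s' where s': "s' > 0" "\<And>z. norm z < s' \<Longrightarrow> norm (z * S 0 z) < \<epsilon>"
    using \<nu>(3) unfolding continuous_at_eps_delta by (auto simp: dist_norm)
  have key: "norm z * Y < 1 \<and> norm z * T' < 1 \<and> (LINT t|\<nu>. 1 / (1 - z * complex_of_real t)) = S 0 z"
    if z: "norm z < min s s'" for z
  proof (cases "z = 0")
    case True
    then show ?thesis using init[of 0] \<mu>.prob_space \<nu>.prob_space by (simp add: S_zero)
  next
    case False
    define w where "w = z * S 0 z"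
    have Rz: "norm z * Y < 1" "w \<noteq> 0" "1 / z = 1 / w + R w" using R[OF False] z by (auto simp: w_def)
    have w: "norm w < \<epsilon>" using s'(2)[of z] z by (simp add: w_def)
    note Gw = G[OF Rz(2) w]
    have "1 / z * (z * w) = (1 / w + R w) * (z * w)" unfolding Rz(3) ..
    then have "w = z * (1 + w * R w)" using False Rz(2) by (simp add: algebra_simps)
    then have "z * (1 + w * R w) = w" by (rule sym)
    moreover have nz: "1 + w * R w \<noteq> 0" using Gw by blast
    ultimately have "z = w / (1 + w * R w)" by (simp only: nonzero_eq_divide_eq[OF nz])
    then have zT: "norm z * T' < 1" using Gw by simp
    have "w = (LINT t|\<nu>. 1 / (1 / z - complex_of_real t))" using Gw Rz(3) by simp
    also have "\<dots> = (LINT t|\<nu>. z * (1 / (1 - z * complex_of_real t)))"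
    proof -
      have "1 / (1 / z - complex_of_real t) = z * (1 / (1 - z * complex_of_real t))" for t
      proof -
        have "1 / z - complex_of_real t = (1 - z * complex_of_real t) / z" using False by (simp add: field_simps)
        then show ?thesis by simp
      qed
      then show ?thesis by simp
    qed
    also have "\<dots> = z * (LINT t|\<nu>. 1 / (1 - z * complex_of_real t))" by (rule integral_mult_right_zero)
    finally show ?thesis using Rz(1) zT False by (simp add: w_def)
  qed
  show thesis
  proof
    show "compact_distribution T' \<nu>" "freely_infinitely_divisible \<nu>" by (rule \<nu>)+
    show "complex_of_real (LINT u|\<nu>. u ^ n) = t n 0" for n
    proof (rule power_series_unique_coeffs[where f = "S 0" and n = n])
      show "min s s' > 0" using s s' by simp
      fix w :: complex assume w: "norm w < min s s'"
      show "(\<lambda>n. complex_of_real (LINT u|\<nu>. u ^ n) * w ^ n) sums S 0 w"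
        using compact_distribution_moment_series[OF \<nu>(1), of w] key[OF w] by simp
      show "(\<lambda>n. t n 0 * w ^ n) sums S 0 w" by (rule sums_S) (use key[OF w] in blast)
    qed
  qed
qed

end

section \<open>Elements of the algebra and their laws\<close>

lemma is_distribution_imp_compact_distribution:
  assumes "is_distribution \<tau> a \<mu>"
  obtains B where "compact_distribution B \<mu>"
proof -
  obtain K where \<mu>: "real_distribution \<mu>" and K: "compact K" "measure \<mu> K = 1"
    using assms unfolding is_distribution_def by blast
  interpret real_distribution \<mu> by (rule \<mu>)
  obtain B where B: "B > 0" "\<And>t. t \<in> K \<Longrightarrow> \<bar>t\<bar> \<le> B"
    using compact_imp_bounded[OF K(1)] unfolding bounded_pos by auto
  have "K \<in> events" using borel_compact[OF K(1)] by simp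
  then have "AE t in \<mu>. t \<in> K" using K(2) by (rule prob_eq_1[THEN iffD1])
  then have "AE t in \<mu>. \<bar>t\<bar> \<le> B" by eventually_elim (rule B(2))
  then show thesis using \<mu> B(1) that by (simp add: compact_distribution_def)
qed

lemma compact_distribution_imp_is_distribution:
  assumes \<nu>: "compact_distribution T \<nu>" and m: "\<And>n. complex_of_real (LINT t|\<nu>. t ^ n) = \<tau> (a ^ n)"
  shows "is_distribution \<tau> a \<nu>"
proof -
  interpret real_distribution \<nu> using \<nu> by (rule compact_distributionD)
  have "{- T..T} \<in> events" by simp
  moreover have "AE t in \<nu>. t \<in> {- T..T}"
    using compact_distributionD(3)[OF \<nu>] by eventually_elim auto
  ultimately have "prob {- T..T} = 1" by (rule prob_eq_1[THEN iffD2])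
  then show ?thesis
    unfolding is_distribution_def using m compactI compact_Icc real_distribution_axioms by blast
qed

context semicircular_pair begin

lemma t_real:
  assumes "selfadjoint x" "selfadjoint s"
  shows "cnj (t n 0) = t n 0"
proof -
  have "star y = y"
    using assms unfolding y_def commutator_def selfadjoint_def
    by (simp add: star_add star_scaleC star_diff star_mult scaleC_minus_left scaleC_diff_right)
  then have "star (y ^ n) = y ^ n" by (simp add: star_power)
  then show ?thesis using tau_star[of "y ^ n"] by (simp add: t_def)
qed

lemma commutator_series_t:
  assumes \<mu>: "compact_distribution B \<mu>" and m: "\<And>n. complex_of_real (LINT u|\<mu>. u ^ n) = \<tau> (x ^ n)"
  shows "commutator_series t v (norm x) (norm y + 1) B \<mu>"
proof
  show "norm (t n j) \<le> (norm y + 1) ^ n * norm x ^ j" for n j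
  proof -
    have "norm y ^ n * norm x ^ j \<le> (norm y + 1) ^ n * norm x ^ j"
      by (intro mult_right_mono power_mono) auto
    then show ?thesis by (rule order_trans[OF t_bound])
  qed
  show "t 0 j = complex_of_real (LINT u|\<mu>. u ^ j)" for j
    unfolding m by (simp add: t_def)
  show "norm y + 1 > 0" by (rule add_nonneg_pos) simp_all
qed (rule moment_recursion norm_ge_zero \<mu>)+

end

theorem theorem1p3:
  fixes \<tau> :: "'a::unital_cstar_algebra \<Rightarrow> complex"
    and x s :: 'a
    and \<mu> :: "real measure"
  assumes "ncps \<tau>"
    and "selfadjoint x" and "selfadjoint s"
    and "freely_independent \<tau> x s"
    and "is_distribution \<tau> x \<mu>" and "freely_infinitely_divisible \<mu>"
    and "semicircular \<tau> s"
  shows "\<exists>\<nu>. is_distribution \<tau> (x + \<i> *\<^sub>C commutator x s) \<nu> \<and> freely_infinitely_divisible \<nu>"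
proof -
  interpret ncps \<tau> by fact
  obtain v where v: "v > 0" and sm: "\<And>n. \<tau> (s ^ n) = pairing_weight (complex_of_real v) 0 n"
    using semicircular_moments[OF unit assms(7)] by blast
  interpret semicircular_pair \<tau> x s "complex_of_real v"
    by unfold_locales (simp_all only: assms(4) sm pairing_weight_catalan)
  obtain B where B: "compact_distribution B \<mu>"
    by (rule is_distribution_imp_compact_distribution[OF assms(5)])
  have m: "complex_of_real (LINT u|\<mu>. u ^ n) = \<tau> (x ^ n)" for n
    using assms(5) unfolding is_distribution_def by blast
  obtain \<nu> T where \<nu>: "compact_distribution T \<nu>" "freely_infinitely_divisible \<nu>"
    "\<And>n. complex_of_real (LINT u|\<nu>. u ^ n) = t n 0"
    by (rule commutator_series.commutator_distribution[OF commutator_series_t[OF B m] assms(6) refl v t_real[OF assms(2,3)]])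
      (assumption | rule that)+
  have "is_distribution \<tau> y \<nu>"
    by (rule compact_distribution_imp_is_distribution[OF \<nu>(1)]) (simp add: \<nu>(3) t_def)
  with \<nu>(2) show ?thesis unfolding y_def by blast
qed

end
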